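(* Let $n\ge 3$, $1\le k\le n-1$, and let $F_1$ be a Minkowski norm on $\mathbb{R}^n$ invariant under the standard block diagonal action of $SO(k)\times SO(n-k)$, with Hessian metric $g_1$. Let $V'=\mathrm{span}(e_1,\dots,e_k)$, $V''=\mathrm{span}(e_{k+1},\dots,e_n)$. Let $C(U_1)\subset\mathbb{R}^n\setminus\{0\}$ be a connected $SO(k)\times SO(n-k)$-invariant conic open set such that $g_1|_y(v',v'')=0$ for all $y\in C(U_1)$, $v'\in V'$, $v''\in V''$. Then $F_1$ is Euclidean on $C(U_1)$, i.e. there is a positive definite symmetric matrix $(\alpha_{ij})$ with $F_1(x)=\sqrt{\sum\alpha_{ij}x_ix_j}$ for all $x\in C(U_1)$. Moreover, for any Minkowski norm $F_2$ invariant under the same action and any local Hessian isometry $\Phi$ from $F_1$ to $F_2$ defined on $C(U_1)$ which maps $SO(k)\times SO(n-k)$-orbits into $SO(k)\times SO(n-k)$-orbits, $\Phi$ is the restriction to $C(U_1)$ of an invertible linear map, and $F_2$ restricted to $C(U_2)=\Phi(C(U_1))$ is Euclidean (coincides there with the square root of a positive definite quadratic form).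
   Context: A Minkowski norm on $\mathbb{R}^n$ is a continuous function $F:\mathbb{R}^n\to\mathbb{R}_{\ge 0}$, smooth and positive on $\mathbb{R}^n\setminus\{0\}$, positively $1$-homogeneous, such that the Hessian of $E=\tfrac12F^2$ is positive definite on $\mathbb{R}^n\setminus\{0\}$; its Hessian metric is $g=\mathrm{d}^2E$. The standard block diagonal action of $SO(k)\times SO(n-k)$ is left multiplication by $\mathrm{diag}(A',A'')$, $A'\in SO(k)$, $A''\in SO(n-k)$. A conic set is one of the form $\{\lambda y\mid y\in U,\lambda>0\}$. A local Hessian isometry from $F_1$ to $F_2$ defined on a conic open set $C(U_1)$ is a positively $1$-homogeneous diffeomorphism $\Phi:C(U_1)\to C(U_2)$ onto a conic open set with $\Phi^*g_2=g_1$. *)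

theory Defs
  imports "HOL-Analysis.Analysis"
begin

text \<open>R^n is modelled as real^('a + 'b): the indices Inl i span V' (k = CARD('a)),
  the indices Inr j span V'' (n - k = CARD('b)).\<close>

type_synonym ('a, 'b) vec = "real ^ ('a + 'b)"

primrec Ck_on :: "nat \<Rightarrow> 'x::euclidean_space set \<Rightarrow> ('x \<Rightarrow> 'y::real_normed_vector) \<Rightarrow> bool" where
  "Ck_on 0 S f = continuous_on S f"
| "Ck_on (Suc m) S f = (f differentiable_on S \<and>
      (\<forall>v. Ck_on m S (\<lambda>x. frechet_derivative f (at x) v)))"

definition smooth_on :: "'x::euclidean_space set \<Rightarrow> ('x \<Rightarrow> 'y::real_normed_vector) \<Rightarrow> bool" where
  "smooth_on S f \<longleftrightarrow> (\<forall>m. Ck_on m S f)"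

definition hess :: "('x::euclidean_space \<Rightarrow> real) \<Rightarrow> 'x \<Rightarrow> 'x \<Rightarrow> 'x \<Rightarrow> real" where
  "hess E y u v = frechet_derivative (\<lambda>x. frechet_derivative E (at x) u) (at y) v"

definition hess_metric :: "('x::euclidean_space \<Rightarrow> real) \<Rightarrow> 'x \<Rightarrow> 'x \<Rightarrow> 'x \<Rightarrow> real" where
  "hess_metric F = hess (\<lambda>x. (F x)\<^sup>2 / 2)"

definition minkowski_norm :: "('x::euclidean_space \<Rightarrow> real) \<Rightarrow> bool" where
  "minkowski_norm F \<longleftrightarrow>
     continuous_on UNIV F \<and> (\<forall>x. F x \<ge> 0) \<and>
     smooth_on (UNIV - {0}) F \<and> (\<forall>y. y \<noteq> 0 \<longrightarrow> F y > 0) \<and>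
     (\<forall>y. \<forall>t>0. F (t *\<^sub>R y) = t * F y) \<and>
     (\<forall>y. y \<noteq> 0 \<longrightarrow> (\<forall>v. v \<noteq> 0 \<longrightarrow> hess_metric F y v v > 0))"

definition SO_mat :: "(real ^ 'a ^ 'a) set" where
  "SO_mat = {A. orthogonal_matrix A \<and> det A = 1}"

definition block_act :: "real ^ 'a ^ 'a \<Rightarrow> real ^ 'b ^ 'b \<Rightarrow> ('a, 'b) vec \<Rightarrow> ('a, 'b) vec" where
  "block_act A1 A2 x = (\<chi> i. case i of
       Inl p \<Rightarrow> (A1 *v (\<chi> q. x $ Inl q)) $ p
     | Inr p \<Rightarrow> (A2 *v (\<chi> q. x $ Inr q)) $ p)"

definition G_invariant_fun :: "(('a::finite, 'b::finite) vec \<Rightarrow> real) \<Rightarrow> bool" where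
  "G_invariant_fun F \<longleftrightarrow>
     (\<forall>A1\<in>SO_mat. \<forall>A2\<in>SO_mat. \<forall>x. F (block_act A1 A2 x) = F x)"

definition G_invariant_set :: "('a::finite, 'b::finite) vec set \<Rightarrow> bool" where
  "G_invariant_set C \<longleftrightarrow>
     (\<forall>A1\<in>SO_mat. \<forall>A2\<in>SO_mat. \<forall>x\<in>C. block_act A1 A2 x \<in> C)"

definition maps_orbits_into_orbits ::
  "(('a::finite, 'b::finite) vec \<Rightarrow> ('a, 'b) vec) \<Rightarrow> ('a, 'b) vec set \<Rightarrow> bool" where
  "maps_orbits_into_orbits \<Phi> C \<longleftrightarrow>
     (\<forall>y\<in>C. \<forall>A1\<in>SO_mat. \<forall>A2\<in>SO_mat. \<exists>B1\<in>SO_mat. \<exists>B2\<in>SO_mat.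
        \<Phi> (block_act A1 A2 y) = block_act B1 B2 (\<Phi> y))"

definition conic_open :: "'x::euclidean_space set \<Rightarrow> bool" where
  "conic_open C \<longleftrightarrow> open C \<and> 0 \<notin> C \<and> (\<forall>y\<in>C. \<forall>t>0. t *\<^sub>R y \<in> C)"

definition diffeo_onto :: "('x::euclidean_space \<Rightarrow> 'x) \<Rightarrow> 'x set \<Rightarrow> 'x set \<Rightarrow> bool" where
  "diffeo_onto \<Phi> C1 C2 \<longleftrightarrow> bij_betw \<Phi> C1 C2 \<and> smooth_on C1 \<Phi> \<and>
     smooth_on C2 (inv_into C1 \<Phi>)"

definition local_hessian_isometry ::
  "('x::euclidean_space \<Rightarrow> real) \<Rightarrow> ('x \<Rightarrow> real) \<Rightarrow> ('x \<Rightarrow> 'x) \<Rightarrow> 'x set \<Rightarrow> bool" where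
  "local_hessian_isometry F1 F2 \<Phi> C1 \<longleftrightarrow>
     conic_open C1 \<and> conic_open (\<Phi> ` C1) \<and> diffeo_onto \<Phi> C1 (\<Phi> ` C1) \<and>
     (\<forall>y\<in>C1. \<forall>t>0. \<Phi> (t *\<^sub>R y) = t *\<^sub>R \<Phi> y) \<and>
     (\<forall>y\<in>C1. \<forall>u v. hess_metric F2 (\<Phi> y)
          (frechet_derivative \<Phi> (at y) u) (frechet_derivative \<Phi> (at y) v)
        = hess_metric F1 y u v)"

definition euclidean_on :: "(real ^ 'n \<Rightarrow> real) \<Rightarrow> (real ^ 'n) set \<Rightarrow> bool" where
  "euclidean_on F C \<longleftrightarrow>
     (\<exists>\<alpha> :: real ^ 'n ^ 'n. transpose \<alpha> = \<alpha> \<and> (\<forall>x. x \<noteq> 0 \<longrightarrow> x \<bullet> (\<alpha> *v x) > 0) \<and>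
        (\<forall>x\<in>C. F x = sqrt (\<Sum>i\<in>UNIV. \<Sum>j\<in>UNIV. \<alpha> $ i $ j * x $ i * x $ j)))"

definition V1 :: "('a::finite, 'b::finite) vec set" where
  "V1 = {v. \<forall>j. v $ Inr j = 0}"

definition V2 :: "('a::finite, 'b::finite) vec set" where
  "V2 = {v. \<forall>i. v $ Inl i = 0}"

end

theory Submission
  imports Defs
begin

text \<open>
Let E = F^2/2. By invariance the V'-part of the gradient of E at y is a multiple a(y) y' of the
V'-component y' of y. The coefficient a is constant along orbits (invariance), along V''
(orthogonality hypothesis) and along y (homogeneity), so it is locally constant where y' and y''
do not vanish. Hence the third derivative of E vanishes on a dense subset of the cone, and E is a
quadratic form there.

For a Hessian isometry \<Phi> mapping orbits into orbits, the Levi-Civita argument expresses the second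
derivative of \<Phi> through the Cartan tensor (third derivative of the energy) of F2, which vanishes on
vectors tangent to an orbit. Comparing the metrics induced on nearby orbits shows that \<Phi> respects
or exchanges the two sphere factors of an orbit and is homothetic on each. A great circle is
mapped to a curve f with f'' = -c^2 f; since \<Phi> is injective, c = 1. This fixes the radial derivatives
of the energy of F2 at \<Phi>(y), and the isometry equation in the radial direction becomes a vanishing
sum of two squares, which forces the second derivative of \<Phi> to vanish.
\<close>

section \<open>Calculus\<close>

text \<open>The pointwise equations only yield some positive frequency c. Its value is read off a
  whole great circle, which lies in the domain because the cone is invariant under the group. A
  block of dimension 1 has a trivial rotation group: no tangent vectors, no great circle, and no
  control of the sign of its gradient coefficient. Since n >= 3, the other block is then wide, and
  Euler's identity transfers the radial information from it to the thin block. If both blocks are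
  wide, straight and crossed points might a priori accumulate at each other, while the final
  argument differentiates identities that hold on an open set of one kind. The derivative of the
  target energy along the first component of \<Phi>(x) is a |x'|^2 at a straight point and b |x''|^2
  at a crossed one, so off the hypersurface a |x'|^2 = b |x''|^2 the kind is locally constant;
  points on it are reached by density. Source and target splittings are independent parameters, so
  that exchanging the target blocks alone turns crossed points into straight ones.\<close>

lemma has_derivative_at_frechet:
  assumes "f differentiable_on S" "open S" "x \<in> S"
  shows "(f has_derivative frechet_derivative f (at x)) (at x)"
  using assms by (metis differentiable_on_eq_differentiable_at frechet_derivative_works)

text \<open>\<open>frechet_derivative\<close> is taken in the whole space and sees only germs;
  openness of S makes \<open>Ck_on\<close> depend on the values on S alone.\<close>

lemma Ck_on_cong:
  assumes "open S" "\<And>x. x \<in> S \<Longrightarrow> f x = g x" "Ck_on m S f"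
  shows "Ck_on m S g"
  using assms(2,3)
proof (induction m arbitrary: f g)
  case 0
  then show ?case by (simp cong: continuous_on_cong)
next
  case (Suc m)
  have d: "(g has_derivative frechet_derivative f (at x)) (at x)" if "x \<in> S" for x
    using has_derivative_at_frechet[of f S x] that Suc.prems assms(1)
    by (intro has_derivative_transform_within_open[of f _ x UNIV S g]) auto
  have "g differentiable_on S"
    unfolding differentiable_on_def using d
    by (meson differentiable_def has_derivative_at_withinI)
  moreover have "Ck_on m S (\<lambda>x. frechet_derivative g (at x) v)" for v
  proof (rule Suc.IH)
    show "Ck_on m S (\<lambda>x. frechet_derivative f (at x) v)" using Suc.prems by simp
    show "frechet_derivative f (at x) v = frechet_derivative g (at x) v" if "x \<in> S" for x
      using frechet_derivative_at[OF d[OF that]] by simp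
  qed
  ultimately show ?case by simp
qed

lemma Ck_on_SucD: "Ck_on (Suc m) S f \<Longrightarrow> Ck_on m S f"
proof (induction m arbitrary: f)
  case 0
  then show ?case by (simp add: differentiable_imp_continuous_on)
next
  case (Suc m)
  then show ?case by (metis Ck_on.simps(2))
qed

lemma Ck_on_SucI:
  assumes "open S" "\<And>x. x \<in> S \<Longrightarrow> (f has_derivative D x) (at x)"
    "\<And>v. Ck_on m S (\<lambda>x. D x v)"
  shows "Ck_on (Suc m) S f"
proof -
  have "f differentiable_on S"
    unfolding differentiable_on_def using assms(2)
    by (meson differentiable_def has_derivative_at_withinI)
  moreover have "Ck_on m S (\<lambda>x. frechet_derivative f (at x) v)" for v
    by (rule Ck_on_cong[OF assms(1) _ assms(3)[of v]])
       (use frechet_derivative_at[OF assms(2)] in simp)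
  ultimately show ?thesis by simp
qed

lemma Ck_on_add:
  assumes "open S" "Ck_on m S f" "Ck_on m S g"
  shows "Ck_on m S (\<lambda>x. f x + g x)"
  using assms(2,3)
proof (induction m arbitrary: f g)
  case 0
  then show ?case by (simp add: continuous_on_add)
next
  case (Suc m)
  show ?case
  proof (rule Ck_on_SucI[OF assms(1)])
    show "((\<lambda>x. f x + g x) has_derivative
        (\<lambda>v. frechet_derivative f (at x) v + frechet_derivative g (at x) v)) (at x)" if "x \<in> S" for x
      using Suc.prems that assms(1) by (intro has_derivative_add has_derivative_at_frechet) auto
  qed (use Suc in auto)
qed

lemma Ck_on_mult:
  fixes f g :: "'x::euclidean_space \<Rightarrow> real"
  assumes "open S" "Ck_on m S f" "Ck_on m S g"
  shows "Ck_on m S (\<lambda>x. f x * g x)"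
  using assms(2,3)
proof (induction m arbitrary: f g)
  case 0
  then show ?case by (simp add: continuous_on_mult)
next
  case (Suc m)
  show ?case
  proof (rule Ck_on_SucI[OF assms(1)])
    show "((\<lambda>x. f x * g x) has_derivative
        (\<lambda>v. f x * frechet_derivative g (at x) v + frechet_derivative f (at x) v * g x)) (at x)"
      if "x \<in> S" for x
      using Suc.prems that assms(1) by (intro has_derivative_mult has_derivative_at_frechet) auto
    show "Ck_on m S (\<lambda>x. f x * frechet_derivative g (at x) v + frechet_derivative f (at x) v * g x)" for v
      using Suc.prems by (intro Ck_on_add Suc.IH assms(1)) (auto intro: Ck_on_SucD)
  qed
qed

lemma Ck_on_const:
  assumes "open S"
  shows "Ck_on m S (\<lambda>x. c)"
proof (induction m arbitrary: c)
  case (Suc m)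
  show ?case by (rule Ck_on_SucI[OF assms, where D = "\<lambda>x v. 0"]) (auto intro: Suc)
qed simp

lemma has_vector_derivative_along_curve:
  assumes "(f has_derivative D) (at (c t))" "(c has_vector_derivative w) (at t)"
  shows "((\<lambda>t. f (c t)) has_vector_derivative D w) (at t)"
  using vector_derivative_diff_chain_within[of c w t UNIV f D] assms
  by (simp add: o_def has_derivative_at_withinI)

lemma has_real_derivative_along_line:
  fixes f :: "'x::real_normed_vector \<Rightarrow> real"
  assumes "(f has_derivative D) (at (a + s *\<^sub>R w))"
  shows "((\<lambda>s. f (a + s *\<^sub>R w)) has_real_derivative D w) (at s)"
  unfolding has_real_derivative_iff_has_vector_derivative
  by (rule has_vector_derivative_along_curve[where c = "\<lambda>s. a + s *\<^sub>R w", OF assms])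
     (auto intro!: derivative_eq_intros)

text \<open>Schwarz's theorem. The mixed second difference \<open>L\<close> over a small
  parallelogram is evaluated by two mean value theorems, in either order of the directions. This
  yields equal values of the two mixed derivatives at points near y, and continuity brings them to
  y.\<close>

lemma second_derivative_symmetric:
  fixes f :: "'x::real_normed_vector \<Rightarrow> real"
  assumes S: "open S" "y \<in> S"
    and D: "\<And>x. x \<in> S \<Longrightarrow> (f has_derivative D x) (at x)"
    and D2: "\<And>x w. x \<in> S \<Longrightarrow> ((\<lambda>x. D x w) has_derivative D2 x w) (at x)"
    and c: "\<And>w z. continuous_on S (\<lambda>x. D2 x w z)"
  shows "D2 y u v = D2 y v u"
proof (rule ccontr)
  assume ne: "D2 y u v \<noteq> D2 y v u"
  \<comment> \<open>Half the gap: one number cannot be closer than \<open>e\<close> to both mixed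
    derivatives at y.\<close>
  define e where "e = \<bar>D2 y u v - D2 y v u\<bar> / 2"
  have e: "e > 0" using ne by (simp add: e_def)
  have cont: "isCont (\<lambda>x. D2 x w z) y" for w z
    using c S continuous_on_eq_continuous_at by blast
  obtain d0 where d0: "d0 > 0" "ball y d0 \<subseteq> S" using S open_contains_ball by blast
  obtain d1 where d1: "d1 > 0" "\<And>x. dist x y < d1 \<Longrightarrow> dist (D2 x u v) (D2 y u v) < e"
    using cont[of u v] e unfolding continuous_at_eps_delta by blast
  obtain d2 where d2: "d2 > 0" "\<And>x. dist x y < d2 \<Longrightarrow> dist (D2 x v u) (D2 y v u) < e"
    using cont[of v u] e unfolding continuous_at_eps_delta by blast
  define d where "d = min d0 (min d1 d2)"
  have d: "d > 0" using d0 d1 d2 by (simp add: d_def)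
  define h where "h = d / (norm u + norm v + 1) / 2"
  have hpos: "h > 0" using d by (simp add: h_def add_nonneg_pos)
  have hsmall: "h * (norm u + norm v) < d"
  proof -
    have "h * (norm u + norm v) \<le> h * (norm u + norm v + 1)" using hpos by (simp add: algebra_simps)
    also have "\<dots> = d / 2"
      using add_nonneg_pos[of "norm u + norm v" 1] by (simp add: h_def field_simps)
    finally show ?thesis using d by simp
  qed
  have close: "dist (y + s *\<^sub>R u + t *\<^sub>R v) y < d" if "0 \<le> s" "s \<le> h" "0 \<le> t" "t \<le> h" for s t
  proof -
    have "dist (y + s *\<^sub>R u + t *\<^sub>R v) y = norm (s *\<^sub>R u + t *\<^sub>R v)" by (simp add: dist_norm algebra_simps)
    also have "\<dots> \<le> s * norm u + t * norm v" using norm_triangle_ineq[of "s *\<^sub>R u" "t *\<^sub>R v"] that by simp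
    also have "\<dots> \<le> h * norm u + h * norm v" using that by (intro add_mono mult_right_mono) auto
    finally show ?thesis using hsmall by (simp add: algebra_simps)
  qed
  have inS: "y + s *\<^sub>R u + t *\<^sub>R v \<in> S" if "0 \<le> s" "s \<le> h" "0 \<le> t" "t \<le> h" for s t
    using close[OF that] d0(2) by (auto simp: d_def dist_commute subset_iff)
  define L where "L = f (y + h *\<^sub>R u + h *\<^sub>R v) - f (y + h *\<^sub>R u) - f (y + h *\<^sub>R v) + f y"
  have "\<exists>s t. 0 < s \<and> s < h \<and> 0 < t \<and> t < h \<and> L = h * h * D2 (y + s *\<^sub>R u + t *\<^sub>R v) u v"
  proof -
    define p where "p s = f (y + h *\<^sub>R v + s *\<^sub>R u) - f (y + s *\<^sub>R u)" for s
    have "\<exists>s. 0 < s \<and> s < h \<and> p h - p 0 = (h - 0) * (D (y + h *\<^sub>R v + s *\<^sub>R u) u - D (y + s *\<^sub>R u) u)"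
      unfolding p_def
    proof (rule MVT2[OF hpos])
      fix s assume s: "0 \<le> s" "s \<le> h"
      have "y + h *\<^sub>R v + s *\<^sub>R u \<in> S" "y + s *\<^sub>R u \<in> S"
        using inS[of s h] inS[of s 0] s hpos by (simp_all add: add_ac)
      then show "((\<lambda>s. f (y + h *\<^sub>R v + s *\<^sub>R u) - f (y + s *\<^sub>R u)) has_real_derivative
          D (y + h *\<^sub>R v + s *\<^sub>R u) u - D (y + s *\<^sub>R u) u) (at s)"
        by (intro DERIV_diff has_real_derivative_along_line D)
    qed
    then obtain s where s: "0 < s" "s < h" "p h - p 0 = h * (D (y + h *\<^sub>R v + s *\<^sub>R u) u - D (y + s *\<^sub>R u) u)" by auto
    have "\<exists>t. 0 < t \<and> t < h \<and> D (y + s *\<^sub>R u + h *\<^sub>R v) u - D (y + s *\<^sub>R u + 0 *\<^sub>R v) u = (h - 0) * D2 (y + s *\<^sub>R u + t *\<^sub>R v) u v"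
      by (rule MVT2[OF hpos]) (use s inS in \<open>intro has_real_derivative_along_line[of "\<lambda>x. D x u" "D2 (y + s *\<^sub>R u + t *\<^sub>R v) u" "y + s *\<^sub>R u" t v for t] D2, auto\<close>)
    then obtain t where "0 < t" "t < h" "D (y + s *\<^sub>R u + h *\<^sub>R v) u - D (y + s *\<^sub>R u) u = h * D2 (y + s *\<^sub>R u + t *\<^sub>R v) u v"
      by auto
    moreover have "L = p h - p 0" by (simp add: L_def p_def add_ac)
    ultimately show ?thesis using s by (intro exI[of _ s] exI[of _ t]) (simp add: add_ac mult.assoc)
  qed
  then obtain s t where st: "0 < s" "s < h" "0 < t" "t < h" "L = h * h * D2 (y + s *\<^sub>R u + t *\<^sub>R v) u v" by blast
  have "\<exists>s t. 0 < s \<and> s < h \<and> 0 < t \<and> t < h \<and> L = h * h * D2 (y + s *\<^sub>R u + t *\<^sub>R v) v u"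
  proof -
    define p where "p t = f (y + h *\<^sub>R u + t *\<^sub>R v) - f (y + t *\<^sub>R v)" for t
    have "\<exists>t. 0 < t \<and> t < h \<and> p h - p 0 = (h - 0) * (D (y + h *\<^sub>R u + t *\<^sub>R v) v - D (y + t *\<^sub>R v) v)"
      unfolding p_def
    proof (rule MVT2[OF hpos])
      fix t assume t: "0 \<le> t" "t \<le> h"
      have "y + h *\<^sub>R u + t *\<^sub>R v \<in> S" "y + t *\<^sub>R v \<in> S"
        using inS[of h t] inS[of 0 t] t hpos by (simp_all add: add_ac)
      then show "((\<lambda>t. f (y + h *\<^sub>R u + t *\<^sub>R v) - f (y + t *\<^sub>R v)) has_real_derivative
          D (y + h *\<^sub>R u + t *\<^sub>R v) v - D (y + t *\<^sub>R v) v) (at t)"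
        by (intro DERIV_diff has_real_derivative_along_line D)
    qed
    then obtain t where t: "0 < t" "t < h" "p h - p 0 = h * (D (y + h *\<^sub>R u + t *\<^sub>R v) v - D (y + t *\<^sub>R v) v)" by auto
    have inS': "y + t *\<^sub>R v + s *\<^sub>R u \<in> S" if "0 \<le> s" "s \<le> h" for s
      using inS[of s t] that t by (simp add: add_ac)
    have "\<exists>s. 0 < s \<and> s < h \<and> D (y + t *\<^sub>R v + h *\<^sub>R u) v - D (y + t *\<^sub>R v + 0 *\<^sub>R u) v = (h - 0) * D2 (y + t *\<^sub>R v + s *\<^sub>R u) v u"
      by (rule MVT2[OF hpos]) (use inS' in \<open>intro has_real_derivative_along_line[of "\<lambda>x. D x v" "D2 (y + t *\<^sub>R v + s *\<^sub>R u) v" "y + t *\<^sub>R v" s u for s] D2, auto\<close>)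
    then obtain s where "0 < s" "s < h" "D (y + t *\<^sub>R v + h *\<^sub>R u) v - D (y + t *\<^sub>R v) v = h * D2 (y + t *\<^sub>R v + s *\<^sub>R u) v u"
      by auto
    moreover have "L = p h - p 0" by (simp add: L_def p_def add_ac)
    ultimately show ?thesis using t by (intro exI[of _ s] exI[of _ t]) (simp add: add_ac mult.assoc)
  qed
  then obtain s' t' where st': "0 < s'" "s' < h" "0 < t'" "t' < h" "L = h * h * D2 (y + s' *\<^sub>R u + t' *\<^sub>R v) v u" by blast
  have "D2 (y + s *\<^sub>R u + t *\<^sub>R v) u v = D2 (y + s' *\<^sub>R u + t' *\<^sub>R v) v u"
    using st(5) st'(5) hpos by simp
  moreover have "dist (D2 (y + s *\<^sub>R u + t *\<^sub>R v) u v) (D2 y u v) < e"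
    using close[of s t] st by (intro d1) (auto simp: d_def)
  moreover have "dist (D2 (y + s' *\<^sub>R u + t' *\<^sub>R v) v u) (D2 y v u) < e"
    using close[of s' t'] st' by (intro d2) (auto simp: d_def)
  ultimately show False by (simp add: e_def dist_real_def) (smt (verit) field_sum_of_halves)
qed

text \<open>Continuity spreads the vanishing of \<open>ddf\<close> from a dense set to all of U, and
  connectedness does the rest. Applied twice: to the Hessian of the first norm and to the
  differential of \<Phi>.\<close>

lemma derivative_constant_if_second_zero_dense:
  fixes df :: "'x::euclidean_space \<Rightarrow> 'x \<Rightarrow> 'y::euclidean_space"
  assumes "open U" "connected U"
    and dd: "\<And>x u. x \<in> U \<Longrightarrow> ((\<lambda>x. df x u) has_derivative ddf x u) (at x)"
    and c: "\<And>u v. continuous_on U (\<lambda>x. ddf x u v)"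
    and D: "U \<subseteq> closure {x \<in> U. \<forall>u v. ddf x u v = 0}"
    and x: "x \<in> U" and y: "y \<in> U"
  shows "df x = df y"
proof
  fix u
  have z: "ddf x u v = 0" if "x \<in> U" for x v
  proof -
    let ?Z = "{x \<in> U. ddf x u v = 0}"
    have "closedin (top_of_set U) ?Z"
      using continuous_closedin_preimage_constant[OF c[of u v]] .
    then obtain T where T: "closed T" "?Z = U \<inter> T" using closedin_closed by blast
    have "{x \<in> U. \<forall>u v. ddf x u v = 0} \<subseteq> T" using T by blast
    then have "closure {x \<in> U. \<forall>u v. ddf x u v = 0} \<subseteq> T" using T(1) by (rule closure_minimal)
    then have "x \<in> T" using D that by blast
    then show ?thesis using T that by blast
  qed
  have "((\<lambda>x. df x u) has_derivative (\<lambda>_. 0)) (at x within U)" if "x \<in> U" for x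
  proof -
    have "ddf x u = (\<lambda>_. 0)" using z[OF that] by auto
    then show ?thesis using dd[OF that, of u] by (simp add: has_derivative_at_withinI)
  qed
  then have "(\<lambda>x. df x u) constant_on U"
    by (intro has_derivative_zero_connected_constant_on[of U "{}"])
       (use assms dd in \<open>auto intro!: continuous_at_imp_continuous_on has_derivative_continuous\<close>)
  then show "df x u = df y u" using x y unfolding constant_on_def by metis
qed

text \<open>Product rule for a varying linear map applied to a varying vector. Differentiability is
  given only for each fixed argument, so \<open>L x\<close> is expanded in the standard
  basis.\<close>

lemma has_derivative_linear_family:
  fixes D :: "'z::real_normed_vector \<Rightarrow> 'x::euclidean_space \<Rightarrow> 'y::real_normed_vector"
  assumes S: "open S" "y \<in> S"
    and lin: "\<And>x. x \<in> S \<Longrightarrow> linear (D x)"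
    and D2: "\<And>u. ((\<lambda>x. D x u) has_derivative D2 u) (at y)"
    and L: "(L has_derivative L') (at y)"
  shows "((\<lambda>x. D x (L x)) has_derivative (\<lambda>v. D2 (L y) v + D y (L' v))) (at y)"
proof -
  have expand: "D x u = (\<Sum>b\<in>Basis. (u \<bullet> b) *\<^sub>R D x b)" if "x \<in> S" for x u
  proof -
    have "D x u = D x (\<Sum>b\<in>Basis. (u \<bullet> b) *\<^sub>R b)" by (simp add: euclidean_representation)
    then show ?thesis using lin[OF that] by (simp add: linear_sum linear_scale)
  qed
  have "((\<lambda>x. \<Sum>b\<in>Basis. (u \<bullet> b) *\<^sub>R D x b) has_derivative (\<lambda>v. \<Sum>b\<in>Basis. (u \<bullet> b) *\<^sub>R D2 b v)) (at y)" for u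
    by (intro has_derivative_sum has_derivative_scaleR_right D2)
  then have "((\<lambda>x. D x u) has_derivative (\<lambda>v. \<Sum>b\<in>Basis. (u \<bullet> b) *\<^sub>R D2 b v)) (at y)" for u
    by (rule has_derivative_transform_within_open[OF _ S]) (rule expand[symmetric])
  then have D2lin: "D2 u v = (\<Sum>b\<in>Basis. (u \<bullet> b) *\<^sub>R D2 b v)" for u v
    using has_derivative_unique[OF D2] by metis
  have "((\<lambda>x. \<Sum>b\<in>Basis. (L x \<bullet> b) *\<^sub>R D x b) has_derivative
      (\<lambda>v. \<Sum>b\<in>Basis. (L y \<bullet> b) *\<^sub>R D2 b v + (L' v \<bullet> b) *\<^sub>R D y b)) (at y)"
    by (intro has_derivative_sum has_derivative_scaleR D2 has_derivative_inner_left L)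
  then have "((\<lambda>x. D x (L x)) has_derivative
      (\<lambda>v. \<Sum>b\<in>Basis. (L y \<bullet> b) *\<^sub>R D2 b v + (L' v \<bullet> b) *\<^sub>R D y b)) (at y)"
    by (rule has_derivative_transform_within_open[OF _ S]) (rule expand[symmetric])
  moreover have "(\<Sum>b\<in>Basis. (L y \<bullet> b) *\<^sub>R D2 b v + (L' v \<bullet> b) *\<^sub>R D y b) = D2 (L y) v + D y (L' v)" for v
    using D2lin[of "L y" v] expand[OF S(2), of "L' v"] by (simp add: sum.distrib)
  ultimately show ?thesis by simp
qed

section \<open>Orthogonal splittings\<close>

text \<open>SO(1) is trivial, whereas SO(m) acts transitively on spheres for m at least 2; hence
  orb is the orbit relation of the block diagonal action.\<close>

definition wide :: "('v::euclidean_space \<Rightarrow> 'v) \<Rightarrow> bool" where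
  "wide P \<longleftrightarrow> dim (range P) \<ge> 2"

definition orb :: "('v::euclidean_space \<Rightarrow> 'v) \<Rightarrow> ('v \<Rightarrow> 'v) \<Rightarrow> 'v \<Rightarrow> 'v \<Rightarrow> bool" where
  "orb P1 P2 x y \<longleftrightarrow> (P1 x = P1 y \<or> wide P1 \<and> norm (P1 x) = norm (P1 y)) \<and>
     (P2 x = P2 y \<or> wide P2 \<and> norm (P2 x) = norm (P2 y))"

text \<open>At a regular point this is the tangent space of the product of spheres through x. A
  one-dimensional block contributes nothing to it.\<close>

definition tang :: "('v::euclidean_space \<Rightarrow> 'v) \<Rightarrow> ('v \<Rightarrow> 'v) \<Rightarrow> 'v \<Rightarrow> 'v \<Rightarrow> bool" where
  "tang P1 P2 x u \<longleftrightarrow> u \<bullet> P1 x = 0 \<and> u \<bullet> P2 x = 0"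

definition reg :: "('v::euclidean_space \<Rightarrow> 'v) \<Rightarrow> ('v \<Rightarrow> 'v) \<Rightarrow> 'v \<Rightarrow> bool" where
  "reg P1 P2 x \<longleftrightarrow> P1 x \<noteq> 0 \<and> P2 x \<noteq> 0"

lemma orb_swap: "orb P2 P1 x y \<longleftrightarrow> orb P1 P2 x y"
  and tang_swap: "tang P2 P1 x u \<longleftrightarrow> tang P1 P2 x u"
  and reg_swap: "reg P2 P1 x \<longleftrightarrow> reg P1 P2 x"
  by (auto simp: orb_def tang_def reg_def)

locale splitting =
  fixes P1 P2 :: "'v::euclidean_space \<Rightarrow> 'v"
  assumes lin1: "linear P1" and lin2: "linear P2"
    and split_sum: "P1 x + P2 x = x"
    and split_orth: "P1 x \<bullet> P2 y = 0"
    and nontriv1: "\<exists>x. P1 x \<noteq> 0" and nontriv2: "\<exists>x. P2 x \<noteq> 0"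
begin

text \<open>Many statements are proved for the first block only and carried to the second by
  interpreting the locale with the blocks exchanged.\<close>

lemma splitting_swap: "splitting P2 P1"
proof (intro splitting.intro lin1 lin2 nontriv1 nontriv2)
  show "P2 x + P1 x = x" for x using split_sum[of x] by (simp add: add.commute)
  show "P2 x \<bullet> P1 y = 0" for x y using split_orth[of y x] by (simp add: inner_commute)
qed

text \<open>The vector \<open>P1 x - P1 (P1 x)\<close> lies in both blocks and is therefore
  orthogonal to itself.\<close>

lemma P2P1 [simp]: "P2 (P1 x) = 0"
proof -
  have "P2 (P1 x) = P1 x - P1 (P1 x)" using split_sum[of "P1 x"] by (simp add: algebra_simps)
  then have "P2 (P1 x) \<bullet> P2 (P1 x) = (P1 x - P1 (P1 x)) \<bullet> P2 (P1 x)" by simp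
  then have "P2 (P1 x) \<bullet> P2 (P1 x) = 0" by (simp add: inner_diff_left split_orth)
  then show ?thesis by simp
qed

lemma P1P1 [simp]: "P1 (P1 x) = P1 x"
  using split_sum[of "P1 x"] by simp

lemma P1P2 [simp]: "P1 (P2 x) = 0" and P2P2 [simp]: "P2 (P2 x) = P2 x"
  using splitting.P2P1[OF splitting_swap] splitting.P1P1[OF splitting_swap] by auto

lemma split_orth' [simp]: "P1 x \<bullet> P2 y = 0" "P2 x \<bullet> P1 y = 0"
  using split_orth inner_commute[of "P2 x"] by auto

lemma inner_P1_left: "P1 x \<bullet> y = P1 x \<bullet> P1 y" and inner_P2_left: "P2 x \<bullet> y = P2 x \<bullet> P2 y"
  and inner_P1_right: "x \<bullet> P1 y = P1 x \<bullet> P1 y" and inner_P2_right: "x \<bullet> P2 y = P2 x \<bullet> P2 y"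
  using split_sum[of x] split_sum[of y] inner_add_right[of "P1 x" "P1 y" "P2 y"] inner_add_right[of "P2 x" "P1 y" "P2 y"]
    inner_add_left[of "P1 x" "P2 x" "P1 y"] inner_add_left[of "P1 x" "P2 x" "P2 y"]
  by auto

lemmas P_linear [simp] = linear_add[OF lin1] linear_add[OF lin2] linear_scale[OF lin1] linear_scale[OF lin2]
  linear_diff[OF lin1] linear_diff[OF lin2] linear_0[OF lin1] linear_0[OF lin2]
  linear_neg[OF lin1] linear_neg[OF lin2]

lemma has_derivative_P1: "(f has_derivative f') F \<Longrightarrow> ((\<lambda>x. P1 (f x)) has_derivative (\<lambda>v. P1 (f' v))) F"
  and has_derivative_P2: "(f has_derivative f') F \<Longrightarrow> ((\<lambda>x. P2 (f x)) has_derivative (\<lambda>v. P2 (f' v))) F"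
  by (intro bounded_linear.has_derivative[OF linear_linear[THEN iffD2, OF lin1]]
      bounded_linear.has_derivative[OF linear_linear[THEN iffD2, OF lin2]]; assumption)+

lemma thin1:
  assumes "\<not> wide P1" "P1 x \<noteq> 0" "u \<bullet> P1 x = 0"
  shows "P1 u = 0"
proof (rule ccontr)
  assume u: "P1 u \<noteq> 0"
  have o: "P1 u \<bullet> P1 x = 0" using assms(3) inner_P1_right by metis
  have ne: "P1 x \<noteq> P1 u" using o u by auto
  have "pairwise orthogonal {P1 x, P1 u}" using o by (auto simp: pairwise_def orthogonal_def inner_commute)
  then have "independent {P1 x, P1 u}" using u assms(2) by (intro pairwise_orthogonal_independent) auto
  then have "card {P1 x, P1 u} \<le> dim (range P1)" by (intro independent_card_le_dim) auto
  then show False using ne assms(1) by (simp add: wide_def)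
qed

text \<open>Supplies the initial velocity of a great circle: \<open>span {P1 x}\<close> has
  dimension at most 1 and cannot fill the block.\<close>

lemma wide1:
  assumes "wide P1"
  obtains w where "P1 w = w" "w \<noteq> 0" "w \<bullet> P1 x = 0"
proof -
  have sub: "subspace (range P1)" using lin1 linear_subspace_image subspace_UNIV by blast
  have "span {P1 x} \<subseteq> span (range P1)" by (intro span_mono) auto
  moreover have "span {P1 x} \<noteq> span (range P1)"
  proof
    assume "span {P1 x} = span (range P1)"
    then have "dim (range P1) = dim {P1 x}" by (metis dim_span)
    also have "\<dots> \<le> 1" using dim_le_card[of "{P1 x}" "{P1 x}"] span_superset[of "{P1 x}"] by simp
    finally show False using assms by (simp add: wide_def)
  qed
  ultimately have "span {P1 x} \<subset> span (range P1)" by blast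
  then obtain w where w: "w \<noteq> 0" "w \<in> span (range P1)" "\<And>y. y \<in> span {P1 x} \<Longrightarrow> orthogonal w y"
    using orthogonal_to_subspace_exists_gen[of "{P1 x}" "range P1"] by blast
  have "w \<in> range P1" using w(2) sub by (metis span_eq_iff)
  then have "P1 w = w" by auto
  moreover have "w \<bullet> P1 x = 0" using w(3) by (meson insertI1 orthogonal_def span_base)
  ultimately show ?thesis using that w(1) by blast
qed

lemma reg_nonzero: "reg P1 P2 x \<Longrightarrow> x \<noteq> 0"
  by (auto simp: reg_def)

lemma orb_norms: "orb P1 P2 x y \<Longrightarrow> norm (P1 x) = norm (P1 y) \<and> norm (P2 x) = norm (P2 y)"
  by (auto simp: orb_def)

lemma orb_norm1: "orb P1 P2 x y \<Longrightarrow> P1 x \<bullet> P1 x = P1 y \<bullet> P1 y"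
  using orb_norms by (metis dot_square_norm)

lemma orb_reg: "orb P1 P2 x y \<Longrightarrow> reg P1 P2 x \<Longrightarrow> reg P1 P2 y"
  by (auto simp: orb_def reg_def)

lemma orb_nonzero: "orb P1 P2 x y \<Longrightarrow> x \<noteq> 0 \<Longrightarrow> y \<noteq> 0"
  using orb_norms[of x y] split_sum[of x] by auto

lemma tang_P: "tang P1 P2 x u \<Longrightarrow> tang P1 P2 x (P1 u)" "tang P1 P2 x u \<Longrightarrow> tang P1 P2 x (P2 u)"
  by (simp_all add: tang_def inner_P1_right[of u x] inner_P2_right[of u x])

lemma tang_inner:
  assumes "tang P1 P2 x u"
  shows "P1 u \<bullet> P1 x = 0" "P2 u \<bullet> P2 x = 0" "P1 x \<bullet> P1 u = 0" "P2 x \<bullet> P2 u = 0" "P1 x \<bullet> u = 0" "P2 x \<bullet> u = 0"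
    "u \<bullet> P1 x = 0" "u \<bullet> P2 x = 0"
  using assms by (simp_all add: tang_def inner_P1_right[of u x] inner_P2_right[of u x] inner_P1_left[of x u]
      inner_P2_left[of x u] inner_commute[of "P1 x"] inner_commute[of "P2 x"])

lemma tang_lin: "tang P1 P2 x u \<Longrightarrow> tang P1 P2 x v \<Longrightarrow> tang P1 P2 x (u + v)"
  "tang P1 P2 x u \<Longrightarrow> tang P1 P2 x (c *\<^sub>R u)"
  by (auto simp: tang_def inner_add_left)

lemma tang_thin1: "reg P1 P2 x \<Longrightarrow> \<not> wide P1 \<Longrightarrow> tang P1 P2 x u \<Longrightarrow> P1 u = 0"
  using thin1 by (auto simp: reg_def tang_def)

text \<open>The frame adapted to an orbit: two radial directions and the tangent space. Linear
  identities at a regular point are checked on these three parts.\<close>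

lemma tang_decomp:
  assumes "reg P1 P2 x"
  obtains t where "tang P1 P2 x t"
    "v = ((P1 x \<bullet> v) / (P1 x \<bullet> P1 x)) *\<^sub>R P1 x + ((P2 x \<bullet> v) / (P2 x \<bullet> P2 x)) *\<^sub>R P2 x + t"
proof
  let ?t = "v - ((P1 x \<bullet> v) / (P1 x \<bullet> P1 x)) *\<^sub>R P1 x - ((P2 x \<bullet> v) / (P2 x \<bullet> P2 x)) *\<^sub>R P2 x"
  show "tang P1 P2 x ?t"
    using assms by (simp add: tang_def reg_def inner_diff_left inner_commute[of v])
  show "v = ((P1 x \<bullet> v) / (P1 x \<bullet> P1 x)) *\<^sub>R P1 x + ((P2 x \<bullet> v) / (P2 x \<bullet> P2 x)) *\<^sub>R P2 x + ?t" by simp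
qed

lemma orb_circle:
  assumes "wide P1" "P1 w = w" "w \<bullet> P1 x = 0" "norm w = norm (P1 x)"
  shows "orb P1 P2 x (cos t *\<^sub>R P1 x + sin t *\<^sub>R w + P2 x)"
proof -
  have P2w: "P2 w = 0" using assms(2) by (metis P2P1)
  have "(norm (cos t *\<^sub>R P1 x + sin t *\<^sub>R w))\<^sup>2 = (cos t)\<^sup>2 * (P1 x \<bullet> P1 x) + (sin t)\<^sup>2 * (w \<bullet> w)"
    unfolding power2_norm_eq_inner
    using assms(3) by (simp add: inner_add_left inner_add_right power2_eq_square inner_commute[of "P1 x" w])
  also have "\<dots> = (norm (P1 x))\<^sup>2"
    using assms(4) by (simp add: dot_square_norm flip: distrib_right)
  finally have "norm (cos t *\<^sub>R P1 x + sin t *\<^sub>R w) = norm (P1 x)"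
    by (metis norm_ge_zero power2_eq_iff_nonneg)
  then show ?thesis using assms P2w by (simp add: orb_def)
qed

text \<open>Rescaling one component carries orbits to orbits; hence radial derivatives of invariants
  are invariants again.\<close>

lemma orb_radial: "orb P1 P2 x y \<Longrightarrow> orb P1 P2 (x + t *\<^sub>R P1 x) (y + t *\<^sub>R P1 y)"
proof -
  assume o: "orb P1 P2 x y"
  have e: "P1 z + t *\<^sub>R P1 z = (1 + t) *\<^sub>R P1 z" for z by (simp add: scaleR_left_distrib)
  show ?thesis using o by (auto simp: orb_def e simp del: scaleR_cancel_left)
qed

text \<open>The great circle through x in the direction \<open>P1 u\<close> stays in the orbit, so
  \<open>h\<close> is constant along it.\<close>

lemma invariant_derivative_tang1:
  assumes h: "(h has_derivative h') (at x)" and inv: "\<And>y. orb P1 P2 x y \<Longrightarrow> h y = h x"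
    and reg: "reg P1 P2 x" and t: "tang P1 P2 x u"
  shows "h' (P1 u) = (0::real)"
proof (cases "P1 u = 0")
  case True
  then show ?thesis using linear_0[OF has_derivative_linear[OF h]] by simp
next
  case False
  then have w: "wide P1" using tang_thin1 reg t by blast
  \<comment> \<open>Brings \<open>P1 u\<close> to the length of \<open>P1 x\<close>, so that the
    curve \<open>g\<close> is a circle and not an ellipse.\<close>
  define c where "c = norm (P1 x) / norm (P1 u)"
  have c: "c > 0" using False reg by (simp add: c_def reg_def)
  define g where "g t = cos t *\<^sub>R P1 x + sin t *\<^sub>R (c *\<^sub>R P1 u) + P2 x" for t
  have g0: "g 0 = x" by (simp add: g_def split_sum)
  have "orb P1 P2 x (g t)" for t unfolding g_def
    using w False t c by (intro orb_circle) (simp_all add: tang_inner c_def)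
  then have "h (g t) = h x" for t using inv by blast
  then have "((\<lambda>t. h (g t)) has_vector_derivative 0) (at 0)" by simp
  moreover have "(g has_vector_derivative c *\<^sub>R P1 u) (at 0)"
    unfolding g_def by (auto intro!: derivative_eq_intros)
  then have "((\<lambda>t. h (g t)) has_vector_derivative h' (c *\<^sub>R P1 u)) (at 0)"
    by (rule has_vector_derivative_along_curve[where c = g, rotated]) (simp add: g0 h)
  ultimately have "h' (c *\<^sub>R P1 u) = 0" using vector_derivative_unique_at by blast
  then show ?thesis using linear_scale[OF has_derivative_linear[OF h]] c by simp
qed

lemma invariant_derivative_tang:
  assumes h: "(h has_derivative h') (at x)" and inv: "\<And>y. orb P1 P2 x y \<Longrightarrow> h y = h x"
    and reg: "reg P1 P2 x" and t: "tang P1 P2 x u"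
  shows "h' u = (0::real)"
proof -
  interpret sw: splitting P2 P1 by (rule splitting_swap)
  have "h' (P1 u) = 0" using assms by (rule invariant_derivative_tang1)
  moreover have "h' (P2 u) = 0"
    using assms by (intro sw.invariant_derivative_tang1[of h h' x]) (auto simp: orb_swap reg_swap tang_swap)
  ultimately show ?thesis
    using linear_add[OF has_derivative_linear[OF h], of "P1 u" "P2 u"] by (simp add: split_sum)
qed

text \<open>By \<open>orb_radial\<close> the radial segments at x and y run through pairwise
  equivalent points, so \<open>h\<close> agrees along them near t = 0.\<close>

lemma radial_derivative_invariant:
  assumes S: "open S" "x \<in> S" and inv: "\<And>x y. x \<in> S \<Longrightarrow> orb P1 P2 x y \<Longrightarrow> h y = (h x :: real)"
    and hx: "(h has_derivative hx) (at x)" and hy: "(h has_derivative hy) (at y)" and o: "orb P1 P2 x y"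
  shows "hx (P1 x) = hy (P1 y)"
proof -
  have ix: "((\<lambda>t. h (x + t *\<^sub>R P1 x)) has_real_derivative hx (P1 x)) (at 0)"
    and iy: "((\<lambda>t. h (y + t *\<^sub>R P1 y)) has_real_derivative hy (P1 y)) (at 0)"
    by (rule has_real_derivative_along_line; simp add: hx hy)+
  let ?T = "(\<lambda>t. x + t *\<^sub>R P1 x) -` S"
  have T: "open ?T" by (intro open_vimage S continuous_intros)
  have "((\<lambda>t. h (y + t *\<^sub>R P1 y)) has_real_derivative hx (P1 x)) (at 0)"
    by (rule has_field_derivative_transform_within_open[OF ix T])
       (use S inv orb_radial[OF o] in auto)
  then show ?thesis using iy DERIV_unique by blast
qed

text \<open>The codimension is the same at all regular points, so an injective differential is onto
  between tangent spaces of orbits (\<open>d\<Phi>_tang_surj\<close>).\<close>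

lemma dim_tang:
  assumes "reg P1 P2 x"
  shows "dim {u. tang P1 P2 x u} + 2 = DIM('v)"
proof -
  have ne: "P1 x \<noteq> P2 x"
    using assms split_orth[of x x] unfolding reg_def by (metis inner_eq_zero_iff)
  have "pairwise orthogonal {P1 x, P2 x}" by (auto simp: pairwise_def orthogonal_def)
  then have "independent {P1 x, P2 x}"
    using assms by (intro pairwise_orthogonal_independent) (auto simp: reg_def)
  then have d: "dim (span {P1 x, P2 x}) = 2" using ne by (simp add: dim_span dim_eq_card_independent)
  have "{u. tang P1 P2 x u} = {u \<in> UNIV. \<forall>v \<in> span {P1 x, P2 x}. orthogonal v u}"
  proof -
    have "(\<forall>v \<in> span {P1 x, P2 x}. orthogonal v u) \<longleftrightarrow> (\<forall>v \<in> {P1 x, P2 x}. orthogonal v u)" for u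
      using orthogonal_to_span[of _ "{P1 x, P2 x}" u] span_base[of _ "{P1 x, P2 x}"] orthogonal_commute by metis
    then show ?thesis by (auto simp: tang_def orthogonal_def inner_commute)
  qed
  then show ?thesis
    using dim_subspace_orthogonal_to_vectors[OF subspace_span subspace_UNIV, of "{P1 x, P2 x}"] d by simp
qed

lemma subspace_tang: "subspace {u. tang P1 P2 x u}"
  by (auto simp: subspace_def tang_def inner_add_left)

text \<open>Along a line whose direction has two nonzero components, each component of the moving
  point vanishes at most once.\<close>

lemma exists_regular:
  assumes U: "open U" "U \<noteq> {}"
  shows "\<exists>x\<in>U. reg P1 P2 x"
proof -
  obtain n1 n2 where n12: "P1 n1 \<noteq> 0" "P2 n2 \<noteq> 0" using nontriv1 nontriv2 by blast
  define n where "n = P1 n1 + P2 n2"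
  have n: "P1 n \<noteq> 0" "P2 n \<noteq> 0" using n12 by (auto simp: n_def)
  obtain x where x: "x \<in> U" using U by blast
  let ?T = "(\<lambda>s. x + s *\<^sub>R n) -` U"
  have "open ?T" by (intro open_vimage U continuous_intros)
  moreover have "0 \<in> ?T" using x by simp
  ultimately obtain e where e: "e > 0" "ball 0 e \<subseteq> ?T" using open_contains_ball by blast
  have inU: "x + s *\<^sub>R n \<in> U" if "\<bar>s\<bar> < e" for s using e(2) that by (auto simp: subset_iff)
  have u1: "s = t" if "P1 (x + s *\<^sub>R n) = 0" "P1 (x + t *\<^sub>R n) = 0" for s t
  proof -
    have "(s - t) *\<^sub>R P1 n = P1 (x + s *\<^sub>R n) - P1 (x + t *\<^sub>R n)" by (simp add: algebra_simps)
    then show ?thesis using n that by (metis diff_self eq_iff_diff_eq_0 scale_eq_0_iff)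
  qed
  have u2: "s = t" if "P2 (x + s *\<^sub>R n) = 0" "P2 (x + t *\<^sub>R n) = 0" for s t
  proof -
    have "(s - t) *\<^sub>R P2 n = P2 (x + s *\<^sub>R n) - P2 (x + t *\<^sub>R n)" by (simp add: algebra_simps)
    then show ?thesis using n that by (metis diff_self eq_iff_diff_eq_0 scale_eq_0_iff)
  qed
  \<comment> \<open>Three parameters, of which at most two are exceptional.\<close>
  have ne: "0 \<noteq> e / 2" "0 \<noteq> e / 3" "e / 2 \<noteq> e / 3" using e by auto
  have "reg P1 P2 (x + 0 *\<^sub>R n) \<or> reg P1 P2 (x + (e / 2) *\<^sub>R n) \<or> reg P1 P2 (x + (e / 3) *\<^sub>R n)"
    unfolding reg_def using u1 u2 ne by blast
  moreover have "x + 0 *\<^sub>R n \<in> U" "x + (e / 2) *\<^sub>R n \<in> U" "x + (e / 3) *\<^sub>R n \<in> U"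
    using e by (auto intro!: inU simp del: scale_zero_left)
  ultimately show ?thesis by blast
qed

text \<open>Moving along \<open>P1 x\<close> changes the left side only. Off this hypersurface
  straight and crossed points can be told apart (\<open>dd\<Phi>_zero_straight\<close>).\<close>

lemma exists_unbalanced:
  assumes U: "open U" "x \<in> U" "reg P1 P2 x" and a: "a > 0"
  shows "\<exists>y\<in>U. a * (P1 y \<bullet> P1 y) \<noteq> b * (P2 y \<bullet> P2 y)"
proof (cases "a * (P1 x \<bullet> P1 x) = b * (P2 x \<bullet> P2 x)")
  case True
  let ?T = "(\<lambda>s. x + s *\<^sub>R P1 x) -` U"
  have "open ?T" by (intro open_vimage U continuous_intros)
  moreover have "0 \<in> ?T" using U by simp
  ultimately obtain e where e: "e > 0" "ball 0 e \<subseteq> ?T" using open_contains_ball by blast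
  let ?y = "x + (e / 2) *\<^sub>R P1 x"
  have "?y \<in> U" using e by (auto simp: subset_iff)
  moreover have "P1 ?y = (1 + e / 2) *\<^sub>R P1 x" "P2 ?y = P2 x" by (simp_all add: algebra_simps)
  then have "a * (P1 ?y \<bullet> P1 ?y) = (1 + e / 2)\<^sup>2 * (a * (P1 x \<bullet> P1 x))"
    "b * (P2 ?y \<bullet> P2 ?y) = a * (P1 x \<bullet> P1 x)" using True by (simp_all add: power2_eq_square)
  moreover have "a * (P1 x \<bullet> P1 x) > 0" using a U(3) by (simp add: reg_def)
  moreover have "(1 + e / 2)\<^sup>2 > 1" using e(1) by (simp add: power2_eq_square algebra_simps add_pos_pos)
  ultimately show ?thesis by (intro bexI[of _ ?y]) auto
qed (use U in blast)

end

section \<open>Invariant homogeneous energies\<close>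

lemma DERIV_unique_eq:
  assumes "(f has_real_derivative a) (at t)" "(g has_real_derivative b) (at t)" "\<And>s. f s = g s"
  shows "a = b"
  using assms DERIV_unique[of f a t b] by (metis ext)

text \<open>Models F^2 / 2 for an invariant Minkowski norm F, together with its first three
  derivatives; no differentiability is assumed at the origin.\<close>

locale energy = splitting R1 R2 for R1 R2 :: "'v::euclidean_space \<Rightarrow> 'v" +
  fixes E :: "'v \<Rightarrow> real" and D1 :: "'v \<Rightarrow> 'v \<Rightarrow> real"
    and D2 :: "'v \<Rightarrow> 'v \<Rightarrow> 'v \<Rightarrow> real" and D3 :: "'v \<Rightarrow> 'v \<Rightarrow> 'v \<Rightarrow> 'v \<Rightarrow> real"
  assumes D1: "x \<noteq> 0 \<Longrightarrow> (E has_derivative D1 x) (at x)"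
    and D2: "x \<noteq> 0 \<Longrightarrow> ((\<lambda>x. D1 x u) has_derivative D2 x u) (at x)"
    and D3: "x \<noteq> 0 \<Longrightarrow> ((\<lambda>x. D2 x u v) has_derivative D3 x u v) (at x)"
    and D2_sym: "x \<noteq> 0 \<Longrightarrow> D2 x u v = D2 x v u"
    and D3_sym: "x \<noteq> 0 \<Longrightarrow> D3 x u v w = D3 x u w v"
    and E_hom: "t > 0 \<Longrightarrow> E (t *\<^sub>R x) = t\<^sup>2 * E x"
    and D2_pos: "x \<noteq> 0 \<Longrightarrow> v \<noteq> 0 \<Longrightarrow> D2 x v v > 0"
    and E_inv: "orb R1 R2 x y \<Longrightarrow> E x = E y"
begin

lemma energy_swap: "energy R2 R1 E D1 D2 D3"
  by (intro energy.intro splitting_swap energy_axioms.intro D1 D2 D3 D2_sym D3_sym E_hom D2_pos E_inv)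
     (simp_all add: orb_swap)

lemma D1_linear: "x \<noteq> 0 \<Longrightarrow> linear (D1 x)"
  using D1 has_derivative_linear by blast

lemma D2_linear2: "x \<noteq> 0 \<Longrightarrow> linear (D2 x u)"
  using D2 has_derivative_linear by blast

lemma D2_linear1: "x \<noteq> 0 \<Longrightarrow> linear (\<lambda>u. D2 x u v)"
  using D2_linear2[of x v] D2_sym[of x _ v] by presburger

lemma D3_linear: "x \<noteq> 0 \<Longrightarrow> linear (D3 x u v)"
  using D3 has_derivative_linear by blast

text \<open>Symmetry of the Hessian holds near x and may be differentiated. Together with
  \<open>D3_sym\<close> it makes \<open>D3\<close> totally symmetric.\<close>

lemma D3_sym12:
  assumes "x \<noteq> 0"
  shows "D3 x u v w = D3 x v u w"
proof -
  have "((\<lambda>x. D2 x v u) has_derivative D3 x u v) (at x)"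
    by (rule has_derivative_transform_within_open[OF D3[OF assms], of "UNIV - {0}"])
       (use assms D2_sym in auto)
  then have "D3 x u v = D3 x v u" using D3[OF assms] has_derivative_unique by blast
  then show ?thesis by simp
qed

lemma euler: assumes "x \<noteq> 0" shows "D1 x x = 2 * E x"
proof -
  have "((\<lambda>t. E (0 + t *\<^sub>R x)) has_real_derivative D1 x x) (at 1)"
    by (rule has_real_derivative_along_line) (simp add: D1 assms)
  moreover have "((\<lambda>t. t\<^sup>2 * E x) has_real_derivative 2 * E x) (at 1)"
    by (auto intro!: derivative_eq_intros)
  then have "((\<lambda>t. E (0 + t *\<^sub>R x)) has_real_derivative 2 * E x) (at 1)"
    by (rule has_field_derivative_transform_within_open[of _ _ _ "{0<..}"]) (auto simp: E_hom)
  ultimately show ?thesis using DERIV_unique by blast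
qed

lemma D1_eval_derivative:
  assumes "x \<noteq> 0" "linear L"
  shows "((\<lambda>x. D1 x (L x)) has_derivative (\<lambda>v. D2 x (L x) v + D1 x (L v))) (at x)"
  by (rule has_derivative_linear_family[of "UNIV - {0}"])
     (use assms D1_linear D2 linear_imp_has_derivative in auto)

lemma euler2: assumes "x \<noteq> 0" shows "D2 x x u = D1 x u"
proof -
  have "((\<lambda>x. D1 x x) has_derivative (\<lambda>v. D2 x x v + D1 x v)) (at x)"
    using D1_eval_derivative[OF assms linear_id] by (simp add: id_def)
  moreover have "((\<lambda>x. 2 * E x) has_derivative (\<lambda>v. 2 * D1 x v)) (at x)"
    using assms by (intro has_derivative_mult_right D1)
  then have "((\<lambda>x. D1 x x) has_derivative (\<lambda>v. 2 * D1 x v)) (at x)"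
    by (rule has_derivative_transform_within_open[of _ _ _ _ "UNIV - {0}"]) (auto simp: assms euler)
  ultimately have "(\<lambda>v. D2 x x v + D1 x v) = (\<lambda>v. 2 * D1 x v)" using has_derivative_unique by blast
  then have "D2 x x u + D1 x u = 2 * D1 x u" by meson
  then show ?thesis by simp
qed

lemma D1_tang: "reg R1 R2 x \<Longrightarrow> tang R1 R2 x u \<Longrightarrow> D1 x u = 0"
  using invariant_derivative_tang[OF D1 E_inv[symmetric], of x u] reg_nonzero by blast

lemma D1_radial_invariant:
  assumes "x \<noteq> 0" "orb R1 R2 x y" shows "D1 y (R1 y) = D1 x (R1 x)"
  using radial_derivative_invariant[of UNIV x E "D1 x" "D1 y" y] assms D1 orb_nonzero E_inv by auto

lemma D1_radial_derivative:
  assumes "x \<noteq> 0"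
  shows "((\<lambda>x. D1 x (R1 x)) has_derivative (\<lambda>v. D2 x (R1 x) v + D1 x (R1 v))) (at x)"
  using D1_eval_derivative[OF assms lin1] .

text \<open>The radial derivative \<open>D1 x (R1 x)\<close> is an orbit invariant, so it is
  stationary along the orbit; the extra term \<open>D1 x (R1 u)\<close> is a tangential derivative
  of E. Radial vectors are thus Hessian-normal to the orbit.\<close>

lemma D2_radial_tang:
  assumes r: "reg R1 R2 x" and t: "tang R1 R2 x u"
  shows "D2 x (R1 x) u = 0"
proof -
  have x: "x \<noteq> 0" using r reg_nonzero by blast
  have "D2 x (R1 x) u + D1 x (R1 u) = 0"
    by (rule invariant_derivative_tang[OF D1_radial_derivative[OF x] _ r t])
       (use D1_radial_invariant x in blast)
  then show ?thesis using D1_tang[OF r tang_P(1)[OF t]] by simp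
qed

text \<open>The Euclidean gradient of E at a regular point is
  \<open>coef x *\<^sub>R R1 x + coef' x *\<^sub>R R2 x\<close>, by \<open>D1_formula\<close>;
  \<open>coef\<close> is the a(y) of the overview.\<close>

definition coef :: "'v \<Rightarrow> real" where "coef x = D1 x (R1 x) / (R1 x \<bullet> R1 x)"
definition coef' :: "'v \<Rightarrow> real" where "coef' x = D1 x (R2 x) / (R2 x \<bullet> R2 x)"

lemma coef_differentiable:
  assumes r: "reg R1 R2 x"
  shows "coef differentiable (at x)"
proof -
  have x: "x \<noteq> 0" using r reg_nonzero by blast
  have "(\<lambda>x. D1 x (R1 x)) differentiable (at x)"
    using D1_radial_derivative[OF x] by (auto simp: differentiable_def)
  moreover have "(\<lambda>x. R1 x \<bullet> R1 x) differentiable (at x)"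
    unfolding differentiable_def
    by (rule exI, rule has_derivative_inner; rule linear_imp_has_derivative[OF lin1])
  ultimately show ?thesis unfolding coef_def
    using r by (intro differentiable_divide) (auto simp: reg_def)
qed

lemma D1_formula:
  assumes r: "reg R1 R2 x"
  shows "D1 x v = coef x * (R1 x \<bullet> v) + coef' x * (R2 x \<bullet> v)"
proof -
  have x: "x \<noteq> 0" using r reg_nonzero by blast
  obtain t where t: "tang R1 R2 x t"
    "v = ((R1 x \<bullet> v) / (R1 x \<bullet> R1 x)) *\<^sub>R R1 x + ((R2 x \<bullet> v) / (R2 x \<bullet> R2 x)) *\<^sub>R R2 x + t"
    using tang_decomp[OF r] by blast
  have "D1 x v = ((R1 x \<bullet> v) / (R1 x \<bullet> R1 x)) * D1 x (R1 x) + ((R2 x \<bullet> v) / (R2 x \<bullet> R2 x)) * D1 x (R2 x) + D1 x t"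
    by (subst t(2)) (simp only: linear_add[OF D1_linear[OF x]] linear_scale[OF D1_linear[OF x]] real_scaleR_def)
  then show ?thesis using D1_tang[OF r t(1)] by (simp add: coef_def coef'_def mult.commute)
qed

lemma open_reg: "open {x. reg R1 R2 x}"
proof -
  have "continuous_on UNIV R1" "continuous_on UNIV R2"
    using lin1 lin2 by (simp_all add: linear_continuous_on linear_linear)
  then have "open {x. R1 x \<noteq> 0}" "open {x. R2 x \<noteq> 0}" by (auto intro!: open_Collect_neq continuous_intros)
  then show ?thesis unfolding reg_def by (rule open_Collect_conj)
qed

lemma coef'_differentiable:
  assumes r: "reg R1 R2 x"
  shows "coef' differentiable (at x)"
proof -
  interpret sw: energy R2 R1 E D1 D2 D3 by (rule energy_swap)
  have "sw.coef = coef'" by (auto simp: sw.coef_def coef'_def)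
  then show ?thesis using sw.coef_differentiable[of x] r reg_swap by metis
qed

text \<open>In the derivative of \<open>D1_formula\<close> the derivatives of the coefficients are
  multiplied by \<open>R1 x \<bullet> u\<close> and \<open>R2 x \<bullet> u\<close>, which vanish.
  The metric on an orbit is a sum of two scaled round forms.\<close>

lemma D2_tang_formula:
  assumes r: "reg R1 R2 x" and t: "tang R1 R2 x u" "tang R1 R2 x v"
  shows "D2 x u v = coef x * (R1 u \<bullet> R1 v) + coef' x * (R2 u \<bullet> R2 v)"
proof -
  have x: "x \<noteq> 0" using r reg_nonzero by blast
  obtain a b where a: "(coef has_derivative a) (at x)" and b: "(coef' has_derivative b) (at x)"
    using coef_differentiable[OF r] coef'_differentiable[OF r] unfolding differentiable_def by blast
  have "((\<lambda>x. coef x * (R1 x \<bullet> u) + coef' x * (R2 x \<bullet> u)) has_derivative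
     (\<lambda>v. (coef x * (R1 v \<bullet> u) + a v * (R1 x \<bullet> u)) + (coef' x * (R2 v \<bullet> u) + b v * (R2 x \<bullet> u)))) (at x)"
    by (intro has_derivative_add has_derivative_mult a b has_derivative_inner_left linear_imp_has_derivative lin1 lin2)
  then have "((\<lambda>x. D1 x u) has_derivative
     (\<lambda>v. (coef x * (R1 v \<bullet> u) + a v * (R1 x \<bullet> u)) + (coef' x * (R2 v \<bullet> u) + b v * (R2 x \<bullet> u)))) (at x)"
    by (rule has_derivative_transform_within_open[OF _ open_reg]) (use r D1_formula in auto)
  from fun_cong[OF has_derivative_unique[OF D2[OF x] this], of v]
  have "D2 x u v = (coef x * (R1 v \<bullet> u) + a v * (R1 x \<bullet> u)) + (coef' x * (R2 v \<bullet> u) + b v * (R2 x \<bullet> u))" .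
  then show ?thesis
    using tang_inner[OF t(1)] inner_P1_left[of v u] inner_P2_left[of v u] by (simp add: inner_commute)
qed

text \<open>Along the line from x in a normal direction both components are only rescaled, so u and
  v stay tangent and \<open>D2_tang_formula\<close> can be differentiated with u and v fixed; c and
  c' are the derivatives of the two coefficients.\<close>

lemma D3_tang_normal:
  assumes r: "reg R1 R2 x"
  obtains c c' where "\<And>u v. tang R1 R2 x u \<Longrightarrow> tang R1 R2 x v \<Longrightarrow>
    D3 x u v (p *\<^sub>R R1 x + q *\<^sub>R R2 x) = c * (R1 u \<bullet> R1 v) + c' * (R2 u \<bullet> R2 v)"
proof -
  let ?z = "p *\<^sub>R R1 x + q *\<^sub>R R2 x"
  have x: "x \<noteq> 0" using r reg_nonzero by blast
  obtain a b where a: "(coef has_derivative a) (at x)" and b: "(coef' has_derivative b) (at x)"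
    using coef_differentiable[OF r] coef'_differentiable[OF r] unfolding differentiable_def by blast
  let ?T = "(\<lambda>t. x + t *\<^sub>R ?z) -` {x. reg R1 R2 x}"
  have T: "open ?T" by (intro open_vimage open_reg continuous_intros)
  have "D3 x u v ?z = a ?z * (R1 u \<bullet> R1 v) + b ?z * (R2 u \<bullet> R2 v)"
    if u: "tang R1 R2 x u" and v: "tang R1 R2 x v" for u v
  proof -
    have "((\<lambda>t. coef (x + t *\<^sub>R ?z)) has_real_derivative a ?z) (at 0)"
      "((\<lambda>t. coef' (x + t *\<^sub>R ?z)) has_real_derivative b ?z) (at 0)"
      by (rule has_real_derivative_along_line; simp add: a b)+
    then have *: "((\<lambda>t. coef (x + t *\<^sub>R ?z) * (R1 u \<bullet> R1 v) + coef' (x + t *\<^sub>R ?z) * (R2 u \<bullet> R2 v)) has_real_derivative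
       a ?z * (R1 u \<bullet> R1 v) + b ?z * (R2 u \<bullet> R2 v)) (at 0)"
      by (intro DERIV_add DERIV_cmult_right)
    have **: "coef (x + t *\<^sub>R ?z) * (R1 u \<bullet> R1 v) + coef' (x + t *\<^sub>R ?z) * (R2 u \<bullet> R2 v) = D2 (x + t *\<^sub>R ?z) u v"
      if "t \<in> ?T" for t
    proof -
      have "tang R1 R2 (x + t *\<^sub>R ?z) w" if "tang R1 R2 x w" for w
        using that by (simp add: tang_def inner_add_right)
      then show ?thesis using D2_tang_formula[of "x + t *\<^sub>R ?z" u v] that u v by simp
    qed
    have "((\<lambda>t. D2 (x + t *\<^sub>R ?z) u v) has_real_derivative
       a ?z * (R1 u \<bullet> R1 v) + b ?z * (R2 u \<bullet> R2 v)) (at 0)"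
      by (rule has_field_derivative_transform_within_open[OF * T _ **]) (use r in auto)
    moreover have "((\<lambda>t. D2 (x + t *\<^sub>R ?z) u v) has_real_derivative D3 x u v ?z) (at 0)"
      by (rule has_real_derivative_along_line[of "\<lambda>x. D2 x u v"]) (simp add: D3[OF x])
    ultimately show ?thesis using DERIV_unique by blast
  qed
  then show ?thesis using that by blast
qed

text \<open>Tangent vectors are orthogonal to x block by block, so both signs give the same radii;
  in a thin block p has no component.\<close>

lemma orb_reflect:
  assumes r: "reg R1 R2 x" and p: "tang R1 R2 x p"
  shows "orb R1 R2 (x + p) (x - p)"
proof -
  interpret sw: splitting R2 R1 by (rule splitting_swap)
  have n: "norm (R1 x + R1 p) = norm (R1 x - R1 p)" "norm (R2 x + R2 p) = norm (R2 x - R2 p)"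
    using tang_inner[OF p] by (simp_all add: norm_eq inner_add_left inner_add_right inner_diff_left inner_diff_right)
  have "R1 p = 0" if "\<not> wide R1" using tang_thin1[OF r that p] .
  moreover have "R2 p = 0" if "\<not> wide R2" using sw.tang_thin1[of x p] that r p by (simp add: reg_swap tang_swap)
  ultimately show ?thesis using n unfolding orb_def by auto
qed

lemma tang_plus_nonzero:
  assumes "reg R1 R2 x" "tang R1 R2 x p"
  shows "x + p \<noteq> 0"
proof
  assume "x + p = 0"
  then have "R1 x + R1 p = 0" using P_linear(1)[of x p] by simp
  then have "R1 x \<bullet> (R1 x + R1 p) = 0" by simp
  then show False using tang_inner[OF assms(2)] assms(1) by (simp add: inner_add_right reg_def)
qed

text \<open>On the affine space through x spanned by the tangent vectors, E is even about x.\<close>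

lemma D3_tang:
  assumes r: "reg R1 R2 x" and u: "tang R1 R2 x u" and v: "tang R1 R2 x v" and w: "tang R1 R2 x w"
  shows "D3 x u v w = 0"
proof -
  have minus: "tang R1 R2 x (- p)" if "tang R1 R2 x p" for p
    using tang_lin(2)[OF that, of "-1"] by simp
  have nz: "x + p \<noteq> 0" "x - p \<noteq> 0" if "tang R1 R2 x p" for p
    using tang_plus_nonzero[OF r that] tang_plus_nonzero[OF r minus[OF that]] by simp_all
  \<comment> \<open>An even function has an odd differential and an even Hessian
    (\<open>d2\<close>); the derivative of the latter vanishes at the centre.\<close>
  have d1: "D1 (x - p) q = - D1 (x + p) q" if p: "tang R1 R2 x p" and q: "tang R1 R2 x q" for p q
  proof -
    have "((\<lambda>t. E ((x + p) + t *\<^sub>R q)) has_real_derivative D1 (x + p) q) (at 0)"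
      using D1[OF nz(1)[OF p]] by (intro has_real_derivative_along_line) simp
    moreover have "((\<lambda>t. E ((x - p) + t *\<^sub>R (-q))) has_real_derivative D1 (x - p) (-q)) (at 0)"
      using D1[OF nz(2)[OF p]] by (intro has_real_derivative_along_line) simp
    moreover have "E ((x + p) + t *\<^sub>R q) = E ((x - p) + t *\<^sub>R (-q))" for t
      using E_inv[OF orb_reflect[OF r, of "p + t *\<^sub>R q"]] p q by (simp add: tang_lin algebra_simps)
    ultimately have "D1 (x + p) q = D1 (x - p) (-q)" by (rule DERIV_unique_eq)
    then show ?thesis using linear_neg[OF D1_linear[OF nz(2)[OF p]], of q] by simp
  qed
  have d2: "D2 (x - p) u v = D2 (x + p) u v" if p: "tang R1 R2 x p" for p
  proof -
    have *: "((\<lambda>t. D1 ((x + p) + t *\<^sub>R v) u) has_real_derivative D2 (x + p) u v) (at 0)"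
      using D2[OF nz(1)[OF p]] by (intro has_real_derivative_along_line[of "\<lambda>x. D1 x u"]) simp
    have **: "((\<lambda>t. D1 ((x - p) + t *\<^sub>R (-v)) u) has_real_derivative D2 (x - p) u (-v)) (at 0)"
      using D2[OF nz(2)[OF p]] by (intro has_real_derivative_along_line[of "\<lambda>x. D1 x u"]) simp
    have "D1 ((x - p) + t *\<^sub>R (-v)) u = - D1 ((x + p) + t *\<^sub>R v) u" for t
      using d1[of "p + t *\<^sub>R v" u] p u v by (simp add: tang_lin algebra_simps)
    then have "- D2 (x + p) u v = D2 (x - p) u (-v)"
      by (intro DERIV_unique_eq[OF DERIV_minus[OF *] **]) simp
    then show ?thesis using linear_neg[OF D2_linear2[OF nz(2)[OF p]], of u v] by simp
  qed
  have x: "x \<noteq> 0" using r reg_nonzero by blast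
  have "((\<lambda>t. D2 (x + t *\<^sub>R w) u v) has_real_derivative D3 x u v w) (at 0)"
    by (rule has_real_derivative_along_line[of "\<lambda>x. D2 x u v"]) (simp add: D3 x)
  moreover have "((\<lambda>t. D2 (x + t *\<^sub>R (-w)) u v) has_real_derivative D3 x u v (-w)) (at 0)"
    by (rule has_real_derivative_along_line[of "\<lambda>x. D2 x u v"]) (simp add: D3 x)
  moreover have "D2 (x + t *\<^sub>R w) u v = D2 (x + t *\<^sub>R (-w)) u v" for t
    using d2[of "t *\<^sub>R w"] w by (simp add: tang_lin)
  ultimately have "D3 x u v w = D3 x u v (-w)" by (rule DERIV_unique_eq)
  then show ?thesis using linear_neg[OF D3_linear[OF x], of u v w] by simp
qed

end

section \<open>Energies whose Hessian makes the two blocks orthogonal\<close>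

context energy
begin

context
  fixes C
  assumes C: "open C" "0 \<notin> C" and orth: "\<And>x u v. x \<in> C \<Longrightarrow> D2 x (R1 u) (R2 v) = 0"
begin

lemma coef_derivative_zero:
  assumes y: "y \<in> C" and r: "reg R1 R2 y"
  shows "(coef has_derivative (\<lambda>_. 0)) (at y)"
proof -
  have y0: "y \<noteq> 0" using r reg_nonzero by blast
  have N: "R1 y \<bullet> R1 y \<noteq> 0" using r by (simp add: reg_def)
  obtain a where a: "(coef has_derivative a) (at y)"
    using coef_differentiable[OF r] unfolding differentiable_def by blast
  have al: "linear a" using a has_derivative_linear by blast
  have "((\<lambda>x. coef x * (R1 x \<bullet> R1 x)) has_derivative
      (\<lambda>v. coef y * (R1 y \<bullet> R1 v + R1 v \<bullet> R1 y) + a v * (R1 y \<bullet> R1 y))) (at y)"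
    by (intro has_derivative_mult a has_derivative_inner linear_imp_has_derivative lin1)
  then have "((\<lambda>x. D1 x (R1 x)) has_derivative
      (\<lambda>v. coef y * (R1 y \<bullet> R1 v + R1 v \<bullet> R1 y) + a v * (R1 y \<bullet> R1 y))) (at y)"
    by (rule has_derivative_transform_within_open[OF _ open_reg]) (use r in \<open>auto simp: coef_def reg_def\<close>)
  from fun_cong[OF has_derivative_unique[OF this D1_radial_derivative[OF y0]]]
  \<comment> \<open>Obtained by differentiating
    \<open>coef x * (R1 x \<bullet> R1 x) = D1 x (R1 x)\<close>; the vanishing of \<open>a\<close>
    in the several directions follows by specialising v.\<close>
  have key: "coef y * (2 * (R1 y \<bullet> R1 v)) + a v * (R1 y \<bullet> R1 y) = D2 y (R1 y) v + D1 y (R1 v)" for v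
    by (simp add: inner_commute)
  have a2: "a (R2 v) = 0" for v
    using key[of "R2 v"] orth[OF y, of y v] N linear_0[OF D1_linear[OF y0]] by simp
  \<comment> \<open>Homogeneity: for v = y both terms on the right of \<open>key\<close> equal
    \<open>coef y * (R1 y \<bullet> R1 y)\<close>, which leaves nothing for
    \<open>a y\<close>.\<close>
  have "D2 y (R1 y) y = D1 y (R1 y)" using euler2[OF y0] D2_sym[OF y0] by metis
  then have ay: "a y = 0" using key[of y] N by (simp add: coef_def)
  have a1: "a (R1 y) = 0" using ay a2[of y] linear_add[OF al, of "R1 y" "R2 y"] by (simp add: split_sum)
  have at: "a t = 0" if t: "tang R1 R2 y t" for t
    using key[of t] tang_inner[OF t] D2_radial_tang[OF r t] D1_tang[OF r tang_P(1)[OF t]] N by simp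
  have "a v = 0" for v
  proof -
    obtain t where "tang R1 R2 y t"
      "v = ((R1 y \<bullet> v) / (R1 y \<bullet> R1 y)) *\<^sub>R R1 y + ((R2 y \<bullet> v) / (R2 y \<bullet> R2 y)) *\<^sub>R R2 y + t"
      using tang_decomp[OF r] by blast
    then show ?thesis using a1 a2 at linear_add[OF al] linear_scale[OF al] by (metis add_0 scale_zero_right)
  qed
  then have "a = (\<lambda>_. 0)" by auto
  then show ?thesis using a by simp
qed

lemma D2_block1:
  assumes y: "y \<in> C" and r: "reg R1 R2 y"
  shows "D2 y (R1 u) v = coef y * (R1 u \<bullet> R1 v)"
proof -
  have y0: "y \<noteq> 0" using r reg_nonzero by blast
  have "((\<lambda>x. coef x * (R1 x \<bullet> R1 u)) has_derivative (\<lambda>v. coef y * (R1 v \<bullet> R1 u) + 0 * (R1 y \<bullet> R1 u))) (at y)"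
    by (intro has_derivative_mult coef_derivative_zero y r has_derivative_inner_left linear_imp_has_derivative lin1)
  then have "((\<lambda>x. D1 x (R1 u)) has_derivative (\<lambda>v. coef y * (R1 v \<bullet> R1 u) + 0 * (R1 y \<bullet> R1 u))) (at y)"
    by (rule has_derivative_transform_within_open[OF _ open_reg]) (use r D1_formula in auto)
  from fun_cong[OF has_derivative_unique[OF this D2[OF y0]], of v]
  show ?thesis by (simp add: inner_commute)
qed

lemma D3_block1:
  assumes y: "y \<in> C" and r: "reg R1 R2 y"
  shows "D3 y (R1 u) v w = 0"
proof -
  have y0: "y \<noteq> 0" using r reg_nonzero by blast
  have "((\<lambda>x. coef x * (R1 u \<bullet> R1 v)) has_derivative (\<lambda>w. 0 * (R1 u \<bullet> R1 v))) (at y)"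
    by (intro has_derivative_mult_left coef_derivative_zero y r)
  then have "((\<lambda>x. D2 x (R1 u) v) has_derivative (\<lambda>w. 0 * (R1 u \<bullet> R1 v))) (at y)"
    by (rule has_derivative_transform_within_open[OF _ open_Int[OF C(1) open_reg]]) (use y r D2_block1 in auto)
  from fun_cong[OF has_derivative_unique[OF this D3[OF y0]], of w]
  show ?thesis by simp
qed

end

lemma D2_block:
  assumes C: "open C" "0 \<notin> C" and orth: "\<And>x u v. x \<in> C \<Longrightarrow> D2 x (R1 u) (R2 v) = 0"
    and y: "y \<in> C" and r: "reg R1 R2 y"
  shows "D2 y u v = coef y * (R1 u \<bullet> R1 v) + coef' y * (R2 u \<bullet> R2 v)"
    and "D3 y u v w = 0"
proof -
  interpret sw: energy R2 R1 E D1 D2 D3 by (rule energy_swap)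
  have c: "sw.coef = coef'" by (auto simp: sw.coef_def coef'_def)
  have y0: "y \<noteq> 0" using r reg_nonzero by blast
  have orth': "D2 x (R2 u) (R1 v) = 0" if "x \<in> C" for x u v
    using orth[OF that] D2_sym[of x "R2 u" "R1 v"] C(2) that by metis
  have "D2 y (R2 u) v = coef' y * (R2 u \<bullet> R2 v)"
    using sw.D2_block1[OF C orth' y, of u v] r by (simp add: c reg_swap)
  then show "D2 y u v = coef y * (R1 u \<bullet> R1 v) + coef' y * (R2 u \<bullet> R2 v)"
    using D2_block1[OF C orth y r, of u v] linear_add[OF D2_linear1[OF y0, of v], of "R1 u" "R2 u"]
    by (simp add: split_sum)
  have l: "linear (\<lambda>u. D3 y u v w)"
  proof -
    have "(\<lambda>u. D3 y u v w) = D3 y v w" using D3_sym12[OF y0, of _ v w] D3_sym[OF y0, of v _ w] by auto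
    then show ?thesis using D3_linear[OF y0] by simp
  qed
  have "D3 y (R2 u) v w = 0"
    using sw.D3_block1[OF C orth' y, of u v w] r by (simp add: reg_swap)
  then show "D3 y u v w = 0"
    using D3_block1[OF C orth y r, of u v w] linear_add[OF l, of "R1 u" "R2 u"]
    by (simp add: split_sum)
qed

text \<open>A wide block contains a tangent vector w, and the Hessian evaluated on it is
  \<open>coef x * (w \<bullet> w)\<close>.\<close>

lemma coef_pos:
  assumes "wide R1" "reg R1 R2 x"
  shows "coef x > 0"
proof -
  obtain w where w: "R1 w = w" "w \<noteq> 0" "w \<bullet> R1 x = 0" using wide1[OF assms(1)] by blast
  have w2: "R2 w = 0" using w(1) by (metis P2P1)
  have t: "tang R1 R2 x w" using w(3) w2 inner_P2_right[of w x] by (simp add: tang_def)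
  have "D2 x w w > 0" using w assms reg_nonzero by (intro D2_pos) auto
  then have "coef x * (w \<bullet> w) > 0" using D2_tang_formula[OF assms(2) t t] w w2 by simp
  moreover have "w \<bullet> w > 0" using w(2) by simp
  ultimately show ?thesis by (rule zero_less_mult_pos2)
qed

lemma coef'_pos:
  assumes "wide R2" "reg R1 R2 x"
  shows "coef' x > 0"
proof -
  interpret sw: energy R2 R1 E D1 D2 D3 by (rule energy_swap)
  show ?thesis using sw.coef_pos[of x] assms by (simp add: sw.coef_def coef'_def reg_swap)
qed

lemma D2_radial2_tang:
  assumes "reg R1 R2 x" "tang R1 R2 x u"
  shows "D2 x (R2 x) u = 0"
  using energy.D2_radial_tang[OF energy_swap, of x u] assms by (simp add: reg_swap tang_swap)

text \<open>Radial vectors are Hessian-orthogonal to the orbit, so the tangential part of v is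
  Hessian-orthogonal to itself and vanishes. The Hessian-normal and the Euclidean-normal space of an
  orbit coincide.\<close>

lemma normal_if_orthogonal:
  assumes r: "reg R1 R2 x" and o: "\<And>t. tang R1 R2 x t \<Longrightarrow> D2 x v t = 0"
  shows "v = ((R1 x \<bullet> v) / (R1 x \<bullet> R1 x)) *\<^sub>R R1 x + ((R2 x \<bullet> v) / (R2 x \<bullet> R2 x)) *\<^sub>R R2 x"
proof -
  have x: "x \<noteq> 0" using r reg_nonzero by blast
  obtain t where t: "tang R1 R2 x t"
    "v = ((R1 x \<bullet> v) / (R1 x \<bullet> R1 x)) *\<^sub>R R1 x + ((R2 x \<bullet> v) / (R2 x \<bullet> R2 x)) *\<^sub>R R2 x + t"
    using tang_decomp[OF r] by blast
  define c d where "c = (R1 x \<bullet> v) / (R1 x \<bullet> R1 x)" and "d = (R2 x \<bullet> v) / (R2 x \<bullet> R2 x)"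
  have v: "v = c *\<^sub>R R1 x + d *\<^sub>R R2 x + t" using t(2) by (simp add: c_def d_def)
  have "D2 x v t = c * D2 x (R1 x) t + d * D2 x (R2 x) t + D2 x t t"
    unfolding v by (simp add: linear_add[OF D2_linear1[OF x]] linear_scale[OF D2_linear1[OF x]])
  then have "D2 x t t = 0" using o[OF t(1)] D2_radial_tang[OF r t(1)] D2_radial2_tang[OF r t(1)] by simp
  then have "t = 0" using D2_pos[OF x, of t] by force
  then show ?thesis using t(2) by simp
qed

end

section \<open>Hessian isometries from a Euclidean cone\<close>

text \<open>The source carries the constant metric found in the first half, the target an arbitrary
  invariant energy. Separate projections P and R allow the target blocks to be exchanged alone;
  matched blocks only have to agree in being wide.\<close>

locale hessian_iso = energy R1 R2 E D1 D2 D3 + src: splitting P1 P2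
  for P1 P2 R1 R2 :: "'v::euclidean_space \<Rightarrow> 'v" and E D1 D2 D3 +
  fixes \<Phi> :: "'v \<Rightarrow> 'v" and d\<Phi> :: "'v \<Rightarrow> 'v \<Rightarrow> 'v" and dd\<Phi> :: "'v \<Rightarrow> 'v \<Rightarrow> 'v \<Rightarrow> 'v"
    and C :: "'v set" and a b :: real
  assumes open_C: "open C"
    and \<Phi>_nonzero: "x \<in> C \<Longrightarrow> \<Phi> x \<noteq> 0"
    and inj: "inj_on \<Phi> C"
    and d\<Phi>: "x \<in> C \<Longrightarrow> (\<Phi> has_derivative d\<Phi> x) (at x)"
    and dd\<Phi>: "x \<in> C \<Longrightarrow> ((\<lambda>x. d\<Phi> x u) has_derivative dd\<Phi> x u) (at x)"
    and dd\<Phi>_sym: "x \<in> C \<Longrightarrow> dd\<Phi> x u v = dd\<Phi> x v u"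
    and d\<Phi>_self: "x \<in> C \<Longrightarrow> d\<Phi> x x = \<Phi> x"
    and iso: "x \<in> C \<Longrightarrow> D2 (\<Phi> x) (d\<Phi> x u) (d\<Phi> x v) = a * (P1 u \<bullet> P1 v) + b * (P2 u \<bullet> P2 v)"
    and a_pos: "a > 0" and b_pos: "b > 0"
    and C_inv: "x \<in> C \<Longrightarrow> orb P1 P2 x y \<Longrightarrow> y \<in> C"
    and \<Phi>_orb: "x \<in> C \<Longrightarrow> orb P1 P2 x y \<Longrightarrow> orb R1 R2 (\<Phi> x) (\<Phi> y)"
    and wide1_iff: "wide P1 \<longleftrightarrow> wide R1" and wide2_iff: "wide P2 \<longleftrightarrow> wide R2"
begin

lemma iso_swap: "hessian_iso P2 P1 R2 R1 E D1 D2 D3 \<Phi> d\<Phi> dd\<Phi> C b a"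
proof (intro hessian_iso.intro energy_swap src.splitting_swap hessian_iso_axioms.intro)
  show "D2 (\<Phi> x) (d\<Phi> x u) (d\<Phi> x v) = b * (P2 u \<bullet> P2 v) + a * (P1 u \<bullet> P1 v)" if "x \<in> C" for x u v
    using iso[OF that] by simp
qed (auto intro: open_C inj d\<Phi> dd\<Phi> dd\<Phi>_sym d\<Phi>_self C_inv \<Phi>_orb
    dest: \<Phi>_nonzero simp: a_pos b_pos wide1_iff wide2_iff orb_swap)

text \<open>Turns crossed points into straight ones. With both blocks wide, the conditions
  \<open>wide1_iff\<close> and \<open>wide2_iff\<close> survive the exchange.\<close>

lemma iso_cross:
  assumes "wide P1" "wide P2"
  shows "hessian_iso P1 P2 R2 R1 E D1 D2 D3 \<Phi> d\<Phi> dd\<Phi> C a b"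
  using assms
  by (intro hessian_iso.intro energy_swap src.splitting_axioms hessian_iso_axioms.intro)
     (auto intro: open_C inj d\<Phi> dd\<Phi> dd\<Phi>_sym d\<Phi>_self C_inv \<Phi>_orb
       dest: \<Phi>_nonzero simp: a_pos b_pos wide1_iff wide2_iff orb_swap[of R2 R1] iso)

lemma d\<Phi>_linear: "x \<in> C \<Longrightarrow> linear (d\<Phi> x)"
  using d\<Phi> has_derivative_linear by blast

lemma dd\<Phi>_linear2: "x \<in> C \<Longrightarrow> linear (dd\<Phi> x u)"
  using dd\<Phi> has_derivative_linear by blast

lemma dd\<Phi>_linear1: "x \<in> C \<Longrightarrow> linear (\<lambda>u. dd\<Phi> x u v)"
  using dd\<Phi>_linear2[of x v] dd\<Phi>_sym[of x _ v] by presburger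

lemma Q_pos: "u \<noteq> 0 \<Longrightarrow> a * (P1 u \<bullet> P1 u) + b * (P2 u \<bullet> P2 u) > 0"
proof -
  assume u: "u \<noteq> 0"
  then have "P1 u \<noteq> 0 \<or> P2 u \<noteq> 0" using src.split_sum[of u] by auto
  then show ?thesis using a_pos b_pos
    by (metis add_nonneg_pos add_pos_nonneg inner_ge_zero inner_gt_zero_iff less_imp_le mult_nonneg_nonneg mult_pos_pos)
qed

lemma d\<Phi>_inj: assumes "x \<in> C" shows "inj (d\<Phi> x)"
proof -
  have "u = 0" if "d\<Phi> x u = 0" for u
  proof (rule ccontr)
    assume "u \<noteq> 0"
    then have "D2 (\<Phi> x) (d\<Phi> x u) (d\<Phi> x u) > 0" using iso[OF assms] Q_pos by simp
    then show False using that linear_0[OF D2_linear2[OF \<Phi>_nonzero[OF assms]]] by simp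
  qed
  then show ?thesis using linear_injective_0[OF d\<Phi>_linear[OF assms]] by blast
qed

lemma d\<Phi>_surj: assumes "x \<in> C" obtains u where "d\<Phi> x u = w"
  using linear_injective_imp_surjective[OF d\<Phi>_linear[OF assms] d\<Phi>_inj[OF assms]] surjD by metis

text \<open>A regular point might have a singular image, so regularity is imposed on both sides;
  density of such points comes from the openness of \<Phi> in
  \<open>hessian_isometry_linear\<close>.\<close>

definition good :: "'v \<Rightarrow> bool" where "good x \<longleftrightarrow> x \<in> C \<and> reg P1 P2 x \<and> reg R1 R2 (\<Phi> x)"

lemma goodD: "good x \<Longrightarrow> x \<in> C" "good x \<Longrightarrow> reg P1 P2 x" "good x \<Longrightarrow> reg R1 R2 (\<Phi> x)"
  by (auto simp: good_def)

lemma good_orb: "good x \<Longrightarrow> orb P1 P2 x y \<Longrightarrow> good y"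
  unfolding good_def using C_inv \<Phi>_orb orb_reg src.orb_reg by blast

lemma \<Phi>_cont: "continuous_on C \<Phi>"
  using d\<Phi> by (meson continuous_at_imp_continuous_on has_derivative_continuous)

lemma open_good: "open {x. good x}"
proof -
  have "open (C \<inter> \<Phi> -` {z. reg R1 R2 z})"
    using continuous_open_preimage[OF \<Phi>_cont open_C open_reg] .
  moreover have "continuous_on UNIV P1" "continuous_on UNIV P2"
    using src.lin1 src.lin2 by (simp_all add: linear_continuous_on linear_linear)
  then have "open {x. P1 x \<noteq> 0}" "open {x. P2 x \<noteq> 0}" by (auto intro!: open_Collect_neq continuous_intros)
  then have "open ({x. P1 x \<noteq> 0} \<inter> {x. P2 x \<noteq> 0})" by blast
  ultimately have "open (({x. P1 x \<noteq> 0} \<inter> {x. P2 x \<noteq> 0}) \<inter> (C \<inter> \<Phi> -` {z. reg R1 R2 z}))" by blast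
  moreover have "{x. good x} = ({x. P1 x \<noteq> 0} \<inter> {x. P2 x \<noteq> 0}) \<inter> (C \<inter> \<Phi> -` {z. reg R1 R2 z})"
    by (auto simp: good_def reg_def)
  ultimately show ?thesis by simp
qed

lemma R1\<Phi>_sq_derivative:
  assumes "x \<in> C"
  shows "((\<lambda>x. R1 (\<Phi> x) \<bullet> R1 (\<Phi> x)) has_derivative (\<lambda>v. 2 * (R1 (\<Phi> x) \<bullet> R1 (d\<Phi> x v)))) (at x)"
  using has_derivative_inner[OF has_derivative_P1[OF d\<Phi>[OF assms]] has_derivative_P1[OF d\<Phi>[OF assms]]]
  by (simp add: inner_commute)

lemma R1\<Phi>_sq_inv: "x \<in> C \<Longrightarrow> orb P1 P2 x y \<Longrightarrow> R1 (\<Phi> y) \<bullet> R1 (\<Phi> y) = R1 (\<Phi> x) \<bullet> R1 (\<Phi> x)"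
  using orb_norm1[OF \<Phi>_orb] by metis

text \<open>The squared radius of the first component of \<Phi> is constant on source
  orbits.\<close>

lemma d\<Phi>_tang1:
  assumes g: "good x" and t: "tang P1 P2 x u"
  shows "d\<Phi> x u \<bullet> R1 (\<Phi> x) = 0"
proof -
  have "2 * (R1 (\<Phi> x) \<bullet> R1 (d\<Phi> x u)) = 0"
    by (rule src.invariant_derivative_tang[OF R1\<Phi>_sq_derivative[OF goodD(1)[OF g]] R1\<Phi>_sq_inv goodD(2)[OF g] t])
       (use g in \<open>auto simp: good_def\<close>)
  then show ?thesis using inner_P1_left[of "\<Phi> x" "d\<Phi> x u"] inner_commute[of "d\<Phi> x u"] by simp
qed

lemma d\<Phi>_tang:
  assumes g: "good x" and t: "tang P1 P2 x u"
  shows "tang R1 R2 (\<Phi> x) (d\<Phi> x u)"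
proof -
  interpret sw: hessian_iso P2 P1 R2 R1 E D1 D2 D3 \<Phi> d\<Phi> dd\<Phi> C b a by (rule iso_swap)
  have "d\<Phi> x u \<bullet> R2 (\<Phi> x) = 0"
    using sw.d\<Phi>_tang1[of x u] g t by (simp add: sw.good_def good_def reg_swap tang_swap)
  then show ?thesis using d\<Phi>_tang1[OF g t] by (simp add: tang_def)
qed

lemma d\<Phi>_tang_surj:
  assumes g: "good x" and w: "tang R1 R2 (\<Phi> x) w"
  obtains u where "tang P1 P2 x u" "d\<Phi> x u = w"
proof -
  note x = goodD[OF g]
  let ?S = "{u. tang P1 P2 x u}" and ?T = "{w. tang R1 R2 (\<Phi> x) w}"
  have "d\<Phi> x ` ?S = ?T"
  proof (rule subspace_dim_equal)
    show "subspace (d\<Phi> x ` ?S)" using d\<Phi>_linear[OF x(1)] src.subspace_tang linear_subspace_image by blast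
    show "subspace ?T" by (rule subspace_tang)
    show "d\<Phi> x ` ?S \<subseteq> ?T" using d\<Phi>_tang[OF g] by auto
    have "dim (d\<Phi> x ` ?S) = dim ?S"
      by (rule dim_image_eq[OF d\<Phi>_linear[OF x(1)]]) (use d\<Phi>_inj[OF x(1)] in \<open>auto simp: inj_on_def\<close>)
    then show "dim ?T \<le> dim (d\<Phi> x ` ?S)" using src.dim_tang[OF x(2)] dim_tang[OF x(3)] by simp
  qed
  then have "w \<in> d\<Phi> x ` ?S" using w by simp
  then show ?thesis using that by auto
qed

text \<open>\<open>rho\<close> and \<open>sig\<close> are the coordinates of
  \<open>d\<Phi> x (P1 x)\<close> in the radial frame at \<Phi>(x). On an open set of straight
  points they turn out to be 1 and 0.\<close>

definition rho :: "'v \<Rightarrow> real" where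
  "rho x = (R1 (\<Phi> x) \<bullet> R1 (d\<Phi> x (P1 x))) / (R1 (\<Phi> x) \<bullet> R1 (\<Phi> x))"
definition sig :: "'v \<Rightarrow> real" where
  "sig x = (R2 (\<Phi> x) \<bullet> R2 (d\<Phi> x (P1 x))) / (R2 (\<Phi> x) \<bullet> R2 (\<Phi> x))"

text \<open>\<open>P1 x\<close> is orthogonal to the source orbit, tangent spaces are mapped onto
  tangent spaces, and Hessian-normal vectors are radial.\<close>

lemma d\<Phi>_radial:
  assumes g: "good x"
  shows "d\<Phi> x (P1 x) = rho x *\<^sub>R R1 (\<Phi> x) + sig x *\<^sub>R R2 (\<Phi> x)"
proof -
  note x = goodD[OF g]
  have "D2 (\<Phi> x) (d\<Phi> x (P1 x)) t = 0" if "tang R1 R2 (\<Phi> x) t" for t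
  proof -
    obtain u where u: "tang P1 P2 x u" "d\<Phi> x u = t" using d\<Phi>_tang_surj[OF g \<open>tang R1 R2 (\<Phi> x) t\<close>] by blast
    show ?thesis using iso[OF x(1), of "P1 x" u] src.tang_inner[OF u(1)] by (simp add: u(2))
  qed
  from normal_if_orthogonal[OF x(3) this]
  show ?thesis using inner_P1_left[of "\<Phi> x" "d\<Phi> x (P1 x)"] inner_P2_left[of "\<Phi> x" "d\<Phi> x (P1 x)"]
    by (simp add: rho_def sig_def)
qed

lemma d\<Phi>_radial_derivative:
  assumes "x \<in> C"
  shows "((\<lambda>x. d\<Phi> x (P1 x)) has_derivative (\<lambda>v. dd\<Phi> x (P1 x) v + d\<Phi> x (P1 v))) (at x)"
  by (rule has_derivative_linear_family[OF open_C])
     (use assms d\<Phi>_linear dd\<Phi> linear_imp_has_derivative[OF src.lin1] in auto)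

text \<open>The numerator is half the radial derivative of the orbit invariant
  \<open>R1 (\<Phi> x) \<bullet> R1 (\<Phi> x)\<close>.\<close>

lemma rho_inv:
  assumes "x \<in> C" "orb P1 P2 x y" shows "rho y = rho x"
  using src.radial_derivative_invariant[OF open_C assms(1) R1\<Phi>_sq_inv R1\<Phi>_sq_derivative[OF assms(1)]
      R1\<Phi>_sq_derivative[OF C_inv[OF assms]] assms(2)] R1\<Phi>_sq_inv[OF assms]
  by (simp add: rho_def)

lemma sig_inv:
  assumes "x \<in> C" "orb P1 P2 x y" shows "sig y = sig x"
proof -
  interpret sw: hessian_iso P2 P1 R2 R1 E D1 D2 D3 \<Phi> d\<Phi> dd\<Phi> C b a by (rule iso_swap)
  have inv: "R2 (\<Phi> y) \<bullet> R2 (\<Phi> y) = R2 (\<Phi> x) \<bullet> R2 (\<Phi> x)" if "x \<in> C" "orb P1 P2 x y" for x y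
    using sw.R1\<Phi>_sq_inv that by (simp add: orb_swap)
  show ?thesis
    using src.radial_derivative_invariant[OF open_C assms(1) inv sw.R1\<Phi>_sq_derivative[OF assms(1)]
      sw.R1\<Phi>_sq_derivative[OF C_inv[OF assms]] assms(2)] inv[OF assms]
    by (simp add: sig_def)
qed

lemma rho_differentiable: assumes g: "good x" shows "rho differentiable (at x)"
proof -
  note x = goodD[OF g]
  have "(\<lambda>x. R1 (\<Phi> x) \<bullet> R1 (d\<Phi> x (P1 x))) differentiable (at x)"
    unfolding differentiable_def
    by (rule exI, rule has_derivative_inner;
        rule has_derivative_P1, rule d\<Phi>[OF x(1)] d\<Phi>_radial_derivative[OF x(1)])
  moreover have "(\<lambda>x. R1 (\<Phi> x) \<bullet> R1 (\<Phi> x)) differentiable (at x)"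
    using R1\<Phi>_sq_derivative[OF x(1)] by (auto simp: differentiable_def)
  ultimately show ?thesis unfolding rho_def
    using x(3) by (intro differentiable_divide) (auto simp: reg_def)
qed

lemma sig_differentiable: assumes g: "good x" shows "sig differentiable (at x)"
proof -
  note x = goodD[OF g]
  have "(\<lambda>x. R2 (\<Phi> x) \<bullet> R2 (d\<Phi> x (P1 x))) differentiable (at x)"
    unfolding differentiable_def
    by (rule exI, rule has_derivative_inner;
        rule has_derivative_P2, rule d\<Phi>[OF x(1)] d\<Phi>_radial_derivative[OF x(1)])
  moreover have "(\<lambda>x. R2 (\<Phi> x) \<bullet> R2 (\<Phi> x)) differentiable (at x)"
    unfolding differentiable_def
    by (rule exI, rule has_derivative_inner; rule has_derivative_P2, rule d\<Phi>[OF x(1)])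
  ultimately show ?thesis unfolding sig_def
    using x(3) by (intro differentiable_divide) (auto simp: reg_def)
qed

text \<open>The derivative of \<open>d\<Phi>_radial\<close> along the orbit, where
  \<open>rho\<close> and \<open>sig\<close> are constant.\<close>

lemma dd\<Phi>_radial_tang:
  assumes g: "good x" and u: "tang P1 P2 x u"
  shows "dd\<Phi> x (P1 x) u + d\<Phi> x (P1 u) = rho x *\<^sub>R R1 (d\<Phi> x u) + sig x *\<^sub>R R2 (d\<Phi> x u)"
proof -
  note x = goodD[OF g]
  obtain r s where r: "(rho has_derivative r) (at x)" and s: "(sig has_derivative s) (at x)"
    using rho_differentiable[OF g] sig_differentiable[OF g] unfolding differentiable_def by blast
  have r0: "r u = 0" using src.invariant_derivative_tang[OF r _ x(2) u] rho_inv x(1) by blast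
  have s0: "s u = 0" using src.invariant_derivative_tang[OF s _ x(2) u] sig_inv x(1) by blast
  have "((\<lambda>x. rho x *\<^sub>R R1 (\<Phi> x) + sig x *\<^sub>R R2 (\<Phi> x)) has_derivative
     (\<lambda>v. (rho x *\<^sub>R R1 (d\<Phi> x v) + r v *\<^sub>R R1 (\<Phi> x)) + (sig x *\<^sub>R R2 (d\<Phi> x v) + s v *\<^sub>R R2 (\<Phi> x)))) (at x)"
    by (intro has_derivative_add has_derivative_scaleR r s has_derivative_P1 has_derivative_P2 d\<Phi> x)
  then have "((\<lambda>x. d\<Phi> x (P1 x)) has_derivative
     (\<lambda>v. (rho x *\<^sub>R R1 (d\<Phi> x v) + r v *\<^sub>R R1 (\<Phi> x)) + (sig x *\<^sub>R R2 (d\<Phi> x v) + s v *\<^sub>R R2 (\<Phi> x)))) (at x)"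
    by (rule has_derivative_transform_within_open[OF _ open_good]) (use g d\<Phi>_radial in auto)
  from fun_cong[OF has_derivative_unique[OF d\<Phi>_radial_derivative[OF x(1)] this], of u]
  show ?thesis using r0 s0 by simp
qed

text \<open>Differentiating the isometry equation expresses the second derivative of the isometry
  through the Cartan tensor of the target, by the argument that determines the Levi-Civita connection.\<close>

lemma second_form:
  assumes x: "x \<in> C"
  shows "D2 (\<Phi> x) (dd\<Phi> x u v) (d\<Phi> x w) = - D3 (\<Phi> x) (d\<Phi> x u) (d\<Phi> x v) (d\<Phi> x w) / 2"
proof -
  note z = \<Phi>_nonzero[OF x]
  \<comment> \<open>The derivative of the isometry equation along w; its right-hand side is constant
    in x.\<close>
  have key: "D3 (\<Phi> x) (d\<Phi> x u) (d\<Phi> x v) (d\<Phi> x w) + D2 (\<Phi> x) (dd\<Phi> x u w) (d\<Phi> x v)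
      + D2 (\<Phi> x) (dd\<Phi> x v w) (d\<Phi> x u) = 0" for u v w
  proof -
    have 1: "((\<lambda>x. D2 (\<Phi> x) p q) has_derivative (\<lambda>w. D3 (\<Phi> x) p q (d\<Phi> x w))) (at x)" for p q
      using has_derivative_compose[OF d\<Phi>[OF x], of "\<lambda>z. D2 z p q"] D3[OF z] by blast
    have 2: "((\<lambda>x. D2 (\<Phi> x) (d\<Phi> x u) q) has_derivative
        (\<lambda>w. D3 (\<Phi> x) (d\<Phi> x u) q (d\<Phi> x w) + D2 (\<Phi> x) (dd\<Phi> x u w) q)) (at x)" for q
      by (rule has_derivative_linear_family[of C x "\<lambda>x p. D2 (\<Phi> x) p q", OF open_C x _ 1 dd\<Phi>[OF x]])
         (use D2_linear1 \<Phi>_nonzero in blast)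
    have 3: "((\<lambda>x. D2 (\<Phi> x) (d\<Phi> x u) (d\<Phi> x v)) has_derivative
        (\<lambda>w. (D3 (\<Phi> x) (d\<Phi> x u) (d\<Phi> x v) (d\<Phi> x w) + D2 (\<Phi> x) (dd\<Phi> x u w) (d\<Phi> x v))
          + D2 (\<Phi> x) (d\<Phi> x u) (dd\<Phi> x v w))) (at x)"
      by (rule has_derivative_linear_family[of C x "\<lambda>x p. D2 (\<Phi> x) (d\<Phi> x u) p", OF open_C x _ 2 dd\<Phi>[OF x]])
         (use D2_linear2 \<Phi>_nonzero in blast)
    have "((\<lambda>x. D2 (\<Phi> x) (d\<Phi> x u) (d\<Phi> x v)) has_derivative (\<lambda>w. 0)) (at x)"
      by (rule has_derivative_transform_within_open[OF _ open_C x, where f = "\<lambda>_. a * (P1 u \<bullet> P1 v) + b * (P2 u \<bullet> P2 v)"])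
         (simp_all add: iso)
    from fun_cong[OF has_derivative_unique[OF 3 this], of w]
    show ?thesis using D2_sym[OF z, of "d\<Phi> x u"] by simp
  qed
  have s: "D3 (\<Phi> x) p q r = D3 (\<Phi> x) q p r" "D3 (\<Phi> x) p q r = D3 (\<Phi> x) p r q" for p q r
    using D3_sym12[OF z] D3_sym[OF z] by auto
  \<comment> \<open>By symmetry of \<open>D3\<close> and \<open>dd\<Phi>\<close>, three permutations
    of \<open>key\<close> form a linear system: the three pairings with \<open>dd\<Phi>\<close> are
    equal, and each is - T / 2.\<close>
  let ?T = "D3 (\<Phi> x) (d\<Phi> x u) (d\<Phi> x v) (d\<Phi> x w)"
  have "?T + D2 (\<Phi> x) (dd\<Phi> x u w) (d\<Phi> x v) + D2 (\<Phi> x) (dd\<Phi> x v w) (d\<Phi> x u) = 0"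
    using key[of u v w] .
  moreover have "?T + D2 (\<Phi> x) (dd\<Phi> x u v) (d\<Phi> x w) + D2 (\<Phi> x) (dd\<Phi> x v w) (d\<Phi> x u) = 0"
    using key[of u w v] s(2)[of "d\<Phi> x u" "d\<Phi> x w" "d\<Phi> x v"] dd\<Phi>_sym[OF x, of w v] by simp
  moreover have "?T + D2 (\<Phi> x) (dd\<Phi> x u v) (d\<Phi> x w) + D2 (\<Phi> x) (dd\<Phi> x u w) (d\<Phi> x v) = 0"
    using key[of v w u] s(1)[of "d\<Phi> x u" "d\<Phi> x v" "d\<Phi> x w"] s(2)[of "d\<Phi> x v" "d\<Phi> x w" "d\<Phi> x u"]
      dd\<Phi>_sym[OF x, of v u] dd\<Phi>_sym[OF x, of w u] by simp
  ultimately show ?thesis by simp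
qed

lemma nondegenerate:
  assumes x: "x \<in> C" and o: "\<And>w. D2 (\<Phi> x) z (d\<Phi> x w) = 0" shows "z = 0"
proof (rule ccontr)
  assume "z \<noteq> 0"
  then have "D2 (\<Phi> x) z z > 0" using D2_pos \<Phi>_nonzero[OF x] by blast
  moreover obtain u where "d\<Phi> x u = z" using d\<Phi>_surj[OF x] by blast
  ultimately show False using o[of u] by simp
qed

text \<open>The left side is half the rate of change of the source orbit metric in the direction
  \<open>P1 x\<close>, to which only the first block contributes. In the target,
  \<open>second_form\<close>, \<open>dd\<Phi>_radial_tang\<close> and \<open>D3_tang_normal\<close>
  express it by the two block forms. So the first source form, and by \<open>iso_tang\<close> also
  the second, is a combination of the target forms.\<close>

lemma pencil:
  assumes g: "good x"
  obtains p q where "\<And>u v. tang P1 P2 x u \<Longrightarrow> tang P1 P2 x v \<Longrightarrow>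
    a * (P1 u \<bullet> P1 v) = p * (R1 (d\<Phi> x u) \<bullet> R1 (d\<Phi> x v)) + q * (R2 (d\<Phi> x u) \<bullet> R2 (d\<Phi> x v))"
proof -
  note x = goodD[OF g]
  note z = \<Phi>_nonzero[OF x(1)]
  obtain c c' where c: "\<And>u v. tang R1 R2 (\<Phi> x) u \<Longrightarrow> tang R1 R2 (\<Phi> x) v \<Longrightarrow>
    D3 (\<Phi> x) u v (rho x *\<^sub>R R1 (\<Phi> x) + sig x *\<^sub>R R2 (\<Phi> x)) = c * (R1 u \<bullet> R1 v) + c' * (R2 u \<bullet> R2 v)"
    using D3_tang_normal[OF x(3)] by blast
  show ?thesis
  proof (rule that)
    fix u v assume u: "tang P1 P2 x u" and v: "tang P1 P2 x v"
    let ?u = "d\<Phi> x u" and ?v = "d\<Phi> x v"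
    have tu: "tang R1 R2 (\<Phi> x) ?u" and tv: "tang R1 R2 (\<Phi> x) ?v" using d\<Phi>_tang[OF g] u v by auto
    have "D3 (\<Phi> x) (d\<Phi> x (P1 x)) ?u ?v = D3 (\<Phi> x) ?u ?v (d\<Phi> x (P1 x))"
      using D3_sym12[OF z] D3_sym[OF z] by metis
    then have "D2 (\<Phi> x) (dd\<Phi> x (P1 x) u) ?v = - (c * (R1 ?u \<bullet> R1 ?v) + c' * (R2 ?u \<bullet> R2 ?v)) / 2"
      using second_form[OF x(1), of "P1 x" u v] c[OF tu tv] d\<Phi>_radial[OF g] by simp
    moreover have "dd\<Phi> x (P1 x) u = rho x *\<^sub>R R1 ?u + sig x *\<^sub>R R2 ?u - d\<Phi> x (P1 u)"
      using dd\<Phi>_radial_tang[OF g u] by (metis add_diff_cancel_right')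
    then have "D2 (\<Phi> x) (dd\<Phi> x (P1 x) u) ?v = rho x * D2 (\<Phi> x) (R1 ?u) ?v + sig x * D2 (\<Phi> x) (R2 ?u) ?v
        - D2 (\<Phi> x) (d\<Phi> x (P1 u)) ?v"
      by (simp add: linear_add[OF D2_linear1[OF z]] linear_diff[OF D2_linear1[OF z]] linear_scale[OF D2_linear1[OF z]])
    moreover have "D2 (\<Phi> x) (R1 ?u) ?v = coef (\<Phi> x) * (R1 ?u \<bullet> R1 ?v)"
      using D2_tang_formula[OF x(3) tang_P(1)[OF tu] tv] by simp
    moreover have "D2 (\<Phi> x) (R2 ?u) ?v = coef' (\<Phi> x) * (R2 ?u \<bullet> R2 ?v)"
      using D2_tang_formula[OF x(3) tang_P(2)[OF tu] tv] by simp
    moreover have "D2 (\<Phi> x) (d\<Phi> x (P1 u)) ?v = a * (P1 u \<bullet> P1 v)"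
      using iso[OF x(1), of "P1 u" v] by simp
    ultimately show "a * (P1 u \<bullet> P1 v) = (rho x * coef (\<Phi> x) + c / 2) * (R1 ?u \<bullet> R1 ?v)
        + (sig x * coef' (\<Phi> x) + c' / 2) * (R2 ?u \<bullet> R2 ?v)"
      by (simp add: algebra_simps)
  qed
qed

text \<open>At a regular point the differential either respects (straight) or exchanges (crossed) the
  two sphere factors of the orbit, with these homothety factors.\<close>

definition straight :: "'v \<Rightarrow> bool" where
  "straight x \<longleftrightarrow> (\<forall>u. tang P1 P2 x u \<longrightarrow>
     coef (\<Phi> x) * (R1 (d\<Phi> x u) \<bullet> R1 (d\<Phi> x u)) = a * (P1 u \<bullet> P1 u) \<and>
     coef' (\<Phi> x) * (R2 (d\<Phi> x u) \<bullet> R2 (d\<Phi> x u)) = b * (P2 u \<bullet> P2 u))"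

definition crossed :: "'v \<Rightarrow> bool" where
  "crossed x \<longleftrightarrow> (\<forall>u. tang P1 P2 x u \<longrightarrow>
     coef (\<Phi> x) * (R1 (d\<Phi> x u) \<bullet> R1 (d\<Phi> x u)) = b * (P2 u \<bullet> P2 u) \<and>
     coef' (\<Phi> x) * (R2 (d\<Phi> x u) \<bullet> R2 (d\<Phi> x u)) = a * (P1 u \<bullet> P1 u))"

lemma iso_tang:
  assumes g: "good x" and u: "tang P1 P2 x u" and v: "tang P1 P2 x v"
  shows "coef (\<Phi> x) * (R1 (d\<Phi> x u) \<bullet> R1 (d\<Phi> x v)) + coef' (\<Phi> x) * (R2 (d\<Phi> x u) \<bullet> R2 (d\<Phi> x v))
    = a * (P1 u \<bullet> P1 v) + b * (P2 u \<bullet> P2 v)"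
  using D2_tang_formula[OF goodD(3)[OF g] d\<Phi>_tang[OF g u] d\<Phi>_tang[OF g v]] iso[OF goodD(1)[OF g]] by simp

lemma R1_tang_thin:
  assumes g: "good x" and w: "\<not> wide P1" and u: "tang P1 P2 x u"
  shows "P1 u = 0" "R1 (d\<Phi> x u) = 0"
  using src.tang_thin1[OF goodD(2)[OF g] w u] tang_thin1[OF goodD(3)[OF g] _ d\<Phi>_tang[OF g u]] w wide1_iff by auto

lemma R2_tang_thin:
  assumes g: "good x" and w: "\<not> wide P2" and u: "tang P1 P2 x u"
  shows "P2 u = 0" "R2 (d\<Phi> x u) = 0"
proof -
  interpret sw: hessian_iso P2 P1 R2 R1 E D1 D2 D3 \<Phi> d\<Phi> dd\<Phi> C b a by (rule iso_swap)
  have "sw.good x" "tang P2 P1 x u" using g u by (auto simp: sw.good_def good_def reg_swap tang_swap)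
  then show "P2 u = 0" "R2 (d\<Phi> x u) = 0" using sw.R1_tang_thin w by auto
qed

text \<open>The blocks are orthogonal, so a combination with both coefficients nonzero has no
  kernel. The test vectors are preimages of the two components of
  \<open>d\<Phi> x u\<close>.\<close>

lemma form_isotropic:
  assumes g: "good x" and u: "tang P1 P2 x u" "u \<noteq> 0"
    and 0: "\<And>v. tang P1 P2 x v \<Longrightarrow> p * (R1 (d\<Phi> x u) \<bullet> R1 (d\<Phi> x v)) + q * (R2 (d\<Phi> x u) \<bullet> R2 (d\<Phi> x v)) = 0"
  shows "p = 0 \<or> q = 0"
proof -
  note x = goodD[OF g]
  have tu: "tang R1 R2 (\<Phi> x) (d\<Phi> x u)" using d\<Phi>_tang[OF g u(1)] .
  obtain v where "tang P1 P2 x v" "d\<Phi> x v = R1 (d\<Phi> x u)" using d\<Phi>_tang_surj[OF g tang_P(1)[OF tu]] by blast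
  then have 1: "p * (R1 (d\<Phi> x u) \<bullet> R1 (d\<Phi> x u)) = 0" using 0[of v] by simp
  obtain v where "tang P1 P2 x v" "d\<Phi> x v = R2 (d\<Phi> x u)" using d\<Phi>_tang_surj[OF g tang_P(2)[OF tu]] by blast
  then have 2: "q * (R2 (d\<Phi> x u) \<bullet> R2 (d\<Phi> x u)) = 0" using 0[of v] by simp
  have "d\<Phi> x u \<noteq> 0" using u(2) d\<Phi>_inj[OF x(1)] linear_0[OF d\<Phi>_linear[OF x(1)]] by (metis injD)
  then have "R1 (d\<Phi> x u) \<noteq> 0 \<or> R2 (d\<Phi> x u) \<noteq> 0" using split_sum[of "d\<Phi> x u"] by auto
  then show ?thesis using 1 2 by auto
qed

lemma wide_tang:
  assumes "wide P1"
  obtains u where "u \<noteq> 0" "P1 u = u" "P2 u = 0" "tang P1 P2 x u"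
proof -
  obtain w where w: "P1 w = w" "w \<noteq> 0" "w \<bullet> P1 x = 0" using src.wide1[OF assms] by blast
  then have "P2 w = 0" by (metis src.P2P1)
  then show ?thesis using that w src.inner_P2_right[of w x] by (simp add: tang_def)
qed

text \<open>Each source block form vanishes on the tangent vectors of the other block, so by
  \<open>form_isotropic\<close> its expression through the target forms has a zero coefficient. If a
  block is thin, only one term is left on each side of \<open>iso_tang\<close>.\<close>

lemma straight_or_crossed:
  assumes g: "good x"
  shows "straight x \<or> wide P1 \<and> wide P2 \<and> crossed x"
proof (cases "wide P1 \<and> wide P2")
  case False
  then have "straight x"
    unfolding straight_def using iso_tang[OF g] R1_tang_thin[OF g] R2_tang_thin[OF g] by fastforce
  then show ?thesis by blast
next
  case True
  interpret sw: hessian_iso P2 P1 R2 R1 E D1 D2 D3 \<Phi> d\<Phi> dd\<Phi> C b a by (rule iso_swap)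
  note x = goodD[OF g]
  obtain p q where pq: "\<And>u v. tang P1 P2 x u \<Longrightarrow> tang P1 P2 x v \<Longrightarrow>
    a * (P1 u \<bullet> P1 v) = p * (R1 (d\<Phi> x u) \<bullet> R1 (d\<Phi> x v)) + q * (R2 (d\<Phi> x u) \<bullet> R2 (d\<Phi> x v))"
    using pencil[OF g] by blast
  have pq': "b * (P2 u \<bullet> P2 v) = (coef (\<Phi> x) - p) * (R1 (d\<Phi> x u) \<bullet> R1 (d\<Phi> x v))
      + (coef' (\<Phi> x) - q) * (R2 (d\<Phi> x u) \<bullet> R2 (d\<Phi> x v))"
    if "tang P1 P2 x u" "tang P1 P2 x v" for u v
    using pq[OF that] iso_tang[OF g that] by (simp add: algebra_simps)
  obtain u where u: "u \<noteq> 0" "P1 u = u" "P2 u = 0" "tang P1 P2 x u" using True wide_tang by blast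
  obtain v where v: "v \<noteq> 0" "P2 v = v" "P1 v = 0" "tang P1 P2 x v" using True sw.wide_tang tang_swap by metis
  have "p = 0 \<or> q = 0" by (rule form_isotropic[OF g v(4,1)]) (use pq[OF v(4)] v(3) in simp)
  moreover have "coef (\<Phi> x) - p = 0 \<or> coef' (\<Phi> x) - q = 0"
    by (rule form_isotropic[OF g u(4,1)]) (use pq'[OF u(4)] u(3) in simp)
  moreover have "coef (\<Phi> x) > 0" "coef' (\<Phi> x) > 0"
    using coef_pos coef'_pos x(3) True wide1_iff wide2_iff by auto
  \<comment> \<open>As \<open>coef (\<Phi> x)\<close> and \<open>coef' (\<Phi> x)\<close> are
    positive, the two coefficient pairs vanish in opposite places.\<close>
  ultimately have "p = 0 \<and> q = coef' (\<Phi> x) \<or> q = 0 \<and> p = coef (\<Phi> x)" by auto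
  then show ?thesis
  proof
    assume "p = 0 \<and> q = coef' (\<Phi> x)"
    then have "crossed x" unfolding crossed_def using pq pq' by simp
    then show ?thesis using True by blast
  next
    assume "q = 0 \<and> p = coef (\<Phi> x)"
    then have "straight x" unfolding straight_def using pq pq' by simp
    then show ?thesis by blast
  qed
qed

end

section \<open>Great circles and the radial derivatives of the target energy\<close>

lemma vector_derivative_zero_imp_eq:
  fixes f :: "real \<Rightarrow> 'v::real_normed_vector"
  assumes "\<And>t. (f has_vector_derivative 0) (at t)"
  shows "f s = f t"
proof -
  have d: "(f has_derivative (\<lambda>_. 0)) (at t within UNIV)" for t
    using assms[of t] by (simp add: has_vector_derivative_def)
  obtain c where "\<And>t. t \<in> UNIV \<Longrightarrow> f t = c" using has_derivative_zero_constant[OF convex_UNIV d] by blast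
  then show ?thesis by simp
qed

text \<open>\<open>p\<close> and \<open>q\<close> undo the rotation of the pair (f, f1 / c) by the
  angle c t, so they are constants of the motion.\<close>

lemma oscillator_solution:
  fixes f f1 :: "real \<Rightarrow> 'v::real_normed_vector"
  assumes c: "c > 0" and f: "\<And>t. (f has_vector_derivative f1 t) (at t)"
    and f1: "\<And>t. (f1 has_vector_derivative (- c\<^sup>2) *\<^sub>R f t) (at t)"
  shows "f t = cos (c * t) *\<^sub>R f 0 + (sin (c * t) / c) *\<^sub>R f1 0"
proof -
  define p where "p t = cos (c * t) *\<^sub>R f t - (sin (c * t) / c) *\<^sub>R f1 t" for t
  define q where "q t = sin (c * t) *\<^sub>R f t + (cos (c * t) / c) *\<^sub>R f1 t" for t
  have "(p has_vector_derivative
      (cos (c * t) *\<^sub>R f1 t + (- sin (c * t) * c) *\<^sub>R f t) - ((sin (c * t) / c) *\<^sub>R ((- c\<^sup>2) *\<^sub>R f t) + (cos (c * t) * c / c) *\<^sub>R f1 t)) (at t)" for t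
    unfolding p_def using c
    by (intro has_vector_derivative_diff has_vector_derivative_scaleR f f1) (auto intro!: derivative_eq_intros)
  then have "(p has_vector_derivative 0) (at t)" for t using c by (simp add: power2_eq_square)
  then have p: "p t = p 0"
    by (rule vector_derivative_zero_imp_eq)
  have "(q has_vector_derivative
      (sin (c * t) *\<^sub>R f1 t + (cos (c * t) * c) *\<^sub>R f t) + ((cos (c * t) / c) *\<^sub>R ((- c\<^sup>2) *\<^sub>R f t) + (- sin (c * t) * c / c) *\<^sub>R f1 t)) (at t)" for t
    unfolding q_def using c
    by (intro has_vector_derivative_add has_vector_derivative_scaleR f f1) (auto intro!: derivative_eq_intros)
  then have "(q has_vector_derivative 0) (at t)" for t using c by (simp add: power2_eq_square)
  then have q: "q t = q 0"
    by (rule vector_derivative_zero_imp_eq)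
  have "cos (c * t) *\<^sub>R p t + sin (c * t) *\<^sub>R q t = ((cos (c * t))\<^sup>2 + (sin (c * t))\<^sup>2) *\<^sub>R f t"
    unfolding p_def q_def scaleR_left_distrib by (simp add: algebra_simps power2_eq_square del: sin_cos_squared_add3)
  then have "f t = cos (c * t) *\<^sub>R p 0 + sin (c * t) *\<^sub>R q 0" using p q by simp
  then show ?thesis by (simp add: p_def q_def)
qed

context hessian_iso
begin

lemma coef_orb:
  assumes g: "good x" and o: "orb P1 P2 x y"
  shows "coef (\<Phi> y) = coef (\<Phi> x)"
  using D1_radial_invariant[OF \<Phi>_nonzero \<Phi>_orb] R1\<Phi>_sq_inv goodD(1)[OF g] o by (simp add: coef_def)

text \<open>The image of a great circle solves a harmonic oscillator equation; it closes up after
  time 2 pi, and injectivity forbids that it closes up earlier, so the frequency is 1.\<close>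

lemma straight_radial1:
  assumes g: "good x" and st: "straight x" and W: "wide P1"
  shows "D1 (\<Phi> x) (R1 (\<Phi> x)) = a * (P1 x \<bullet> P1 x)"
proof -
  note x = goodD[OF g]
  obtain w0 where w0: "w0 \<noteq> 0" "P1 w0 = w0" "P2 w0 = 0" "tang P1 P2 x w0" using wide_tang[OF W] by blast
  \<comment> \<open>Scaled to the length of \<open>P1 x\<close>, so that \<open>\<gamma>\<close>
    runs on a circle inside the orbit of x.\<close>
  define w where "w = (norm (P1 x) / norm w0) *\<^sub>R w0"
  have w: "P1 w = w" "P2 w = 0" "w \<bullet> P1 x = 0" "norm w = norm (P1 x)"
    using w0 by (simp_all add: w_def tang_def)
  define r2 where "r2 = P1 x \<bullet> P1 x"
  have r2: "r2 > 0" using x(2) by (simp add: r2_def reg_def)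
  have ww: "w \<bullet> w = r2" using w(4) by (simp add: r2_def dot_square_norm)
  define \<gamma> where "\<gamma> t = cos t *\<^sub>R P1 x + sin t *\<^sub>R w + P2 x" for t
  define \<delta> where "\<delta> t = - sin t *\<^sub>R P1 x + cos t *\<^sub>R w" for t
  have P1\<gamma>: "P1 (\<gamma> t) = cos t *\<^sub>R P1 x + sin t *\<^sub>R w" for t
    by (simp add: \<gamma>_def w)
  have P1\<delta>: "P1 (\<delta> t) = \<delta> t" and P2\<delta>: "P2 (\<delta> t) = 0" for t by (simp_all add: \<delta>_def w)
  have \<gamma>0: "\<gamma> 0 = x" by (simp add: \<gamma>_def src.split_sum)
  have orb\<gamma>: "orb P1 P2 x (\<gamma> t)" for t
    unfolding \<gamma>_def using W w by (intro src.orb_circle) auto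
  have good\<gamma>: "good (\<gamma> t)" for t using good_orb[OF g orb\<gamma>] .
  have C\<gamma>: "\<gamma> t \<in> C" for t using goodD(1)[OF good\<gamma>] .
  have tang\<delta>: "tang P1 P2 (\<gamma> t) (\<delta> t)" for t
  proof -
    have "\<delta> t \<bullet> P1 (\<gamma> t) = 0"
      unfolding P1\<gamma> \<delta>_def using w(3) ww
      by (simp add: inner_add_left inner_add_right inner_diff_left inner_commute[of "P1 x" w] r2_def)
    moreover have "\<delta> t \<bullet> P2 (\<gamma> t) = 0" using src.inner_P2_right[of "\<delta> t"] P2\<delta> by simp
    ultimately show ?thesis by (simp add: tang_def)
  qed
  have \<delta>\<delta>: "\<delta> t \<bullet> \<delta> t = r2" for t
  proof -
    have "\<delta> t \<bullet> \<delta> t = (sin t)\<^sup>2 * r2 + (cos t)\<^sup>2 * r2"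
      unfolding \<delta>_def using w(3) ww
      by (simp add: inner_add_left inner_add_right inner_diff_left inner_diff_right inner_commute[of "P1 x" w] power2_eq_square flip: r2_def)
    then show ?thesis by (simp flip: distrib_right)
  qed
  have \<gamma>': "(\<gamma> has_vector_derivative \<delta> t) (at t)" for t
    unfolding \<gamma>_def \<delta>_def by (auto intro!: derivative_eq_intros)
  have \<delta>': "(\<delta> has_vector_derivative - P1 (\<gamma> t)) (at t)" for t
    unfolding P1\<gamma> \<delta>_def by (auto intro!: derivative_eq_intros)
  define f where "f t = R1 (\<Phi> (\<gamma> t))" for t
  define f1 where "f1 t = R1 (d\<Phi> (\<gamma> t) (\<delta> t))" for t
  define h0 where "h0 = R1 (\<Phi> x) \<bullet> R1 (\<Phi> x)"
  define k where "k = coef (\<Phi> x)"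
  have h0: "h0 > 0" using x(3) by (simp add: h0_def reg_def)
  have k: "k > 0" unfolding k_def using coef_pos W wide1_iff x(3) by blast
  have ff: "f t \<bullet> f t = h0" for t unfolding f_def h0_def using R1\<Phi>_sq_inv[OF x(1) orb\<gamma>] .
  have ff1: "f t \<bullet> f1 t = 0" for t
    unfolding f_def f1_def using tang_inner[OF d\<Phi>_tang[OF good\<gamma> tang\<delta>]] by simp
  have f': "(f has_vector_derivative f1 t) (at t)" for t
    unfolding f_def f1_def
    by (rule has_vector_derivative_along_curve[where c = \<gamma>, OF has_derivative_P1[OF d\<Phi>[OF C\<gamma>]] \<gamma>'])
  define m where "m t = R1 (dd\<Phi> (\<gamma> t) (\<delta> t) (\<delta> t) - d\<Phi> (\<gamma> t) (P1 (\<gamma> t)))" for t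
  have f1': "(f1 has_vector_derivative m t) (at t)" for t
  proof -
    have "((\<lambda>t. d\<Phi> (\<gamma> t) u) has_derivative (\<lambda>s. s *\<^sub>R dd\<Phi> (\<gamma> t) u (\<delta> t))) (at t)" for u
      using has_vector_derivative_along_curve[where c = \<gamma>, OF dd\<Phi>[OF C\<gamma>[of t], of u] \<gamma>'[of t]]
      by (simp add: has_vector_derivative_def)
    then have "((\<lambda>t. d\<Phi> (\<gamma> t) (\<delta> t)) has_derivative
        (\<lambda>s. s *\<^sub>R dd\<Phi> (\<gamma> t) (\<delta> t) (\<delta> t) + d\<Phi> (\<gamma> t) (s *\<^sub>R (- P1 (\<gamma> t))))) (at t)"
      using \<delta>'[of t] d\<Phi>_linear[OF C\<gamma>]
      by (intro has_derivative_linear_family[of UNIV t "\<lambda>t. d\<Phi> (\<gamma> t)"]) (auto simp: has_vector_derivative_def)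
    from has_derivative_P1[OF this] show ?thesis
      unfolding has_vector_derivative_def f1_def m_def
      by (simp add: linear_scale[OF d\<Phi>_linear[OF C\<gamma>]] linear_neg[OF d\<Phi>_linear[OF C\<gamma>]] scaleR_diff_right)
  qed
  \<comment> \<open>By \<open>D3_tang\<close> and \<open>second_form\<close>,
    \<open>dd\<Phi>\<close> on the velocity is Hessian-normal to the target orbit, hence radial; the
    other term of \<open>m\<close> is radial by \<open>d\<Phi>_radial\<close>.\<close>
  have m_parallel: "\<exists>l. m t = l *\<^sub>R f t" for t
  proof -
    have z: "reg R1 R2 (\<Phi> (\<gamma> t))" using goodD(3)[OF good\<gamma>] .
    have "D2 (\<Phi> (\<gamma> t)) (dd\<Phi> (\<gamma> t) (\<delta> t) (\<delta> t)) v = 0" if v: "tang R1 R2 (\<Phi> (\<gamma> t)) v" for v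
    proof -
      obtain u where u: "tang P1 P2 (\<gamma> t) u" "d\<Phi> (\<gamma> t) u = v" using d\<Phi>_tang_surj[OF good\<gamma> v] by blast
      have "D3 (\<Phi> (\<gamma> t)) (d\<Phi> (\<gamma> t) (\<delta> t)) (d\<Phi> (\<gamma> t) (\<delta> t)) v = 0"
        by (intro D3_tang z d\<Phi>_tang good\<gamma> tang\<delta> v)
      then show ?thesis using second_form[OF C\<gamma>[of t], of "\<delta> t" "\<delta> t" u] u(2) by simp
    qed
    from normal_if_orthogonal[OF z this] obtain p q where
      "dd\<Phi> (\<gamma> t) (\<delta> t) (\<delta> t) = p *\<^sub>R R1 (\<Phi> (\<gamma> t)) + q *\<^sub>R R2 (\<Phi> (\<gamma> t))" by blast
    then have "m t = (p - rho (\<gamma> t)) *\<^sub>R f t"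
      unfolding m_def f_def using d\<Phi>_radial[OF good\<gamma>, of t] by (simp add: scaleR_diff_left)
    then show ?thesis by blast
  qed
  have coef\<gamma>: "coef (\<Phi> (\<gamma> t)) = k" for t unfolding k_def using coef_orb[OF g orb\<gamma>] .
  have straight_f1: "f1 t \<bullet> f1 t = a * r2 / k" if "straight (\<gamma> t)" for t
    using that tang\<delta>[of t] k unfolding straight_def f1_def by (simp add: coef\<gamma> P1\<delta> \<delta>\<delta> field_simps)
  have crossed_f1: "f1 t \<bullet> f1 t = 0" if "crossed (\<gamma> t)" for t
  proof -
    have "k * (f1 t \<bullet> f1 t) = b * (P2 (\<delta> t) \<bullet> P2 (\<delta> t))"
      using that tang\<delta>[of t] unfolding crossed_def f1_def by (simp add: coef\<gamma>)
    then show ?thesis using k by (simp add: P2\<delta>)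
  qed
  \<comment> \<open>The squared speed takes one value at straight and another at crossed points. A
    continuous function with finite range on the line is constant, so the circle never changes
    kind.\<close>
  have "(\<lambda>t. f1 t \<bullet> f1 t) constant_on UNIV"
  proof (rule continuous_finite_range_constant)
    show "continuous_on UNIV (\<lambda>t. f1 t \<bullet> f1 t)"
      using f1' by (intro continuous_on_inner continuous_at_imp_continuous_on)
        (auto intro: has_vector_derivative_continuous)
    have "range (\<lambda>t. f1 t \<bullet> f1 t) \<subseteq> {0, a * r2 / k}"
      using straight_or_crossed[OF good\<gamma>] straight_f1 crossed_f1 by blast
    then show "finite (range (\<lambda>t. f1 t \<bullet> f1 t))" using finite_subset by blast
  qed auto
  then have f1f1: "f1 t \<bullet> f1 t = a * r2 / k" for t
    using straight_f1[of 0] st \<gamma>0 unfolding constant_on_def by (metis UNIV_I)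
  have st\<gamma>: "straight (\<gamma> t)" for t
    using straight_or_crossed[OF good\<gamma>[of t]] crossed_f1[of t] f1f1[of t] a_pos r2 k by auto
  \<comment> \<open>The second component of the image does not move, so a return of \<open>f\<close>
    is a return of the whole image curve.\<close>
  have "R2 (d\<Phi> (\<gamma> t) (\<delta> t)) = 0" for t
  proof (cases "wide P2")
    case True
    then have "coef' (\<Phi> (\<gamma> t)) > 0" using coef'_pos wide2_iff goodD(3)[OF good\<gamma>] by blast
    moreover have "coef' (\<Phi> (\<gamma> t)) * (R2 (d\<Phi> (\<gamma> t) (\<delta> t)) \<bullet> R2 (d\<Phi> (\<gamma> t) (\<delta> t))) = 0"
      using st\<gamma>[of t] tang\<delta>[of t] unfolding straight_def by (simp add: P2\<delta>)
    ultimately show ?thesis by simp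
  next
    case False
    then show ?thesis using R2_tang_thin[OF good\<gamma> _ tang\<delta>] by blast
  qed
  then have "((\<lambda>t. R2 (\<Phi> (\<gamma> t))) has_vector_derivative 0) (at t)" for t
    using has_vector_derivative_along_curve[where c = \<gamma>, OF has_derivative_P2[OF d\<Phi>[OF C\<gamma>, of t]] \<gamma>'] by simp
  then have R2c: "R2 (\<Phi> (\<gamma> t)) = R2 (\<Phi> x)" for t
    using vector_derivative_zero_imp_eq[of "\<lambda>t. R2 (\<Phi> (\<gamma> t))" t 0] \<gamma>0 by simp
  \<comment> \<open>The constant speed of \<open>f\<close> divided by its constant radius.\<close>
  define c where "c = sqrt (a * r2 / (k * h0))"
  have c2: "c\<^sup>2 = a * r2 / (k * h0)" and c: "c > 0" using a_pos r2 k h0 by (simp_all add: c_def)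
  \<comment> \<open>Differentiating \<open>f t \<bullet> f1 t = 0\<close> determines the multiple
    provided by \<open>m_parallel\<close>.\<close>
  have osc: "(f1 has_vector_derivative (- c\<^sup>2) *\<^sub>R f t) (at t)" for t
  proof -
    obtain l where l: "m t = l *\<^sub>R f t" using m_parallel by blast
    have "((\<lambda>t. f t \<bullet> f1 t) has_vector_derivative (f t \<bullet> m t + f1 t \<bullet> f1 t)) (at t)"
      using has_derivative_inner[OF f'[of t, unfolded has_vector_derivative_def] f1'[of t, unfolded has_vector_derivative_def]]
      by (simp add: has_vector_derivative_def algebra_simps)
    moreover have "((\<lambda>t. f t \<bullet> f1 t) has_vector_derivative 0) (at t)" using ff1 by simp
    ultimately have "f t \<bullet> m t + f1 t \<bullet> f1 t = 0" using vector_derivative_unique_at by blast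
    then have "l * h0 + a * r2 / k = 0" using l ff f1f1 by simp
    then have "l = - c\<^sup>2" using h0 k unfolding c2 by (simp add: field_simps)
    then show ?thesis using f1'[of t] l by simp
  qed
  have sol: "f t = cos (c * t) *\<^sub>R f 0 + (sin (c * t) / c) *\<^sub>R f1 0" for t
    using oscillator_solution[OF c f' osc] .
  have sol0: "f t \<bullet> f 0 = cos (c * t) * h0" for t
    unfolding sol[of t] using ff[of 0] ff1[of 0] by (simp add: inner_add_left inner_commute[of "f1 0"])
  \<comment> \<open>The image closes up with \<open>\<gamma>\<close> after time 2 pi, which makes c
    a positive integer.\<close>
  have "\<not> c < 1"
  proof
    assume "c < 1"
    have "\<gamma> (2 * pi) = \<gamma> 0" by (simp add: \<gamma>_def)
    then have "f (2 * pi) = f 0" by (simp add: f_def)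
    then have "cos (c * (2 * pi)) = 1" using sol0[of "2 * pi"] ff[of 0] h0 by simp
    then obtain n :: int where "c * (2 * pi) = of_int n * 2 * pi" using cos_one_2pi_int by blast
    then have "c = of_int n" by simp
    then show False using c \<open>c < 1\<close> by simp
  qed
  \<comment> \<open>\<open>f\<close> returns at time 2 pi / c. Injectivity forces
    \<open>\<gamma>\<close> to return as well, which is too early if c > 1.\<close>
  moreover have "\<not> 1 < c"
  proof
    assume "1 < c"
    let ?t = "2 * pi / c"
    have "f ?t = f 0" using sol[of ?t] c by simp
    then have "\<Phi> (\<gamma> ?t) = \<Phi> (\<gamma> 0)"
      using R2c[of ?t] R2c[of 0] split_sum[of "\<Phi> (\<gamma> ?t)"] split_sum[of "\<Phi> (\<gamma> 0)"] unfolding f_def by metis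
    then have "\<gamma> ?t = \<gamma> 0" using inj C\<gamma> by (metis inj_onD)
    then have "cos ?t *\<^sub>R P1 x + sin ?t *\<^sub>R w = P1 x" using P1\<gamma>[of ?t] P1\<gamma>[of 0] by simp
    then have "(cos ?t *\<^sub>R P1 x + sin ?t *\<^sub>R w) \<bullet> P1 x = r2" by (simp add: r2_def)
    then have "cos ?t * r2 = r2" using w(3) by (simp add: inner_add_left r2_def)
    then have "cos ?t = 1" using r2 by simp
    then obtain n :: int where "?t = of_int n * 2 * pi" using cos_one_2pi_int by blast
    then have n: "1 = c * of_int n" using c by (simp add: field_simps)
    then have "real_of_int n > 0" using c by (metis zero_less_mult_pos zero_less_one)
    then have "real_of_int n \<ge> 1" by simp
    then have "c * of_int n \<ge> c * 1" using c by (intro mult_left_mono) auto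
    then show False using n \<open>1 < c\<close> by simp
  qed
  ultimately have "c = 1" by simp
  then have "a * r2 = k * h0" using c2 h0 k by simp
  then show ?thesis using h0 by (simp add: r2_def k_def h0_def coef_def)
qed

text \<open>The circle argument reaches wide blocks only. Since
  \<open>d\<Phi> x x = \<Phi> x\<close>, Euler's identity gives the sum of the two radial
  derivatives, and a thin block is settled by the other one.\<close>

lemma straight_radial:
  assumes g: "good x" and st: "straight x" and W: "wide P1 \<or> wide P2"
  shows "D1 (\<Phi> x) (R1 (\<Phi> x)) = a * (P1 x \<bullet> P1 x)" "D1 (\<Phi> x) (R2 (\<Phi> x)) = b * (P2 x \<bullet> P2 x)"
proof -
  interpret sw: hessian_iso P2 P1 R2 R1 E D1 D2 D3 \<Phi> d\<Phi> dd\<Phi> C b a by (rule iso_swap)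
  note x = goodD[OF g]
  note z = \<Phi>_nonzero[OF x(1)]
  have "D1 (\<Phi> x) (\<Phi> x) = a * (P1 x \<bullet> P1 x) + b * (P2 x \<bullet> P2 x)"
    using iso[OF x(1), of x x] euler2[OF z, of "\<Phi> x"] d\<Phi>_self[OF x(1)] by simp
  moreover have "D1 (\<Phi> x) (\<Phi> x) = D1 (\<Phi> x) (R1 (\<Phi> x)) + D1 (\<Phi> x) (R2 (\<Phi> x))"
    using linear_add[OF D1_linear[OF z], of "R1 (\<Phi> x)" "R2 (\<Phi> x)"] by (simp add: split_sum)
  moreover have "D1 (\<Phi> x) (R1 (\<Phi> x)) = a * (P1 x \<bullet> P1 x)" if "wide P1"
    using straight_radial1[OF g st that] .
  moreover have "D1 (\<Phi> x) (R2 (\<Phi> x)) = b * (P2 x \<bullet> P2 x)" if "wide P2"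
  proof (rule sw.straight_radial1[OF _ _ that])
    show "sw.good x" using g by (simp add: sw.good_def good_def reg_swap)
    show "sw.straight x"
      using st unfolding sw.straight_def straight_def
      by (auto simp: tang_swap sw.coef_def sw.coef'_def coef_def coef'_def)
  qed
  ultimately show "D1 (\<Phi> x) (R1 (\<Phi> x)) = a * (P1 x \<bullet> P1 x)" "D1 (\<Phi> x) (R2 (\<Phi> x)) = b * (P2 x \<bullet> P2 x)"
    using W by auto
qed

end

section \<open>Vanishing of the second derivative of the isometry\<close>

context hessian_iso
begin

lemma straight_blocks:
  assumes g: "good x" and st: "straight x" and u: "tang P1 P2 x u"
  shows "R2 (d\<Phi> x (P1 u)) = 0" "R1 (d\<Phi> x (P2 u)) = 0"
proof -
  note t = src.tang_P(1)[OF u] src.tang_P(2)[OF u]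
  show "R2 (d\<Phi> x (P1 u)) = 0"
  proof (cases "wide P2")
    case True
    then have "coef' (\<Phi> x) > 0" using coef'_pos wide2_iff goodD(3)[OF g] by blast
    moreover have "coef' (\<Phi> x) * (R2 (d\<Phi> x (P1 u)) \<bullet> R2 (d\<Phi> x (P1 u))) = b * (P2 (P1 u) \<bullet> P2 (P1 u))"
      using st t(1) unfolding straight_def by blast
    ultimately show ?thesis by simp
  qed (use R2_tang_thin[OF g _ t(1)] in blast)
  show "R1 (d\<Phi> x (P2 u)) = 0"
  proof (cases "wide P1")
    case True
    then have "coef (\<Phi> x) > 0" using coef_pos wide1_iff goodD(3)[OF g] by blast
    moreover have "coef (\<Phi> x) * (R1 (d\<Phi> x (P2 u)) \<bullet> R1 (d\<Phi> x (P2 u))) = a * (P1 (P2 u) \<bullet> P1 (P2 u))"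
      using st t(2) unfolding straight_def by blast
    ultimately show ?thesis by simp
  qed (use R1_tang_thin[OF g _ t(2)] in blast)
qed

text \<open>Write A and B for \<open>?A\<close> and \<open>?B\<close>. Differentiating
  \<open>straight_radial\<close> along \<open>P1 x\<close>, possible because U is open, gives the
  pairings (2 - rho) A and - sig B of the image vector with the two radial vectors. Its squared
  length is A, so A (1 - rho)^2 + B sig^2 = 0.\<close>

lemma straight_d\<Phi>_radial:
  assumes U: "open U" "\<And>y. y \<in> U \<Longrightarrow> good y \<and> straight y" and W: "wide P1 \<or> wide P2" and x: "x \<in> U"
  shows "d\<Phi> x (P1 x) = R1 (\<Phi> x)"
proof -
  have g: "good x" using U x by blast
  note xg = goodD[OF g]
  note z = \<Phi>_nonzero[OF xg(1)]
  let ?A = "a * (P1 x \<bullet> P1 x)" and ?B = "b * (P2 x \<bullet> P2 x)"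
  have A: "D1 (\<Phi> x) (R1 (\<Phi> x)) = ?A" and B: "D1 (\<Phi> x) (R2 (\<Phi> x)) = ?B"
    using straight_radial[OF g _ W] U x by auto
  let ?z = "d\<Phi> x (P1 x)"
  have zeta: "?z = rho x *\<^sub>R R1 (\<Phi> x) + sig x *\<^sub>R R2 (\<Phi> x)" by (rule d\<Phi>_radial[OF g])
  have "((\<lambda>y. D1 (\<Phi> y) (R1 (\<Phi> y))) has_derivative (\<lambda>v. D2 (\<Phi> x) (R1 (\<Phi> x)) (d\<Phi> x v) + D1 (\<Phi> x) (R1 (d\<Phi> x v)))) (at x)"
    using has_derivative_compose[OF d\<Phi>[OF xg(1)] D1_radial_derivative[OF z]] .
  moreover have "((\<lambda>y. D1 (\<Phi> y) (R1 (\<Phi> y))) has_derivative (\<lambda>v. a * (P1 x \<bullet> P1 v + P1 v \<bullet> P1 x))) (at x)"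
    by (rule has_derivative_transform_within_open[OF _ U(1) x, where f = "\<lambda>y. a * (P1 y \<bullet> P1 y)"])
       (auto intro!: has_derivative_mult_right has_derivative_inner linear_imp_has_derivative src.lin1
         simp: straight_radial[OF _ _ W] U(2))
  ultimately have "D2 (\<Phi> x) (R1 (\<Phi> x)) ?z + D1 (\<Phi> x) (R1 ?z) = a * (P1 x \<bullet> P1 (P1 x) + P1 (P1 x) \<bullet> P1 x)"
    by (rule fun_cong[OF has_derivative_unique])
  moreover have "D1 (\<Phi> x) (R1 ?z) = rho x * ?A"
    unfolding zeta using A by (simp add: linear_scale[OF D1_linear[OF z]])
  ultimately have g1: "D2 (\<Phi> x) (R1 (\<Phi> x)) ?z = 2 * ?A - rho x * ?A" by simp
  have "((\<lambda>y. D1 (\<Phi> y) (R2 (\<Phi> y))) has_derivative (\<lambda>v. D2 (\<Phi> x) (R2 (\<Phi> x)) (d\<Phi> x v) + D1 (\<Phi> x) (R2 (d\<Phi> x v)))) (at x)"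
    using has_derivative_compose[OF d\<Phi>[OF xg(1)] D1_eval_derivative[OF z lin2]] .
  moreover have "((\<lambda>y. D1 (\<Phi> y) (R2 (\<Phi> y))) has_derivative (\<lambda>v. b * (P2 x \<bullet> P2 v + P2 v \<bullet> P2 x))) (at x)"
    by (rule has_derivative_transform_within_open[OF _ U(1) x, where f = "\<lambda>y. b * (P2 y \<bullet> P2 y)"])
       (auto intro!: has_derivative_mult_right has_derivative_inner linear_imp_has_derivative src.lin2
         simp: straight_radial[OF _ _ W] U(2))
  ultimately have "D2 (\<Phi> x) (R2 (\<Phi> x)) ?z + D1 (\<Phi> x) (R2 ?z) = b * (P2 x \<bullet> P2 (P1 x) + P2 (P1 x) \<bullet> P2 x)"
    by (rule fun_cong[OF has_derivative_unique])
  moreover have "D1 (\<Phi> x) (R2 ?z) = sig x * ?B"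
    unfolding zeta using B by (simp add: linear_scale[OF D1_linear[OF z]])
  ultimately have g2: "D2 (\<Phi> x) (R2 (\<Phi> x)) ?z = - sig x * ?B" by simp
  have "D2 (\<Phi> x) (rho x *\<^sub>R R1 (\<Phi> x) + sig x *\<^sub>R R2 (\<Phi> x)) ?z
      = rho x * D2 (\<Phi> x) (R1 (\<Phi> x)) ?z + sig x * D2 (\<Phi> x) (R2 (\<Phi> x)) ?z"
    by (simp add: linear_add[OF D2_linear1[OF z]] linear_scale[OF D2_linear1[OF z]])
  then have "D2 (\<Phi> x) ?z ?z = rho x * (2 * ?A - rho x * ?A) + sig x * (- sig x * ?B)"
    using g1 g2 zeta by simp
  moreover have "D2 (\<Phi> x) ?z ?z = ?A" using iso[OF xg(1), of "P1 x" "P1 x"] by simp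
  ultimately have sq: "?A * (1 - rho x)\<^sup>2 + ?B * (sig x)\<^sup>2 = 0"
    by (simp add: power2_eq_square algebra_simps)
  have AB: "?A > 0" "?B > 0" using a_pos b_pos xg(2) by (simp_all add: reg_def)
  then have "?A * (1 - rho x)\<^sup>2 \<ge> 0" "?B * (sig x)\<^sup>2 \<ge> 0" by (meson less_imp_le mult_nonneg_nonneg zero_le_power2)+
  then have "?A * (1 - rho x)\<^sup>2 = 0" "?B * (sig x)\<^sup>2 = 0" using sq by linarith+
  then have "(1 - rho x)\<^sup>2 = 0" "(sig x)\<^sup>2 = 0" using AB by (metis less_irrefl mult_eq_0_iff)+
  then have "rho x = 1" "sig x = 0" by auto
  then show ?thesis using zeta by simp
qed

text \<open>Radial arguments annihilate \<open>dd\<Phi>\<close>, by differentiating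
  \<open>straight_d\<Phi>_radial\<close> and the homogeneity relation \<open>d\<Phi>_self\<close>.
  Pairs of tangent arguments are tested against the adapted frame.\<close>

lemma straight_dd\<Phi>_zero:
  assumes U: "open U" "\<And>y. y \<in> U \<Longrightarrow> good y \<and> straight y" and W: "wide P1 \<or> wide P2" and x: "x \<in> U"
  shows "dd\<Phi> x u v = 0"
proof -
  have g: "good x" and st: "straight x" using U x by auto
  note xg = goodD[OF g]
  note z = \<Phi>_nonzero[OF xg(1)]
  note l = d\<Phi>_linear[OF xg(1)]
  note rad = straight_d\<Phi>_radial[OF U W x]
  have rad2: "d\<Phi> x (P2 x) = R2 (\<Phi> x)"
    using rad d\<Phi>_self[OF xg(1)] linear_add[OF l, of "P1 x" "P2 x"] src.split_sum[of x] split_sum[of "\<Phi> x"]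
    by (metis add_left_imp_eq)
  have "((\<lambda>y. d\<Phi> y (P1 y)) has_derivative (\<lambda>v. R1 (d\<Phi> x v))) (at x)"
    by (rule has_derivative_transform_within_open[OF has_derivative_P1[OF d\<Phi>[OF xg(1)]] U(1) x])
       (use straight_d\<Phi>_radial[OF U W] in simp)
  from fun_cong[OF has_derivative_unique[OF d\<Phi>_radial_derivative[OF xg(1)] this]]
  have dd: "dd\<Phi> x (P1 x) w + d\<Phi> x (P1 w) = R1 (d\<Phi> x w)" for w .
  \<comment> \<open>The differential intertwines the projections: on radial vectors by
    \<open>rad\<close> and \<open>rad2\<close>, on tangent vectors because straightness excludes
    mixed parts.\<close>
  have commute: "d\<Phi> x (P1 w) = R1 (d\<Phi> x w)" for w
  proof -
    obtain t c d where t: "tang P1 P2 x t" "w = c *\<^sub>R P1 x + d *\<^sub>R P2 x + t"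
      using src.tang_decomp[OF xg(2), of w] by metis
    have "d\<Phi> x t = d\<Phi> x (P1 t) + d\<Phi> x (P2 t)" using linear_add[OF l, of "P1 t" "P2 t"] by (simp add: src.split_sum)
    then have "R1 (d\<Phi> x t) = R1 (d\<Phi> x (P1 t))" using straight_blocks(2)[OF g st t(1)] by simp
    also have "\<dots> = d\<Phi> x (P1 t)" using straight_blocks(1)[OF g st t(1)] split_sum[of "d\<Phi> x (P1 t)"] by simp
    finally have "R1 (d\<Phi> x t) = d\<Phi> x (P1 t)" .
    then show ?thesis unfolding t(2) using rad rad2
      by (simp add: linear_add[OF l] linear_scale[OF l])
  qed
  have d1: "dd\<Phi> x (P1 x) w = 0" for w using dd[of w] commute[of w] by simp
  have "((\<lambda>y. d\<Phi> y y) has_derivative (\<lambda>v. dd\<Phi> x x v + d\<Phi> x v)) (at x)"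
    by (rule has_derivative_linear_family[OF open_C]) (use xg(1) d\<Phi>_linear dd\<Phi> in auto)
  moreover have "((\<lambda>y. d\<Phi> y y) has_derivative d\<Phi> x) (at x)"
    by (rule has_derivative_transform_within_open[OF d\<Phi>[OF xg(1)] open_C xg(1)]) (simp add: d\<Phi>_self)
  ultimately have "dd\<Phi> x x w + d\<Phi> x w = d\<Phi> x w" for w by (rule fun_cong[OF has_derivative_unique])
  then have dx: "dd\<Phi> x x w = 0" for w by simp
  have d2: "dd\<Phi> x (P2 x) w = 0" for w
    using dx[of w] d1[of w] linear_add[OF dd\<Phi>_linear1[OF xg(1), of w], of "P1 x" "P2 x"]
    by (simp add: src.split_sum)
  \<comment> \<open>By \<open>second_form\<close> this pairing is totally symmetric, so a radial
    test vector can trade places with a tangent argument and bring in \<open>d1\<close> and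
    \<open>d2\<close>.\<close>
  have sym: "D2 (\<Phi> x) (dd\<Phi> x p q) (d\<Phi> x w) = D2 (\<Phi> x) (dd\<Phi> x w p) (d\<Phi> x q)" for p q w
    using second_form[OF xg(1)] D3_sym[OF z] D3_sym12[OF z] by metis
  have zero: "D2 (\<Phi> x) 0 q = 0" for q using linear_0[OF D2_linear1[OF z]] .
  have tt: "dd\<Phi> x s t = 0" if s: "tang P1 P2 x s" and t: "tang P1 P2 x t" for s t
  proof (rule nondegenerate[OF xg(1)])
    fix w
    obtain r c d where r: "tang P1 P2 x r" "w = c *\<^sub>R P1 x + d *\<^sub>R P2 x + r"
      using src.tang_decomp[OF xg(2), of w] by metis
    have "D2 (\<Phi> x) (dd\<Phi> x s t) (d\<Phi> x r) = 0"
      using second_form[OF xg(1), of s t r] D3_tang[OF xg(3) d\<Phi>_tang[OF g s] d\<Phi>_tang[OF g t] d\<Phi>_tang[OF g r(1)]]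
      by simp
    moreover have "D2 (\<Phi> x) (dd\<Phi> x s t) (d\<Phi> x (P1 x)) = 0" "D2 (\<Phi> x) (dd\<Phi> x s t) (d\<Phi> x (P2 x)) = 0"
      using sym[of s t "P1 x"] sym[of s t "P2 x"] d1 d2 zero by auto
    ultimately show "D2 (\<Phi> x) (dd\<Phi> x s t) (d\<Phi> x w) = 0"
      unfolding r(2) by (simp add: linear_add[OF l] linear_scale[OF l]
          linear_add[OF D2_linear2[OF z]] linear_scale[OF D2_linear2[OF z]])
  qed
  obtain s c d where s: "tang P1 P2 x s" "u = c *\<^sub>R P1 x + d *\<^sub>R P2 x + s"
    using src.tang_decomp[OF xg(2), of u] by metis
  obtain t c' d' where t: "tang P1 P2 x t" "v = c' *\<^sub>R P1 x + d' *\<^sub>R P2 x + t"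
    using src.tang_decomp[OF xg(2), of v] by metis
  have "dd\<Phi> x u v = dd\<Phi> x s v"
    unfolding s(2) using d1 d2 by (simp add: linear_add[OF dd\<Phi>_linear1[OF xg(1)]] linear_scale[OF dd\<Phi>_linear1[OF xg(1)]])
  also have "\<dots> = dd\<Phi> x s t"
    unfolding t(2) using d1 d2 dd\<Phi>_sym[OF xg(1), of s]
    by (simp add: linear_add[OF dd\<Phi>_linear2[OF xg(1)]] linear_scale[OF dd\<Phi>_linear2[OF xg(1)]])
  finally show ?thesis using tt[OF s(1) t(1)] by simp
qed

lemma crossed_imp_radial:
  assumes g: "good x" and c: "crossed x" and W: "wide P1" "wide P2"
  shows "D1 (\<Phi> x) (R1 (\<Phi> x)) = b * (P2 x \<bullet> P2 x)"
proof -
  interpret cr: hessian_iso P1 P2 R2 R1 E D1 D2 D3 \<Phi> d\<Phi> dd\<Phi> C a b by (rule iso_cross[OF W])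
  have "cr.good x" using g by (simp add: cr.good_def good_def reg_swap[of R2 R1])
  moreover have "cr.straight x"
    using c unfolding cr.straight_def crossed_def
    by (auto simp: cr.coef_def cr.coef'_def coef_def coef'_def)
  ultimately show ?thesis using cr.straight_radial(2) W by blast
qed

text \<open>Straightness must hold in a neighbourhood of x. At a crossed point y the radial
  derivative equals \<open>b * (P2 y \<bullet> P2 y)\<close>; by \<open>ne\<close> this fails at x,
  hence also near x.\<close>

lemma dd\<Phi>_zero_straight:
  assumes g: "good x" and st: "straight x" and ne: "a * (P1 x \<bullet> P1 x) \<noteq> b * (P2 x \<bullet> P2 x)" and W: "wide P1 \<or> wide P2"
  shows "dd\<Phi> x u v = 0"
proof -
  \<comment> \<open>The good points at which \<open>crossed_imp_radial\<close> excludes being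
    crossed; they form an open set by continuity.\<close>
  define U where "U = {y. good y} \<inter> {y \<in> {y. good y}. D1 (\<Phi> y) (R1 (\<Phi> y)) - b * (P2 y \<bullet> P2 y) \<in> - {0}}"
  have "continuous_on {y. good y} (\<lambda>y. D1 (\<Phi> y) (R1 (\<Phi> y)) - b * (P2 y \<bullet> P2 y))"
  proof (rule continuous_at_imp_continuous_on, rule ballI)
    fix y assume "y \<in> {y. good y}"
    then have y: "y \<in> C" by (simp add: good_def)
    show "isCont (\<lambda>y. D1 (\<Phi> y) (R1 (\<Phi> y)) - b * (P2 y \<bullet> P2 y)) y"
      by (rule has_derivative_continuous, rule has_derivative_diff,
          rule has_derivative_compose[OF d\<Phi>[OF y] D1_radial_derivative[OF \<Phi>_nonzero[OF y]]],
          rule has_derivative_mult_right, rule has_derivative_inner;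
          rule linear_imp_has_derivative[OF src.lin2])
  qed
  then have "open U" unfolding U_def
    using continuous_open_preimage[OF _ open_good, of "\<lambda>y. D1 (\<Phi> y) (R1 (\<Phi> y)) - b * (P2 y \<bullet> P2 y)" "- {0}"]
    by (simp add: open_Compl vimage_def Collect_conj_eq Int_assoc[symmetric])
  moreover have "good y \<and> straight y" if "y \<in> U" for y
    using that straight_or_crossed[of y] crossed_imp_radial[of y] by (auto simp: U_def)
  moreover have "x \<in> U" using g ne straight_radial(1)[OF g st W] by (simp add: U_def)
  ultimately show ?thesis using straight_dd\<Phi>_zero W by blast
qed

text \<open>The condition \<open>ne\<close> concerns the source alone, so it survives the exchange
  of target blocks that makes a crossed point straight.\<close>

lemma dd\<Phi>_zero:
  assumes g: "good x" and ne: "a * (P1 x \<bullet> P1 x) \<noteq> b * (P2 x \<bullet> P2 x)" and W: "wide P1 \<or> wide P2"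
  shows "dd\<Phi> x u v = 0"
proof (cases "straight x")
  case True
  then show ?thesis using dd\<Phi>_zero_straight assms by blast
next
  case False
  then have c: "wide P1" "wide P2" "crossed x" using straight_or_crossed[OF g] by auto
  interpret cr: hessian_iso P1 P2 R2 R1 E D1 D2 D3 \<Phi> d\<Phi> dd\<Phi> C a b by (rule iso_cross[OF c(1,2)])
  have "cr.good x" using g by (simp add: cr.good_def good_def reg_swap[of R2 R1])
  moreover have "cr.straight x"
    using c unfolding cr.straight_def crossed_def
    by (auto simp: cr.coef_def cr.coef'_def coef_def coef'_def)
  ultimately show ?thesis using cr.dd\<Phi>_zero_straight ne W by blast
qed

end

section \<open>Minkowski norms with block diagonal symmetry\<close>

text \<open>In dimension 1 the determinant is the only entry and forces the identity; from dimension
  2 on, rotations join any two vectors of equal length.\<close>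

lemma SO_orbit_iff:
  fixes z z' :: "real ^ 'n"
  shows "(\<exists>A\<in>SO_mat. z' = A *v z) \<longleftrightarrow> z = z' \<or> 2 \<le> CARD('n) \<and> norm z = norm z'"
proof
  assume "\<exists>A\<in>SO_mat. z' = A *v z"
  then obtain A :: "real ^ 'n ^ 'n" where A: "orthogonal_matrix A" "det A = 1" "z' = A *v z" by (auto simp: SO_mat_def)
  have "orthogonal_transformation (\<lambda>z. A *v z)"
    using A(1) by (simp add: orthogonal_transformation_matrix)
  then have n: "norm z = norm z'" using A(3) by (simp add: orthogonal_transformation)
  show "z = z' \<or> 2 \<le> CARD('n) \<and> norm z = norm z'"
  proof (cases "2 \<le> CARD('n)")
    case False
    then have "CARD('n) = 1" using one_le_card_finite[where 'a='n] by linarith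
    then obtain k :: 'n where k: "UNIV = {k}" by (auto simp: card_1_singleton_iff)
    then have "\<And>i::'n. i = k" by blast
    then have "det A = (\<Prod>i\<in>UNIV. A $ i $ i)" by (intro det_diagonal) metis
    then have "A $ k $ k = 1" using A(2) unfolding k by simp
    moreover have "(A *v z) $ k = A $ k $ k * z $ k" unfolding matrix_vector_mult_def k by simp
    ultimately have "A *v z = z" using \<open>\<And>i. i = k\<close> by (metis mult_1 vec_eq_iff)
    then show ?thesis using A(3) by simp
  qed (use n in blast)
next
  assume "z = z' \<or> 2 \<le> CARD('n) \<and> norm z = norm z'"
  then show "\<exists>A\<in>SO_mat. z' = A *v z"
  proof
    assume "z = z'"
    then show ?thesis by (intro bexI[of _ "mat 1"]) (auto simp: SO_mat_def orthogonal_matrix_id det_I)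
  next
    assume *: "2 \<le> CARD('n) \<and> norm z = norm z'"
    then obtain f where f: "orthogonal_transformation f" "det (matrix f) = 1" "f z = z'"
      using rotation_exists[of z z'] by blast
    then show ?thesis
      by (intro bexI[of _ "matrix f"])
         (auto simp: SO_mat_def orthogonal_transformation_matrix matrix_works orthogonal_transformation_linear)
  qed
qed

definition proj1 :: "('a::finite, 'b::finite) vec \<Rightarrow> ('a, 'b) vec" where
  "proj1 x = (\<chi> i. case i of Inl p \<Rightarrow> x $ Inl p | Inr p \<Rightarrow> 0)"

definition proj2 :: "('a::finite, 'b::finite) vec \<Rightarrow> ('a, 'b) vec" where
  "proj2 x = (\<chi> i. case i of Inl p \<Rightarrow> 0 | Inr p \<Rightarrow> x $ Inr p)"

lemma sum_UNIV_Plus: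
  "(\<Sum>i\<in>(UNIV::('a::finite + 'b::finite) set). f i) = (\<Sum>i\<in>UNIV. f (Inl i)) + (\<Sum>i\<in>UNIV. f (Inr i))"
  using sum.Plus[of "UNIV :: 'a set" "UNIV :: 'b set" f] by (simp add: o_def)

lemma proj_nth [simp]:
  "proj1 x $ Inl i = x $ Inl i" "proj1 x $ Inr j = 0" "proj2 x $ Inl i = 0" "proj2 x $ Inr j = x $ Inr j"
  by (simp_all add: proj1_def proj2_def)

lemma vec_eq_Plus: "(x :: ('a::finite, 'b::finite) vec) = y \<longleftrightarrow>
    (\<forall>i. x $ Inl i = y $ Inl i) \<and> (\<forall>j. x $ Inr j = y $ Inr j)"
  unfolding vec_eq_iff by (metis sum.exhaust)

lemma splitting_proj: "splitting (proj1 :: ('a::finite, 'b::finite) vec \<Rightarrow> _) proj2"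
proof
  show "proj1 (x + y) = proj1 x + proj1 y" "proj2 (x + y) = proj2 x + proj2 y"
    "proj1 (c *\<^sub>R x) = c *\<^sub>R proj1 x" "proj2 (c *\<^sub>R x) = c *\<^sub>R proj2 x" "proj1 x + proj2 x = x"
    for x y :: "('a, 'b) vec" and c
    by (simp_all add: vec_eq_Plus)
  show "proj1 x \<bullet> proj2 y = 0" for x y :: "('a, 'b) vec"
    by (simp add: inner_vec_def sum_UNIV_Plus)
  have "proj1 (1 :: ('a, 'b) vec) \<noteq> 0" "proj2 (1 :: ('a, 'b) vec) \<noteq> 0"
    by (simp_all add: vec_eq_Plus)
  then show "\<exists>x::('a, 'b) vec. proj1 x \<noteq> 0" "\<exists>x::('a, 'b) vec. proj2 x \<noteq> 0" by blast+
qed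

lemma wide_proj1: "wide (proj1 :: ('a::finite, 'b::finite) vec \<Rightarrow> _) \<longleftrightarrow> 2 \<le> CARD('a)"
proof -
  define j :: "real ^ 'a \<Rightarrow> ('a, 'b) vec" where "j z = (\<chi> i. case i of Inl p \<Rightarrow> z $ p | Inr p \<Rightarrow> 0)" for z
  have jn: "j z $ Inl i = z $ i" "j z $ Inr k = 0" for z i k by (simp_all add: j_def)
  have "linear j" by (rule linearI) (simp_all add: vec_eq_Plus jn)
  moreover have "inj j" by (rule injI) (metis jn(1) vec_eq_iff)
  ultimately have "dim (range j) = dim (UNIV :: (real ^ 'a) set)" by (intro dim_image_eq) auto
  moreover have "range j = range (proj1 :: ('a, 'b) vec \<Rightarrow> _)"
  proof
    show "range j \<subseteq> range proj1"
    proof (rule image_subsetI)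
      fix z have "j z = proj1 (j z)" by (simp add: vec_eq_Plus jn)
      then show "j z \<in> range proj1" by blast
    qed
    show "range proj1 \<subseteq> range j"
    proof (rule image_subsetI)
      fix x :: "('a, 'b) vec" have "proj1 x = j (\<chi> i. x $ Inl i)" by (simp add: vec_eq_Plus jn)
      then show "proj1 x \<in> range j" by blast
    qed
  qed
  ultimately show ?thesis by (simp add: wide_def)
qed

lemma wide_proj2: "wide (proj2 :: ('a::finite, 'b::finite) vec \<Rightarrow> _) \<longleftrightarrow> 2 \<le> CARD('b)"
proof -
  define j :: "real ^ 'b \<Rightarrow> ('a, 'b) vec" where "j z = (\<chi> i. case i of Inl p \<Rightarrow> 0 | Inr p \<Rightarrow> z $ p)" for z
  have jn: "j z $ Inr i = z $ i" "j z $ Inl k = 0" for z i k by (simp_all add: j_def)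
  have "linear j" by (rule linearI) (simp_all add: vec_eq_Plus jn)
  moreover have "inj j" by (rule injI) (metis jn(1) vec_eq_iff)
  ultimately have "dim (range j) = dim (UNIV :: (real ^ 'b) set)" by (intro dim_image_eq) auto
  moreover have "range j = range (proj2 :: ('a, 'b) vec \<Rightarrow> _)"
  proof
    show "range j \<subseteq> range proj2"
    proof (rule image_subsetI)
      fix z have "j z = proj2 (j z)" by (simp add: vec_eq_Plus jn)
      then show "j z \<in> range proj2" by blast
    qed
    show "range proj2 \<subseteq> range j"
    proof (rule image_subsetI)
      fix x :: "('a, 'b) vec" have "proj2 x = j (\<chi> i. x $ Inr i)" by (simp add: vec_eq_Plus jn)
      then show "proj2 x \<in> range j" by blast
    qed
  qed
  ultimately show ?thesis by (simp add: wide_def)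
qed

text \<open>The two rotations act on separate coordinates, so the condition splits into two
  instances of \<open>SO_orbit_iff\<close>.\<close>

lemma orb_iff_block_act:
  fixes x y :: "('a::finite, 'b::finite) vec"
  shows "orb proj1 proj2 x y \<longleftrightarrow> (\<exists>A1\<in>SO_mat. \<exists>A2\<in>SO_mat. y = block_act A1 A2 x)"
proof -
  let ?p = "\<lambda>x::('a, 'b) vec. (\<chi> q. x $ Inl q) :: real ^ 'a" and ?q = "\<lambda>x::('a, 'b) vec. (\<chi> q. x $ Inr q) :: real ^ 'b"
  have e: "proj1 x = proj1 y \<longleftrightarrow> ?p x = ?p y" "proj2 x = proj2 y \<longleftrightarrow> ?q x = ?q y" for x y :: "('a, 'b) vec"
    by (simp_all add: vec_eq_Plus vec_eq_iff)
  have n: "norm (proj1 x) = norm (?p x)" "norm (proj2 x) = norm (?q x)" for x :: "('a, 'b) vec"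
    by (simp_all add: norm_eq_sqrt_inner inner_vec_def sum_UNIV_Plus)
  have "y = block_act A1 A2 x \<longleftrightarrow> ?p y = A1 *v ?p x \<and> ?q y = A2 *v ?q x" for A1 A2
    by (simp add: vec_eq_Plus vec_eq_iff block_act_def)
  then have "(\<exists>A1\<in>SO_mat. \<exists>A2\<in>SO_mat. y = block_act A1 A2 x) \<longleftrightarrow>
      (\<exists>A1\<in>SO_mat. ?p y = A1 *v ?p x) \<and> (\<exists>A2\<in>SO_mat. ?q y = A2 *v ?q x)" by blast
  also have "\<dots> \<longleftrightarrow> orb proj1 proj2 x y"
    unfolding SO_orbit_iff orb_def e n wide_proj1 wide_proj2 by blast
  finally show ?thesis by blast
qed

section \<open>Minkowski norms as invariant energies\<close>

lemma Ck_on_energy: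
  assumes "minkowski_norm F"
  shows "Ck_on m (UNIV - {0}) (\<lambda>x. (F x)\<^sup>2 / 2)"
proof -
  have o: "open (UNIV - {0::'a})" by auto
  have F: "Ck_on m (UNIV - {0}) F" using assms by (simp add: minkowski_norm_def smooth_on_def)
  show ?thesis
    by (rule Ck_on_cong[OF o _ Ck_on_mult[OF o Ck_on_const[OF o, of m "1/2"] Ck_on_mult[OF o F F]]])
       (simp add: power2_eq_square)
qed

lemma Ck_on_frechet: "Ck_on (Suc m) S f \<Longrightarrow> Ck_on m S (\<lambda>x. frechet_derivative f (at x) u)"
  by simp

lemma Ck_on_has_derivative:
  assumes "Ck_on (Suc m) S f" "open S" "x \<in> S"
  shows "(f has_derivative frechet_derivative f (at x)) (at x)"
  using assms by (intro has_derivative_at_frechet) auto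

lemma frechet_derivative2_symmetric:
  fixes f :: "'x::euclidean_space \<Rightarrow> 'y::euclidean_space"
  assumes f: "Ck_on (Suc (Suc 0)) S f" and S: "open S" "x \<in> S"
  shows "frechet_derivative (\<lambda>x. frechet_derivative f (at x) u) (at x) v
    = frechet_derivative (\<lambda>x. frechet_derivative f (at x) v) (at x) u"
proof (rule euclidean_eqI)
  fix e :: 'y assume "e \<in> Basis"
  note f1 = Ck_on_frechet[OF f]
  show "frechet_derivative (\<lambda>x. frechet_derivative f (at x) u) (at x) v \<bullet> e
    = frechet_derivative (\<lambda>x. frechet_derivative f (at x) v) (at x) u \<bullet> e"
  proof (rule second_derivative_symmetric[OF S,
        where f = "\<lambda>x. f x \<bullet> e" and D = "\<lambda>x u. frechet_derivative f (at x) u \<bullet> e"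
        and ?D2.0 = "\<lambda>x u v. frechet_derivative (\<lambda>x. frechet_derivative f (at x) u) (at x) v \<bullet> e"])
    show "((\<lambda>x. f x \<bullet> e) has_derivative (\<lambda>u. frechet_derivative f (at x) u \<bullet> e)) (at x)" if "x \<in> S" for x
      by (intro has_derivative_inner_left Ck_on_has_derivative[OF f S(1) that])
    show "((\<lambda>x. frechet_derivative f (at x) w \<bullet> e) has_derivative
        (\<lambda>v. frechet_derivative (\<lambda>x. frechet_derivative f (at x) w) (at x) v \<bullet> e)) (at x)" if "x \<in> S" for x w
      by (intro has_derivative_inner_left Ck_on_has_derivative[OF f1 S(1) that])
    show "continuous_on S (\<lambda>x. frechet_derivative (\<lambda>x. frechet_derivative f (at x) w) (at x) z \<bullet> e)" for w z
      using Ck_on_frechet[OF f1] by (intro continuous_on_inner continuous_on_const) simp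
  qed
qed

lemma energy_minkowski:
  fixes F :: "('a::finite, 'b::finite) vec \<Rightarrow> real"
  assumes F: "minkowski_norm F" and G: "G_invariant_fun F"
  shows "energy proj1 proj2 (\<lambda>x. (F x)\<^sup>2 / 2) (\<lambda>x. frechet_derivative (\<lambda>x. (F x)\<^sup>2 / 2) (at x))
    (hess_metric F) (\<lambda>x u v. frechet_derivative (\<lambda>x. hess_metric F x u v) (at x))"
proof (intro energy.intro splitting_proj energy_axioms.intro)
  let ?E = "\<lambda>x. (F x)\<^sup>2 / 2" and ?S = "UNIV - {0 :: ('a, 'b) vec}"
  have o: "open ?S" by auto
  note c = Ck_on_energy[OF F]
  have h: "hess_metric F x u = frechet_derivative (\<lambda>x. frechet_derivative ?E (at x) u) (at x)" for x u
    by (auto simp: hess_metric_def hess_def)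
  have c2: "Ck_on m ?S (\<lambda>x. frechet_derivative ?E (at x) u)" for m u
    using Ck_on_frechet[OF c] .
  have c3: "Ck_on m ?S (\<lambda>x. hess_metric F x u v)" for m u v
    unfolding h using Ck_on_frechet[OF c2] .
  fix x :: "('a, 'b) vec"
  show "(?E has_derivative frechet_derivative ?E (at x)) (at x)" if "x \<noteq> 0"
    using Ck_on_has_derivative[OF c o, of x] that by simp
  show "((\<lambda>x. frechet_derivative ?E (at x) u) has_derivative hess_metric F x u) (at x)" if "x \<noteq> 0" for u
    unfolding h using Ck_on_has_derivative[OF c2 o, of x] that by simp
  show "((\<lambda>x. hess_metric F x u v) has_derivative frechet_derivative (\<lambda>x. hess_metric F x u v) (at x)) (at x)"
    if "x \<noteq> 0" for u v
    using Ck_on_has_derivative[OF c3 o, of x] that by simp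
  show "hess_metric F x u v = hess_metric F x v u" if "x \<noteq> 0" for u v
    unfolding h using frechet_derivative2_symmetric[OF c o, of x] that by simp
  show "frechet_derivative (\<lambda>x. hess_metric F x u v) (at x) w = frechet_derivative (\<lambda>x. hess_metric F x u w) (at x) v"
    if "x \<noteq> 0" for u v w
    unfolding h using frechet_derivative2_symmetric[OF c2 o, of x] that by simp
  show "(F (t *\<^sub>R x))\<^sup>2 / 2 = t\<^sup>2 * ((F x)\<^sup>2 / 2)" if "0 < t" for t
    using F that by (simp add: minkowski_norm_def power_mult_distrib)
  show "0 < hess_metric F x v v" if "x \<noteq> 0" "v \<noteq> 0" for v
    using F that by (simp add: minkowski_norm_def)
  show "(F x)\<^sup>2 / 2 = (F y)\<^sup>2 / 2" if "orb proj1 proj2 x y" for y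
    using that G unfolding orb_iff_block_act G_invariant_fun_def by auto
qed

lemma continuous_on_D3:
  assumes "minkowski_norm F" "0 \<notin> C"
  shows "continuous_on C (\<lambda>x. frechet_derivative (\<lambda>x. hess_metric F x u v) (at x) w)"
proof -
  have "Ck_on 0 (UNIV - {0}) (\<lambda>x. frechet_derivative (\<lambda>x. hess_metric F x u v) (at x) w)"
    unfolding hess_metric_def hess_def by (intro Ck_on_frechet Ck_on_energy assms)
  then show ?thesis using assms(2) by (auto elim: continuous_on_subset)
qed

text \<open>The matrix demanded by \<open>euclidean_on\<close> is the Gram matrix of B in the
  standard basis.\<close>

lemma euclidean_on_quadratic:
  fixes B :: "real ^ 'n \<Rightarrow> real ^ 'n \<Rightarrow> real"
  assumes lin: "\<And>u. linear (B u)" and sym: "\<And>u v. B u v = B v u" and pos: "\<And>u. u \<noteq> 0 \<Longrightarrow> B u u > 0"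
    and F: "\<And>x. x \<in> C \<Longrightarrow> F x = sqrt (B x x)"
  shows "euclidean_on F C"
proof -
  define \<alpha> :: "real ^ 'n ^ 'n" where "\<alpha> = (\<chi> i j. B (axis i 1) (axis j 1))"
  have e: "B u v = (\<Sum>j\<in>UNIV. v $ j * B u (axis j 1))" for u v
  proof -
    have "B u v = B u (\<Sum>j\<in>UNIV. v $ j *\<^sub>R axis j 1)" by (simp add: basis_expansion flip: scalar_mult_eq_scaleR)
    then show ?thesis by (simp add: linear_sum[OF lin] linear_scale[OF lin])
  qed
  have Bx: "(\<Sum>i\<in>UNIV. \<Sum>j\<in>UNIV. \<alpha> $ i $ j * x $ i * x $ j) = B x x" for x
  proof -
    have "B x x = (\<Sum>j\<in>UNIV. x $ j * B (axis j 1) x)" by (subst e) (simp add: sym)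
    also have "\<dots> = (\<Sum>i\<in>UNIV. x $ i * (\<Sum>j\<in>UNIV. x $ j * B (axis i 1) (axis j 1)))"
      by (simp only: e[of _ x])
    finally show ?thesis by (simp add: \<alpha>_def sum_distrib_left mult_ac)
  qed
  have "x \<bullet> (\<alpha> *v x) = B x x" for x
    unfolding Bx[symmetric] by (simp add: inner_vec_def matrix_vector_mult_def sum_distrib_left mult_ac)
  moreover have "transpose \<alpha> = \<alpha>" by (simp add: transpose_def \<alpha>_def sym)
  ultimately show ?thesis unfolding euclidean_on_def using pos F Bx by (intro exI[of _ \<alpha>]) auto
qed

lemma block_form_linear_symmetric_pos:
  fixes a b :: real
  assumes "a > 0" "b > 0"
  defines "Q \<equiv> \<lambda>u v :: ('a::finite, 'b::finite) vec. a * (proj1 u \<bullet> proj1 v) + b * (proj2 u \<bullet> proj2 v)"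
  shows "linear (Q u)" "Q u v = Q v u" "u \<noteq> 0 \<Longrightarrow> Q u u > 0"
proof -
  interpret splitting "proj1 :: ('a, 'b) vec \<Rightarrow> _" proj2 by (rule splitting_proj)
  show "linear (Q u)" by (rule linearI) (simp_all add: Q_def inner_add_right algebra_simps)
  show "Q u v = Q v u" by (simp add: Q_def inner_commute)
  assume "u \<noteq> 0"
  then have "proj1 u \<noteq> 0 \<or> proj2 u \<noteq> 0" using split_sum[of u] by auto
  then show "Q u u > 0" unfolding Q_def using assms(1,2)
    by (metis add_nonneg_pos add_pos_nonneg inner_ge_zero inner_gt_zero_iff less_imp_le mult_nonneg_nonneg mult_pos_pos)
qed

section \<open>Constancy of the Hessian and linearity of the isometry\<close>

text \<open>The third derivative vanishes at regular points by \<open>D2_block\<close>. These are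
  dense and C is connected, so the Hessian is constant and can be read off at one regular
  point.\<close>

lemma hess_metric_constant:
  fixes F :: "('a::finite, 'b::finite) vec \<Rightarrow> real"
  assumes F: "minkowski_norm F" "G_invariant_fun F" and C: "conic_open C" "connected C" "C \<noteq> {}"
    and orth: "\<forall>y\<in>C. \<forall>v1\<in>V1. \<forall>v2\<in>V2. hess_metric F y v1 v2 = 0"
  obtains a b where "a > 0" "b > 0"
    "\<And>y u v. y \<in> C \<Longrightarrow> hess_metric F y u v = a * (proj1 u \<bullet> proj1 v) + b * (proj2 u \<bullet> proj2 v)"
proof -
  interpret energy proj1 proj2 "\<lambda>x. (F x)\<^sup>2 / 2" "\<lambda>x. frechet_derivative (\<lambda>x. (F x)\<^sup>2 / 2) (at x)"
    "hess_metric F" "\<lambda>x u v. frechet_derivative (\<lambda>x. hess_metric F x u v) (at x)"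
    by (rule energy_minkowski[OF F])
  have oC: "open C" "0 \<notin> C" using C by (auto simp: conic_open_def)
  have orth': "hess_metric F x (proj1 u) (proj2 v) = 0" if "x \<in> C" for x u v
    using orth that by (simp add: V1_def V2_def)
  note blk = D2_block[OF oC orth']
  have dense: "C \<subseteq> closure {x \<in> C. \<forall>v w. frechet_derivative (\<lambda>x. hess_metric F x u v) (at x) w = 0}" for u
  proof
    fix x assume x: "x \<in> C"
    show "x \<in> closure {x \<in> C. \<forall>v w. frechet_derivative (\<lambda>x. hess_metric F x u v) (at x) w = 0}"
      unfolding closure_iff_nhds_not_empty
    proof (intro allI impI)
      fix A T assume T: "T \<subseteq> A" "open T" "x \<in> T"
      then obtain y where "y \<in> T \<inter> C" "reg proj1 proj2 y"
        using exists_regular[of "T \<inter> C"] oC x by blast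
      then show "{x \<in> C. \<forall>v w. frechet_derivative (\<lambda>x. hess_metric F x u v) (at x) w = 0} \<inter> A \<noteq> {}"
        using blk(2)[of y] T by blast
    qed
  qed
  have deriv: "((\<lambda>x. hess_metric F x u v) has_derivative frechet_derivative (\<lambda>x. hess_metric F x u v) (at x)) (at x)"
    if "x \<in> C" for x u v
    using D3 oC(2) that by metis
  have const: "hess_metric F x u = hess_metric F y u" if "x \<in> C" "y \<in> C" for x y u
    by (rule derivative_constant_if_second_zero_dense[where df = "\<lambda>x. hess_metric F x u"
          and ddf = "\<lambda>x v. frechet_derivative (\<lambda>x. hess_metric F x u v) (at x)",
          OF oC(1) C(2) deriv continuous_on_D3[OF F(1) oC(2)] dense that])
  obtain y where y: "y \<in> C" "reg proj1 proj2 y" using exists_regular[OF oC(1) C(3)] by blast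
  have form: "hess_metric F x u v = coef y * (proj1 u \<bullet> proj1 v) + coef' y * (proj2 u \<bullet> proj2 v)" if "x \<in> C" for x u v
    using const[OF that y(1)] blk(1)[OF _ y] by metis
  have y0: "y \<noteq> 0" using y oC by blast
  \<comment> \<open>The form is known on all vectors here, so the radial vector tests the sign even
    in a block of dimension 1.\<close>
  have "coef y * (proj1 y \<bullet> proj1 y) > 0"
    using D2_pos[OF y0, of "proj1 y"] form[OF y(1), of "proj1 y" "proj1 y"] y(2) by (simp add: reg_def)
  then have "coef y > 0" by (rule zero_less_mult_pos2) (use y(2) in \<open>simp add: reg_def\<close>)
  moreover have "coef' y * (proj2 y \<bullet> proj2 y) > 0"
    using D2_pos[OF y0, of "proj2 y"] form[OF y(1), of "proj2 y" "proj2 y"] y(2) by (simp add: reg_def)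
  then have "coef' y > 0" by (rule zero_less_mult_pos2) (use y(2) in \<open>simp add: reg_def\<close>)
  ultimately show ?thesis using that form by blast
qed

text \<open>Two Euler identities: the Hessian of F^2 / 2 at x, evaluated on x, is F(x)^2. A constant
  Hessian thus makes F^2 quadratic.\<close>

lemma minkowski_norm_sqrt_hess:
  fixes F :: "('a::finite, 'b::finite) vec \<Rightarrow> real"
  assumes F: "minkowski_norm F" "G_invariant_fun F" and x: "x \<noteq> 0"
  shows "F x = sqrt (hess_metric F x x x)"
proof -
  interpret energy proj1 proj2 "\<lambda>x. (F x)\<^sup>2 / 2" "\<lambda>x. frechet_derivative (\<lambda>x. (F x)\<^sup>2 / 2) (at x)"
    "hess_metric F" "\<lambda>x u v. frechet_derivative (\<lambda>x. hess_metric F x u v) (at x)"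
    by (rule energy_minkowski[OF F])
  have "hess_metric F x x x = (F x)\<^sup>2" using euler[OF x] euler2[OF x, of x] by simp
  then show ?thesis using F(1) by (simp add: minkowski_norm_def)
qed

lemma hessian_iso_minkowski:
  fixes F1 F2 :: "('a::finite, 'b::finite) vec \<Rightarrow> real"
  assumes F2: "minkowski_norm F2" "G_invariant_fun F2"
    and C: "conic_open C" "G_invariant_set C" and ab: "a > 0" "b > 0"
    and Q: "\<And>y u v. y \<in> C \<Longrightarrow> hess_metric F1 y u v = a * (proj1 u \<bullet> proj1 v) + b * (proj2 u \<bullet> proj2 v)"
    and iso: "local_hessian_isometry F1 F2 \<Phi> C" and orbs: "maps_orbits_into_orbits \<Phi> C"
  shows "hessian_iso proj1 proj2 proj1 proj2 (\<lambda>x. (F2 x)\<^sup>2 / 2) (\<lambda>x. frechet_derivative (\<lambda>x. (F2 x)\<^sup>2 / 2) (at x))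
    (hess_metric F2) (\<lambda>x u v. frechet_derivative (\<lambda>x. hess_metric F2 x u v) (at x))
    \<Phi> (\<lambda>x. frechet_derivative \<Phi> (at x)) (\<lambda>x u. frechet_derivative (\<lambda>x. frechet_derivative \<Phi> (at x) u) (at x)) C a b"
proof (intro hessian_iso.intro energy_minkowski F2 splitting_proj hessian_iso_axioms.intro ab refl)
  have oC: "open C" using C by (auto simp: conic_open_def)
  have ck: "Ck_on m C \<Phi>" for m using iso by (simp add: local_hessian_isometry_def diffeo_onto_def smooth_on_def)
  show "open C" by (rule oC)
  show "inj_on \<Phi> C" using iso by (auto simp: local_hessian_isometry_def diffeo_onto_def bij_betw_def)
  fix x assume x: "x \<in> C"
  show "\<Phi> x \<noteq> 0" using iso x unfolding local_hessian_isometry_def conic_open_def by (metis imageI)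
  show d: "(\<Phi> has_derivative frechet_derivative \<Phi> (at x)) (at x)"
    using Ck_on_has_derivative[OF ck oC x] .
  show "((\<lambda>x. frechet_derivative \<Phi> (at x) u) has_derivative
      frechet_derivative (\<lambda>x. frechet_derivative \<Phi> (at x) u) (at x)) (at x)" for u
    using Ck_on_has_derivative[OF Ck_on_frechet[OF ck] oC x] .
  show "frechet_derivative (\<lambda>x. frechet_derivative \<Phi> (at x) u) (at x) v
      = frechet_derivative (\<lambda>x. frechet_derivative \<Phi> (at x) v) (at x) u" for u v
    using frechet_derivative2_symmetric[OF ck oC x] .
  \<comment> \<open>Euler's identity for a map of degree 1, by differentiating along the ray through
    x at t = 1.\<close>
  show "frechet_derivative \<Phi> (at x) x = \<Phi> x"
  proof -
    have 1: "((\<lambda>t. \<Phi> (t *\<^sub>R x)) has_vector_derivative frechet_derivative \<Phi> (at x) x) (at 1)"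
      by (rule has_vector_derivative_along_curve[where c = "\<lambda>t. t *\<^sub>R x"])
         (auto intro!: derivative_eq_intros simp: d)
    have "((\<lambda>t. t *\<^sub>R \<Phi> x) has_vector_derivative \<Phi> x) (at 1)" by (auto intro!: derivative_eq_intros)
    then have "((\<lambda>t. \<Phi> (t *\<^sub>R x)) has_vector_derivative \<Phi> x) (at 1)"
      by (rule has_vector_derivative_transform_within_open[of _ _ _ "{0<..}"])
         (use iso x in \<open>auto simp: local_hessian_isometry_def\<close>)
    with 1 show ?thesis using vector_derivative_unique_at by blast
  qed
  show "hess_metric F2 (\<Phi> x) (frechet_derivative \<Phi> (at x) u) (frechet_derivative \<Phi> (at x) v)
      = a * (proj1 u \<bullet> proj1 v) + b * (proj2 u \<bullet> proj2 v)" for u v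
    using iso x Q[OF x] by (simp add: local_hessian_isometry_def)
  show "y \<in> C" if "orb proj1 proj2 x y" for y
    using that x C(2) unfolding orb_iff_block_act G_invariant_set_def by auto
  show "orb proj1 proj2 (\<Phi> x) (\<Phi> y)" if "orb proj1 proj2 x y" for y
    using that x orbs unfolding orb_iff_block_act maps_orbits_into_orbits_def by blast
qed

text \<open>\<open>dd\<Phi>_zero\<close> applies on a dense set, so the differential is constant on
  the connected cone; by homogeneity \<Phi>(y) is the differential at y applied to y.\<close>

lemma hessian_isometry_linear:
  fixes F1 F2 :: "('a::finite, 'b::finite) vec \<Rightarrow> real"
  assumes card: "CARD('a) + CARD('b) \<ge> 3" and F2: "minkowski_norm F2" "G_invariant_fun F2"
    and C: "conic_open C" "G_invariant_set C" "connected C" "C \<noteq> {}" and ab: "a > 0" "b > 0"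
    and Q: "\<And>y u v. y \<in> C \<Longrightarrow> hess_metric F1 y u v = a * (proj1 u \<bullet> proj1 v) + b * (proj2 u \<bullet> proj2 v)"
    and iso: "local_hessian_isometry F1 F2 \<Phi> C" and orbs: "maps_orbits_into_orbits \<Phi> C"
  obtains L where "linear L" "inj L" "\<And>y. y \<in> C \<Longrightarrow> \<Phi> y = L y"
    "\<And>y. y \<in> C \<Longrightarrow> F2 (\<Phi> y) = sqrt (a * (proj1 y \<bullet> proj1 y) + b * (proj2 y \<bullet> proj2 y))"
proof -
  let ?d = "\<lambda>x. frechet_derivative \<Phi> (at x)"
  let ?dd = "\<lambda>x u. frechet_derivative (\<lambda>x. frechet_derivative \<Phi> (at x) u) (at x)"
  interpret I: hessian_iso proj1 proj2 proj1 proj2 "\<lambda>x. (F2 x)\<^sup>2 / 2" "\<lambda>x. frechet_derivative (\<lambda>x. (F2 x)\<^sup>2 / 2) (at x)"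
    "hess_metric F2" "\<lambda>x u v. frechet_derivative (\<lambda>x. hess_metric F2 x u v) (at x)" \<Phi> ?d ?dd C a b
    by (rule hessian_iso_minkowski[OF F2 C(1,2) ab Q iso orbs])
  have W: "wide (proj1 :: ('a, 'b) vec \<Rightarrow> _) \<or> wide (proj2 :: ('a, 'b) vec \<Rightarrow> _)"
    using card unfolding wide_proj1 wide_proj2 by linarith
  have inv_cont: "continuous_on (\<Phi> ` C) (inv_into C \<Phi>)"
    using iso unfolding local_hessian_isometry_def diffeo_onto_def smooth_on_def by (metis Ck_on.simps(1))
  \<comment> \<open>Continuity of the inverse makes \<Phi> an open map.\<close>
  have open_im: "open (\<Phi> ` U)" if U: "open U" "U \<subseteq> C" for U
  proof -
    have "open (\<Phi> ` C)" using iso by (auto simp: local_hessian_isometry_def conic_open_def)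
    then have "open (\<Phi> ` C \<inter> inv_into C \<Phi> -` U)"
      using continuous_open_preimage[OF inv_cont] U(1) by blast
    moreover have "\<Phi> ` C \<inter> inv_into C \<Phi> -` U = \<Phi> ` U"
      using U(2) I.inj by (auto simp: inv_into_f_f subset_iff image_iff)
    ultimately show ?thesis by simp
  qed
  have dense: "C \<subseteq> closure {x \<in> C. \<forall>u v. ?dd x u v = 0}"
  proof
    fix x assume x: "x \<in> C"
    show "x \<in> closure {x \<in> C. \<forall>u v. ?dd x u v = 0}"
      unfolding closure_iff_nhds_not_empty
    proof (intro allI impI)
      fix A T assume T: "T \<subseteq> A" "open T" "x \<in> T"
      \<comment> \<open>Regular source points come first; the open image of \<open>?U\<close>
        contains a regular point, and its preimage is good.\<close>
      let ?U = "T \<inter> C \<inter> {y. reg proj1 proj2 y}"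
      have oU: "open ?U" using T I.open_C I.open_reg by blast
      have "?U \<noteq> {}" using I.exists_regular[of "T \<inter> C"] T x I.open_C by blast
      then obtain z where z: "z \<in> \<Phi> ` ?U" "reg proj1 proj2 z"
        using I.exists_regular[OF open_im[OF oU]] by blast
      then obtain y where y: "y \<in> T" "I.good y" by (auto simp: I.good_def)
      obtain y' where "y' \<in> T \<inter> {y. I.good y}" "a * (proj1 y' \<bullet> proj1 y') \<noteq> b * (proj2 y' \<bullet> proj2 y')"
        using I.exists_unbalanced[OF open_Int[OF T(2) I.open_good] _ I.goodD(2)[OF y(2)] ab(1)] y by blast
      then show "{x \<in> C. \<forall>u v. ?dd x u v = 0} \<inter> A \<noteq> {}"
        using I.dd\<Phi>_zero[OF _ _ W] I.goodD(1) T(1) by blast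
    qed
  qed
  have ck: "Ck_on m C \<Phi>" for m using iso by (simp add: local_hessian_isometry_def diffeo_onto_def smooth_on_def)
  have cont: "continuous_on C (\<lambda>x. ?dd x u v)" for u v
    using Ck_on_frechet[OF Ck_on_frechet[OF ck]] Ck_on.simps(1) by blast
  have const: "?d x = ?d y" if "x \<in> C" "y \<in> C" for x y
    using derivative_constant_if_second_zero_dense[OF I.open_C C(3) I.dd\<Phi> cont dense that] .
  obtain y0 where y0: "y0 \<in> C" using C(4) by blast
  show ?thesis
  proof (rule that)
    show "linear (?d y0)" using I.d\<Phi>_linear[OF y0] .
    show "inj (?d y0)" using I.d\<Phi>_inj[OF y0] .
    fix y assume y: "y \<in> C"
    show "\<Phi> y = ?d y0 y" using I.d\<Phi>_self[OF y] const[OF y y0] by simp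
    show "F2 (\<Phi> y) = sqrt (a * (proj1 y \<bullet> proj1 y) + b * (proj2 y \<bullet> proj2 y))"
      using minkowski_norm_sqrt_hess[OF F2 I.\<Phi>_nonzero[OF y]] I.iso[OF y, of y y] I.d\<Phi>_self[OF y] by simp
  qed
qed

theorem theorem1p4:
  fixes F1 :: "('a::finite, 'b::finite) vec \<Rightarrow> real"
    and C1 :: "('a, 'b) vec set"
  assumes "CARD('a) + CARD('b) \<ge> 3"
    and "minkowski_norm F1"
    and "G_invariant_fun F1"
    and "conic_open C1" and "connected C1" and "G_invariant_set C1"
    and "\<forall>y\<in>C1. \<forall>v1\<in>V1. \<forall>v2\<in>V2. hess_metric F1 y v1 v2 = 0"
  shows "euclidean_on F1 C1 \<and>
    (\<forall>(F2 :: ('a, 'b) vec \<Rightarrow> real) \<Phi>.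
       minkowski_norm F2 \<and> G_invariant_fun F2 \<and>
       local_hessian_isometry F1 F2 \<Phi> C1 \<and> maps_orbits_into_orbits \<Phi> C1 \<longrightarrow>
       (\<exists>M :: real ^ ('a + 'b) ^ ('a + 'b). invertible M \<and> (\<forall>y\<in>C1. \<Phi> y = M *v y)) \<and>
       euclidean_on F2 (\<Phi> ` C1))"
proof (cases "C1 = {}")
  case True
  \<comment> \<open>An empty cone offers no point at which to read off a and b; the inner product
    and the identity matrix serve instead.\<close>
  have e: "euclidean_on F {}" for F :: "('a, 'b) vec \<Rightarrow> real"
    by (rule euclidean_on_quadratic[of "(\<bullet>)"])
       (auto simp: inner_commute inner_gt_zero_iff intro: bounded_linear.linear bounded_linear_inner_right)
  have "invertible (mat 1 :: real ^ ('a + 'b) ^ ('a + 'b))" by (simp add: invertible_def exI[of _ "mat 1"])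
  then show ?thesis using e True by auto
next
  case False
  obtain a b where ab: "a > 0" "b > 0"
    and Q: "\<And>y u v. y \<in> C1 \<Longrightarrow> hess_metric F1 y u v = a * (proj1 u \<bullet> proj1 v) + b * (proj2 u \<bullet> proj2 v)"
    using hess_metric_constant[OF assms(2,3,4,5) False assms(7)] by blast
  let ?Q = "\<lambda>u v :: ('a, 'b) vec. a * (proj1 u \<bullet> proj1 v) + b * (proj2 u \<bullet> proj2 v)"
  note form = block_form_linear_symmetric_pos[OF ab, where 'a = 'a and 'b = 'b]
  have nz: "y \<noteq> 0" if "y \<in> C1" for y using that assms(4) by (auto simp: conic_open_def)
  have "euclidean_on F1 C1"
    by (rule euclidean_on_quadratic[of ?Q])
       (use form minkowski_norm_sqrt_hess[OF assms(2,3) nz] Q in auto)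
  moreover have "(\<exists>M :: real ^ ('a + 'b) ^ ('a + 'b). invertible M \<and> (\<forall>y\<in>C1. \<Phi> y = M *v y)) \<and>
       euclidean_on F2 (\<Phi> ` C1)"
    if H: "minkowski_norm F2" "G_invariant_fun F2" "local_hessian_isometry F1 F2 \<Phi> C1" "maps_orbits_into_orbits \<Phi> C1"
    for F2 :: "('a, 'b) vec \<Rightarrow> real" and \<Phi>
  proof -
    obtain L where L: "linear L" "inj L" "\<And>y. y \<in> C1 \<Longrightarrow> \<Phi> y = L y"
      "\<And>y. y \<in> C1 \<Longrightarrow> F2 (\<Phi> y) = sqrt (?Q y y)"
      using hessian_isometry_linear[OF assms(1) H(1,2) assms(4,6,5) False ab Q H(3,4)] by blast
    obtain K where K: "linear K" "\<And>y. K (L y) = y" "\<And>z. L (K z) = z"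
      using linear_injective_isomorphism[OF L(1,2)] by blast
    have "\<exists>M :: real ^ ('a + 'b) ^ ('a + 'b). invertible M \<and> (\<forall>y\<in>C1. \<Phi> y = M *v y)"
      using L(1-3) by (intro exI[of _ "matrix L"])
        (auto simp: matrix_works matrix_left_invertible_injective invertible_left_inverse)
    \<comment> \<open>The form on the image cone is the source form transported by the inverse
      \<open>K\<close> of the linear map.\<close>
    moreover have "euclidean_on F2 (\<Phi> ` C1)"
    proof (rule euclidean_on_quadratic[of "\<lambda>z w. ?Q (K z) (K w)"])
      show "linear (\<lambda>w. ?Q (K z) (K w))" for z
        using linear_compose[OF K(1) form(1)] by (simp add: o_def)
      show "?Q (K z) (K w) = ?Q (K w) (K z)" for z w by (rule form(2))
      show "?Q (K z) (K z) > 0" if "z \<noteq> 0" for z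
        using form(3)[of "K z"] K that linear_0[OF L(1)] by metis
      show "F2 z = sqrt (?Q (K z) (K z))" if "z \<in> \<Phi> ` C1" for z
        using that L(3,4) K(2) by auto
    qed
    ultimately show ?thesis by blast
  qed
  ultimately show ?thesis by blast
qed

end
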